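(* Let $\mathcal{G}_h$ be an $m\times n$ rectangular subdivision of a rectangle $\Omega$. Then $$V_{h0}^{\rm MC}=V_{h0}^{\rm BL}\oplus\mathrm{span}\{\varphi_{0,K}\}_{K\in\mathcal{G}_h}.$$
   Context: An $m\times n$ rectangular subdivision of an axis-parallel rectangle $\Omega$ is the tensor-product partition into $mn$ axis-parallel rectangles $K$ ($m$ columns, $n$ rows, not necessarily of equal sizes). $V_{h0}^{\rm BL}$ is the space of $w_h\in H^1_0(\Omega)$ whose restriction to each $K\in\mathcal{G}_h$ is bilinear (in $Q_1(K)$). $V_{h0}^{\rm MC}$ (moment-continuous space with homogeneous boundary condition) is the space of $w_h\in L^2(\Omega)$ such that $w_h|_K\in P_2(K)$ (total degree at most 2) for all $K$; for every interior edge $e$, the jump $[w_h]_e$ across $e$ satisfies $\int_e [w_h]_e\,v\,ds=0$ for all $v\in P_1(e)$; and for every boundary edge $e$, $\int_e w_hv\,ds=0$ for all $v\in P_1(e)$. Equivalently, $w_h$ is continuous at the two second-order Gauss--Legendre points of each interior edge and vanishes at those of each boundary edge. For a cell $K$ with widths $\xi$ (in $x$) and $\eta$ (in $y$), in local coordinates with the lower-left vertex of $K$ at the origin, $\varphi_{0,K}(x,y)=\frac{1}{\xi^2}x(\xi-x)+\frac1{\eta^2}y(\eta-y)-\theta_1\theta_2$ on $K$, where $\theta_1=\frac12(1-\frac1{\sqrt3})$, $\theta_2=\frac12(1+\frac1{\sqrt3})$ (so $\theta_1\theta_2=\frac16$), extended by zero outside $K$. *)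

theory Defs
  imports "HOL-Analysis.Analysis"
begin

section \<open>Functions modulo almost-everywhere equality\<close>

text \<open>
  Elements of \<open>L\<^sup>2(\<Omega>)\<close> are classes of functions.  We use one ambient real vector space: all
  functions on the plane modulo equality Lebesgue-a.e.; the space \<open>L\<^sup>2(\<Omega>)\<close> is embedded
  in it through extension by zero.
\<close>

type_synonym plane = "real \<times> real"

quotient_type ae_fun = "plane \<Rightarrow> real" / "\<lambda>f g. AE p in lborel. f p = g p"
  morphisms ae_rep ae_class
proof (rule equivpI)
  show "reflp (\<lambda>f g :: plane \<Rightarrow> real. AE p in lborel. f p = g p)"
    by (simp add: reflp_def)
  show "symp (\<lambda>f g :: plane \<Rightarrow> real. AE p in lborel. f p = g p)"
    by (simp add: symp_def eq_commute)
  show "transp (\<lambda>f g :: plane \<Rightarrow> real. AE p in lborel. f p = g p)"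
  proof (rule transpI)
    fix f g h :: "plane \<Rightarrow> real"
    assume "AE p in lborel. f p = g p" "AE p in lborel. g p = h p"
    then show "AE p in lborel. f p = h p" by eventually_elim simp
  qed
qed

instantiation ae_fun :: real_vector
begin

lift_definition zero_ae_fun :: ae_fun is "\<lambda>_. 0" .

lift_definition plus_ae_fun :: "ae_fun \<Rightarrow> ae_fun \<Rightarrow> ae_fun" is "\<lambda>f g p. f p + g p"
  by (auto elim: eventually_elim2)

lift_definition minus_ae_fun :: "ae_fun \<Rightarrow> ae_fun \<Rightarrow> ae_fun" is "\<lambda>f g p. f p - g p"
  by (auto elim: eventually_elim2)

lift_definition uminus_ae_fun :: "ae_fun \<Rightarrow> ae_fun" is "\<lambda>f p. - f p"
  by simp

lift_definition scaleR_ae_fun :: "real \<Rightarrow> ae_fun \<Rightarrow> ae_fun" is "\<lambda>c f p. c * f p"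
  by (auto elim: eventually_mono)

instance
  by standard (transfer; simp add: algebra_simps)+

end

lift_definition agrees_on :: "ae_fun \<Rightarrow> plane set \<Rightarrow> (plane \<Rightarrow> real) \<Rightarrow> bool"
  is "\<lambda>f K q. AE p in lborel. p \<in> K \<longrightarrow> f p = q p"
  by (intro ext eventually_subst) (auto elim: eventually_mono)

definition direct_sum :: "'a::real_vector set \<Rightarrow> 'a set \<Rightarrow> 'a set \<Rightarrow> bool" where
  "direct_sum U V W \<longleftrightarrow>
     subspace V \<and> subspace W \<and> V \<inter> W = {0} \<and> U = {v + w | v w. v \<in> V \<and> w \<in> W}"

section \<open>The spaces \<open>L\<^sup>2(\<Omega>)\<close> and \<open>H\<^sub>0\<^sup>1(\<Omega>)\<close>\<close>

definition sq_integrable :: "plane set \<Rightarrow> (plane \<Rightarrow> real) set" where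
  "sq_integrable \<Omega> = {f. f \<in> borel_measurable lborel \<and> (\<forall>p. p \<notin> \<Omega> \<longrightarrow> f p = 0) \<and>
     integrable lborel (\<lambda>p. (f p)\<^sup>2)}"

definition L2 :: "plane set \<Rightarrow> ae_fun set" where
  "L2 \<Omega> = ae_class ` sq_integrable \<Omega>"

definition partial :: "plane \<Rightarrow> (plane \<Rightarrow> real) \<Rightarrow> plane \<Rightarrow> real" where
  "partial b f p = frechet_derivative f (at p) b"

primrec Ck :: "nat \<Rightarrow> (plane \<Rightarrow> real) \<Rightarrow> bool" where
  "Ck 0 f \<longleftrightarrow> continuous_on UNIV f"
| "Ck (Suc k) f \<longleftrightarrow> f differentiable_on UNIV \<and> (\<forall>b\<in>Basis. Ck k (partial b f))"

definition test_functions :: "plane set \<Rightarrow> (plane \<Rightarrow> real) set" where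
  "test_functions \<Omega> = {\<phi>. (\<forall>k. Ck k \<phi>) \<and>
     (\<exists>C. compact C \<and> C \<subseteq> \<Omega> \<and> (\<forall>p. p \<notin> C \<longrightarrow> \<phi> p = 0))}"

definition weak_partial :: "plane set \<Rightarrow> plane \<Rightarrow> (plane \<Rightarrow> real) \<Rightarrow> (plane \<Rightarrow> real) \<Rightarrow> bool" where
  "weak_partial \<Omega> b f g \<longleftrightarrow> (\<forall>\<psi>\<in>test_functions \<Omega>.
     (LINT p:\<Omega>|lborel. f p * partial b \<psi> p) = - (LINT p:\<Omega>|lborel. g p * \<psi> p))"

text \<open>
  The space \<open>H\<^sub>0\<^sup>1(\<Omega>)\<close> is the closure of the test functions in \<open>H\<^sup>1(\<Omega>)\<close>; the family \<open>g\<close> below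
  is the weak gradient of \<open>f\<close>, and the last condition bounds the squared
  \<open>H\<^sup>1\<close> norm of the difference of \<open>f\<close> and \<open>\<phi>\<close>.
\<close>

definition H10 :: "plane set \<Rightarrow> ae_fun set" where
  "H10 \<Omega> = {ae_class f | f g. f \<in> sq_integrable \<Omega> \<and>
     (\<forall>b\<in>Basis. g b \<in> sq_integrable \<Omega> \<and> weak_partial \<Omega> b f (g b)) \<and>
     (\<forall>\<epsilon>>0. \<exists>\<phi>\<in>test_functions \<Omega>.
        (LINT p:\<Omega>|lborel. (f p - \<phi> p)\<^sup>2) +
        (\<Sum>b\<in>Basis. LINT p:\<Omega>|lborel. (g b p - partial b \<phi> p)\<^sup>2) < \<epsilon>)}"

section \<open>Polynomials in two variables\<close>

definition P :: "nat \<Rightarrow> (plane \<Rightarrow> real) set" where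
  "P k = {q. \<exists>c :: nat \<Rightarrow> nat \<Rightarrow> real. \<forall>s t. q (s, t) = (\<Sum>i\<le>k. \<Sum>j\<le>k - i. c i j * s ^ i * t ^ j)}"

definition Q :: "nat \<Rightarrow> (plane \<Rightarrow> real) set" where
  "Q k = {q. \<exists>c :: nat \<Rightarrow> nat \<Rightarrow> real. \<forall>s t. q (s, t) = (\<Sum>i\<le>k. \<Sum>j\<le>k. c i j * s ^ i * t ^ j)}"

section \<open>Rectangular subdivisions\<close>

text \<open>
  The grid lines are \<open>X 0 < \<dots> < X m\<close> and \<open>Y 0 < \<dots> < Y n\<close>; values of \<open>X\<close>, \<open>Y\<close> at larger indices
  are irrelevant.  A cell is named by its column and row index.
\<close>

definition rectangular_subdivision ::
  "plane set \<Rightarrow> nat \<Rightarrow> nat \<Rightarrow> (nat \<Rightarrow> real) \<Rightarrow> (nat \<Rightarrow> real) \<Rightarrow> bool" where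
  "rectangular_subdivision \<Omega> m n X Y \<longleftrightarrow>
     1 \<le> m \<and> 1 \<le> n \<and> strict_mono_on {..m} X \<and> strict_mono_on {..n} Y \<and>
     \<Omega> = box (X 0, Y 0) (X m, Y n)"

definition cells :: "nat \<Rightarrow> nat \<Rightarrow> (nat \<times> nat) set" where
  "cells m n = {..<m} \<times> {..<n}"

fun cell :: "(nat \<Rightarrow> real) \<Rightarrow> (nat \<Rightarrow> real) \<Rightarrow> nat \<times> nat \<Rightarrow> plane set" where
  "cell X Y (i, j) = cbox (X i, Y j) (X (Suc i), Y (Suc j))"

text \<open>
  An edge is the pair of its end points, ordered left to right or bottom to top, so that an edge
  common to two cells is the same pair for both.
\<close>

fun edges :: "(nat \<Rightarrow> real) \<Rightarrow> (nat \<Rightarrow> real) \<Rightarrow> nat \<times> nat \<Rightarrow> (plane \<times> plane) set" where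
  "edges X Y (i, j) =
    {((X i, Y j), (X (Suc i), Y j)),
     ((X i, Y (Suc j)), (X (Suc i), Y (Suc j))),
     ((X i, Y j), (X i, Y (Suc j))),
     ((X (Suc i), Y j), (X (Suc i), Y (Suc j)))}"

definition edge_integral :: "plane \<times> plane \<Rightarrow> (plane \<Rightarrow> real) \<Rightarrow> real" where
  "edge_integral e f = dist (fst e) (snd e) * integral {0..1} (\<lambda>t. f (linepath (fst e) (snd e) t))"

section \<open>The finite element spaces\<close>

definition V_BL :: "plane set \<Rightarrow> nat \<Rightarrow> nat \<Rightarrow> (nat \<Rightarrow> real) \<Rightarrow> (nat \<Rightarrow> real) \<Rightarrow> ae_fun set" where
  "V_BL \<Omega> m n X Y =
     {w \<in> H10 \<Omega>. \<forall>K\<in>cells m n. \<exists>q\<in>Q 1. agrees_on w (cell X Y K) q}"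

text \<open>
  The polynomials \<open>q K\<close> are determined by \<open>w\<close> and supply its one-sided traces on the edges.
  The functions in \<open>P\<^sub>1(e)\<close> are the restrictions to \<open>e\<close> of the affine functions of the plane.
\<close>

definition V_MC :: "plane set \<Rightarrow> nat \<Rightarrow> nat \<Rightarrow> (nat \<Rightarrow> real) \<Rightarrow> (nat \<Rightarrow> real) \<Rightarrow> ae_fun set" where
  "V_MC \<Omega> m n X Y =
     {w \<in> L2 \<Omega>. \<exists>q :: nat \<times> nat \<Rightarrow> plane \<Rightarrow> real.
        (\<forall>K\<in>cells m n. q K \<in> P 2 \<and> agrees_on w (cell X Y K) (q K)) \<and>
        (\<forall>K\<in>cells m n. \<forall>K'\<in>cells m n. \<forall>e\<in>edges X Y K \<inter> edges X Y K'. K \<noteq> K' \<longrightarrow>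
           (\<forall>v\<in>P 1. edge_integral e (\<lambda>p. (q K p - q K' p) * v p) = 0)) \<and>
        (\<forall>K\<in>cells m n. \<forall>e\<in>edges X Y K. (\<forall>K'\<in>cells m n. e \<in> edges X Y K' \<longrightarrow> K' = K) \<longrightarrow>
           (\<forall>v\<in>P 1. edge_integral e (\<lambda>p. q K p * v p) = 0))}"

definition \<theta>1 :: real where "\<theta>1 = 1 / 2 * (1 - 1 / sqrt 3)"

definition \<theta>2 :: real where "\<theta>2 = 1 / 2 * (1 + 1 / sqrt 3)"

fun bubble :: "(nat \<Rightarrow> real) \<Rightarrow> (nat \<Rightarrow> real) \<Rightarrow> nat \<times> nat \<Rightarrow> plane \<Rightarrow> real" where
  "bubble X Y (i, j) (s, t) =
    (let \<xi> = X (Suc i) - X i; \<eta> = Y (Suc j) - Y j; x = s - X i; y = t - Y j in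
      if (s, t) \<in> cell X Y (i, j)
      then 1 / \<xi>\<^sup>2 * (x * (\<xi> - x)) + 1 / \<eta>\<^sup>2 * (y * (\<eta> - y)) - \<theta>1 * \<theta>2
      else 0)"

end

theory Submission
  imports Defs
begin

text \<open>
  A function of one variable in \<open>P\<^sub>2\<close> whose moments against \<open>P\<^sub>1\<close> vanish is a multiple of the second
  Legendre polynomial, so on every edge the jump of a function in \<open>V_MC\<close> has the same value at both end
  points, namely one sixth of its scaled second-order coefficient.  Going around a vertex, these relations
  force the scaled coefficients of \<open>x\<^sup>2\<close> and \<open>y\<^sup>2\<close> to coincide on each cell.  Subtracting the matching
  multiples of the bubbles therefore leaves a piecewise bilinear function with well-defined nodal values that
  vanish on the boundary, that is, a combination of tensor products of hat functions.  These lie in \<open>H10\<close>,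
  being limits of products of smooth compactly supported functions.  Conversely, if \<open>f\<close> in \<open>H10\<close> is
  extended by zero, the squared \<open>L\<^sup>2\<close> norm of \<open>f (p + h *\<^sub>R b) - f p\<close> is \<open>O(h\<^sup>2)\<close>, which rules out
  jumps of a piecewise polynomial \<open>f\<close>, also across the boundary.
\<close>

subsection \<open>Polynomials on edges\<close>

text \<open>The number 1/6 ties the argument together. The polynomial
  \<open>\<tau>^2 - \<tau> + 1/6\<close> has the value 1/6 at both ends of the unit interval, and
  the product \<open>\<theta>1 * \<theta>2\<close> of its zeros is the same 1/6. A bubble is
  therefore the negative of this polynomial on every edge of its cell, equals -1/6 at every vertex,
  and has both scaled second-order coefficients equal to -1. This dictates the coefficient of each
  bubble and the correction by one sixth that makes the nodal values single-valued.

  Two obstacles shape the analytic half. Elements are classes modulo null sets and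
  \<open>H10\<close> is defined by a closure, so no traces come with the definition: one-sided
  values are compared through translates, and membership in \<open>H10\<close> is shown by writing
  down smooth functions with compact support in the open rectangle whose derivatives stay bounded.
  Boundary edges are no special case: the function is zero outside, and the outside is treated as a
  frame of further cells carrying the zero polynomial.\<close>

lemma P_1_iff: "v \<in> P 1 \<longleftrightarrow> (\<exists>a b c. \<forall>s t. v (s, t) = a + b * s + c * t)"
proof
  assume "v \<in> P 1"
  then obtain c where "\<forall>s t. v (s, t) = (\<Sum>i\<le>1. \<Sum>j\<le>1 - i. c i j * s ^ i * t ^ j)"
    by (auto simp: P_def)
  then have "\<forall>s t. v (s, t) = c 0 0 + c 1 0 * s + c 0 1 * t"
    by (simp add: atMost_Suc algebra_simps)
  then show "\<exists>a b c. \<forall>s t. v (s, t) = a + b * s + c * t" by blast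
next
  assume "\<exists>a b c. \<forall>s t. v (s, t) = a + b * s + c * t"
  then obtain a b c where *: "\<forall>s t. v (s, t) = a + b * s + c * t" by blast
  let ?c = "\<lambda>i j :: nat. if i = 0 then if j = 0 then a else c else b"
  have "\<forall>s t. v (s, t) = (\<Sum>i\<le>1. \<Sum>j\<le>1 - i. ?c i j * s ^ i * t ^ j)"
    by (simp add: * atMost_Suc algebra_simps)
  then show "v \<in> P 1" unfolding P_def by (intro CollectI exI[of _ ?c])
qed

lemma P_2_iff:
  "v \<in> P 2 \<longleftrightarrow> (\<exists>a b c d e f. \<forall>s t. v (s, t) = a + b * s + c * t + d * (s * t) + e * s\<^sup>2 + f * t\<^sup>2)"
proof
  assume "v \<in> P 2"
  then obtain c where "\<forall>s t. v (s, t) = (\<Sum>i\<le>2. \<Sum>j\<le>2 - i. c i j * s ^ i * t ^ j)"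
    by (auto simp: P_def)
  then have "\<forall>s t. v (s, t) = c 0 0 + c 1 0 * s + c 0 1 * t + c 1 1 * (s * t) + c 2 0 * s\<^sup>2 + c 0 2 * t\<^sup>2"
    by (simp add: atMost_Suc numeral_2_eq_2 algebra_simps)
  then show "\<exists>a b c d e f. \<forall>s t. v (s, t) = a + b * s + c * t + d * (s * t) + e * s\<^sup>2 + f * t\<^sup>2" by blast
next
  assume "\<exists>a b c d e f. \<forall>s t. v (s, t) = a + b * s + c * t + d * (s * t) + e * s\<^sup>2 + f * t\<^sup>2"
  then obtain a b c d e f where *: "\<forall>s t. v (s, t) = a + b * s + c * t + d * (s * t) + e * s\<^sup>2 + f * t\<^sup>2"
    by blast
  let ?c = "\<lambda>i j :: nat. if i = 0 then if j = 0 then a else if j = 1 then c else f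
              else if i = 1 then if j = 0 then b else d else e"
  have "\<forall>s t. v (s, t) = (\<Sum>i\<le>2. \<Sum>j\<le>2 - i. ?c i j * s ^ i * t ^ j)"
    by (simp add: * atMost_Suc numeral_2_eq_2 algebra_simps)
  then show "v \<in> P 2" unfolding P_def by (intro CollectI exI[of _ ?c])
qed

lemma Q_1_iff: "v \<in> Q 1 \<longleftrightarrow> (\<exists>a b c d. \<forall>s t. v (s, t) = a + b * s + c * t + d * (s * t))"
proof
  assume "v \<in> Q 1"
  then obtain c where "\<forall>s t. v (s, t) = (\<Sum>i\<le>1. \<Sum>j\<le>1. c i j * s ^ i * t ^ j)"
    by (auto simp: Q_def)
  then have "\<forall>s t. v (s, t) = c 0 0 + c 1 0 * s + c 0 1 * t + c 1 1 * (s * t)"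
    by (simp add: atMost_Suc algebra_simps)
  then show "\<exists>a b c d. \<forall>s t. v (s, t) = a + b * s + c * t + d * (s * t)" by blast
next
  assume "\<exists>a b c d. \<forall>s t. v (s, t) = a + b * s + c * t + d * (s * t)"
  then obtain a b c d where *: "\<forall>s t. v (s, t) = a + b * s + c * t + d * (s * t)" by blast
  let ?c = "\<lambda>i j :: nat. if i = 0 then if j = 0 then a else c else if j = 0 then b else d"
  have "\<forall>s t. v (s, t) = (\<Sum>i\<le>1. \<Sum>j\<le>1. ?c i j * s ^ i * t ^ j)"
    by (simp add: * atMost_Suc algebra_simps)
  then show "v \<in> Q 1" unfolding Q_def by (intro CollectI exI[of _ ?c])
qed

lemma Q_1_subset_P_2: "Q 1 \<subseteq> P 2"
proof
  fix q assume "q \<in> Q 1"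
  then obtain a b c d where "\<forall>s t. q (s, t) = a + b * s + c * t + d * (s * t)"
    unfolding Q_1_iff by blast
  then have "\<forall>s t. q (s, t) = a + b * s + c * t + d * (s * t) + 0 * s\<^sup>2 + 0 * t\<^sup>2" by simp
  then show "q \<in> P 2" unfolding P_2_iff by blast
qed

lemma P_zero: "(\<lambda>_. 0) \<in> P k"
  unfolding P_def by (auto intro: exI[of _ "\<lambda>_ _. 0"])

lemma P_lincomb: "(\<lambda>p. x * q p + y * r p) \<in> P k" if "q \<in> P k" "r \<in> P k"
proof -
  from that obtain c d where
    "\<forall>s t. q (s, t) = (\<Sum>i\<le>k. \<Sum>j\<le>k - i. c i j * s ^ i * t ^ j)"
    "\<forall>s t. r (s, t) = (\<Sum>i\<le>k. \<Sum>j\<le>k - i. d i j * s ^ i * t ^ j)"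
    by (auto simp: P_def)
  then have "\<forall>s t. x * q (s, t) + y * r (s, t) = (\<Sum>i\<le>k. \<Sum>j\<le>k - i. (x * c i j + y * d i j) * s ^ i * t ^ j)"
    by (simp add: sum_distrib_left sum.distrib distrib_right mult.assoc)
  then show ?thesis unfolding P_def by (intro CollectI exI[of _ "\<lambda>i j. x * c i j + y * d i j"])
qed

lemma Q_lincomb: "(\<lambda>p. x * q p + y * r p) \<in> Q k" if "q \<in> Q k" "r \<in> Q k"
proof -
  from that obtain c d where
    "\<forall>s t. q (s, t) = (\<Sum>i\<le>k. \<Sum>j\<le>k. c i j * s ^ i * t ^ j)"
    "\<forall>s t. r (s, t) = (\<Sum>i\<le>k. \<Sum>j\<le>k. d i j * s ^ i * t ^ j)"
    by (auto simp: Q_def)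
  then have "\<forall>s t. x * q (s, t) + y * r (s, t) = (\<Sum>i\<le>k. \<Sum>j\<le>k. (x * c i j + y * d i j) * s ^ i * t ^ j)"
    by (simp add: sum_distrib_left sum.distrib distrib_right mult.assoc)
  then show ?thesis unfolding Q_def by (intro CollectI exI[of _ "\<lambda>i j. x * c i j + y * d i j"])
qed

lemma continuous_on_P_2: "continuous_on A q" if "q \<in> P 2"
proof -
  from that obtain a b c d e f where
    *: "\<forall>s t. q (s, t) = a + b * s + c * t + d * (s * t) + e * s\<^sup>2 + f * t\<^sup>2"
    unfolding P_2_iff by blast
  have "q = (\<lambda>p. a + b * fst p + c * snd p + d * (fst p * snd p) + e * (fst p)\<^sup>2 + f * (snd p)\<^sup>2)"
    using * by (auto simp: fun_eq_iff)
  then show ?thesis by (auto intro!: continuous_intros)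
qed

lemma P_2_linepath:
  assumes "J \<in> P 2"
  obtains u0 u1 u2 where "\<And>\<tau>. J (linepath p p' \<tau>) = u0 + u1 * \<tau> + u2 * \<tau>\<^sup>2"
proof -
  obtain s0 t0 s1 t1 where pp: "p = (s0, t0)" "p' = (s1, t1)" by (cases p, cases p') auto
  obtain a b c d e f where
    J: "\<forall>s t. J (s, t) = a + b * s + c * t + d * (s * t) + e * s\<^sup>2 + f * t\<^sup>2"
    using assms unfolding P_2_iff by blast
  have L: "linepath p p' \<tau> = (s0 + \<tau> * (s1 - s0), t0 + \<tau> * (t1 - t0))" for \<tau>
    by (simp add: linepath_def pp algebra_simps)
  show ?thesis
  proof
    show "J (linepath p p' \<tau>) = (a + b * s0 + c * t0 + d * (s0 * t0) + e * s0\<^sup>2 + f * t0\<^sup>2) +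
       (b * (s1 - s0) + c * (t1 - t0) + d * (s0 * (t1 - t0) + t0 * (s1 - s0)) +
         2 * e * s0 * (s1 - s0) + 2 * f * t0 * (t1 - t0)) * \<tau> +
       (d * (s1 - s0) * (t1 - t0) + e * (s1 - s0)\<^sup>2 + f * (t1 - t0)\<^sup>2) * \<tau>\<^sup>2" for \<tau>
      unfolding L using J by (simp add: power2_eq_square algebra_simps)
  qed
qed

text \<open>Up to scaling, \<open>\<tau>\<^sup>2 - \<tau> + 1 / 6\<close> is the second Legendre polynomial of the unit interval.\<close>

definition legendre_multiple :: "plane \<Rightarrow> plane \<Rightarrow> (plane \<Rightarrow> real) \<Rightarrow> bool" where
  "legendre_multiple p p' J \<longleftrightarrow> (\<exists>C. \<forall>\<tau>. J (linepath p p' \<tau>) = C * (\<tau>\<^sup>2 - \<tau> + 1 / 6))"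

lemma integral_cubic:
  "((\<lambda>\<tau>. a + b * \<tau> + c * \<tau>\<^sup>2 + d * \<tau> ^ 3) has_integral a + b / 2 + c / 3 + d / 4) {0..1::real}"
proof -
  let ?F = "\<lambda>\<tau>. a * \<tau> + b / 2 * \<tau>\<^sup>2 + c / 3 * \<tau> ^ 3 + d / 4 * \<tau> ^ 4"
  have "((\<lambda>\<tau>. a + b * \<tau> + c * \<tau>\<^sup>2 + d * \<tau> ^ 3) has_integral ?F 1 - ?F 0) {0..1}"
    by (intro fundamental_theorem_of_calculus)
       (auto intro!: derivative_eq_intros simp flip: has_real_derivative_iff_has_vector_derivative)
  then show ?thesis by simp
qed

text \<open>Because the end points differ, the affine functions of the plane restrict to all affine
  functions of the parameter. Testing with 1 and with \<open>\<tau>\<close> gives two linear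
  equations for the three coefficients of a quadratic, which leaves a single free one.\<close>

lemma edge_integral_zero_iff:
  assumes J: "J \<in> P 2" and ne: "p \<noteq> p'"
  shows "(\<forall>v\<in>P 1. edge_integral (p, p') (\<lambda>z. J z * v z) = 0) \<longleftrightarrow> legendre_multiple p p' J"
proof -
  obtain s0 t0 s1 t1 where pp: "p = (s0, t0)" "p' = (s1, t1)" by (cases p, cases p') auto
  define L where "L = linepath p p'"
  have L: "L \<tau> = (s0 + \<tau> * (s1 - s0), t0 + \<tau> * (t1 - t0))" for \<tau>
    by (simp add: L_def linepath_def pp algebra_simps)
  obtain u0 u1 u2 where JL: "\<And>\<tau>. J (L \<tau>) = u0 + u1 * \<tau> + u2 * \<tau>\<^sup>2"
    using P_2_linepath[OF J, of p p'] unfolding L_def by blast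
  have int: "integral {0..1} (\<lambda>\<tau>. J (L \<tau>) * (x + y * \<tau>)) =
      u0 * x + (u0 * y + u1 * x) / 2 + (u1 * y + u2 * x) / 3 + u2 * y / 4" for x y
  proof -
    have "(\<lambda>\<tau>. J (L \<tau>) * (x + y * \<tau>)) =
        (\<lambda>\<tau>. u0 * x + (u0 * y + u1 * x) * \<tau> + (u1 * y + u2 * x) * \<tau>\<^sup>2 + u2 * y * \<tau> ^ 3)"
      by (simp add: fun_eq_iff JL power2_eq_square power3_eq_cube algebra_simps)
    then show ?thesis using integral_cubic by (simp add: integral_unique)
  qed
  have edge: "edge_integral (p, p') (\<lambda>z. J z * v z) =
      dist p p' * (u0 * x + (u0 * y + u1 * x) / 2 + (u1 * y + u2 * x) / 3 + u2 * y / 4)"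
    if "\<And>\<tau>. v (L \<tau>) = x + y * \<tau>" for v x y
    using int that by (simp add: edge_integral_def flip: L_def)
  show ?thesis
  proof
    assume *: "\<forall>v\<in>P 1. edge_integral (p, p') (\<lambda>z. J z * v z) = 0"
    define N where "N = (s1 - s0)\<^sup>2 + (t1 - t0)\<^sup>2"
    have N: "N \<noteq> 0" using ne by (auto simp: N_def pp sum_power2_eq_zero_iff)
    \<comment> \<open>\<open>v\<close> is the coordinate along the segment, from the orthogonal
      projection onto its direction; on the segment it equals \<open>\<tau>\<close>.\<close>
    define v where "v = (\<lambda>(s, t). ((s - s0) * (s1 - s0) + (t - t0) * (t1 - t0)) / N)"
    have "\<forall>s t. v (s, t) = (- (s0 * (s1 - s0) + t0 * (t1 - t0)) / N) + ((s1 - s0) / N) * s + ((t1 - t0) / N) * t"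
      unfolding v_def using N by (simp add: field_simps)
    then have v: "v \<in> P 1" unfolding P_1_iff by blast
    have vL: "v (L \<tau>) = 0 + 1 * \<tau>" for \<tau>
      using N unfolding v_def L N_def by (simp add: field_simps power2_eq_square)
    have "\<forall>s t. (\<lambda>_. 1) (s, t) = 1 + 0 * s + 0 * (t :: real)" by simp
    then have one: "(\<lambda>_. 1) \<in> P 1" unfolding P_1_iff by blast
    have "u0 / 2 + u1 / 3 + u2 / 4 = 0" using edge[OF vL] bspec[OF * v] ne by simp
    moreover have "u0 + u1 / 2 + u2 / 3 = 0" using edge[of "\<lambda>_. 1" 1 0] bspec[OF * one] ne by simp
    ultimately have "u1 = - u2" "u0 = u2 / 6" by auto
    then have "\<forall>\<tau>. J (L \<tau>) = u2 * (\<tau>\<^sup>2 - \<tau> + 1 / 6)" by (simp add: JL algebra_simps)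
    then show "legendre_multiple p p' J" by (auto simp: legendre_multiple_def L_def)
  next
    assume "legendre_multiple p p' J"
    then obtain C where C: "\<And>\<tau>. J (L \<tau>) = C * (\<tau>\<^sup>2 - \<tau> + 1 / 6)"
      by (auto simp: legendre_multiple_def L_def)
    \<comment> \<open>Three values determine the quadratic; the identity holds for every real
      parameter, so -1 can serve as the third one.\<close>
    have u: "u0 = C / 6" "u1 = - C" "u2 = C"
      using C[of 0] C[of 1] C[of "-1"] JL[of 0] JL[of 1] JL[of "-1"] by auto
    show "\<forall>v\<in>P 1. edge_integral (p, p') (\<lambda>z. J z * v z) = 0"
    proof
      fix v assume "v \<in> P 1"
      then obtain k l r where v: "\<forall>s t. v (s, t) = k + l * s + r * t"
        unfolding P_1_iff by blast
      have "v (L \<tau>) = (k + l * s0 + r * t0) + (l * (s1 - s0) + r * (t1 - t0)) * \<tau>" for \<tau>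
        unfolding L using v by (simp add: algebra_simps)
      from edge[OF this] show "edge_integral (p, p') (\<lambda>z. J z * v z) = 0"
        by (simp add: u field_simps)
    qed
  qed
qed

text \<open>On the right and upper sides of the rectangle the outer function comes first in the
  difference, so the jump is the negative of the inner polynomial.\<close>

lemma legendre_multiple_uminus: "legendre_multiple p p' (\<lambda>z. - J z) \<longleftrightarrow> legendre_multiple p p' J"
  unfolding legendre_multiple_def
  by (metis (no_types) minus_minus mult_minus_left)

lemma legendre_multiple_lincomb:
  "legendre_multiple p p' (\<lambda>z. x * J z + y * J' z)"
  if "legendre_multiple p p' J" "legendre_multiple p p' J'"
proof -
  from that obtain C C' where "\<forall>\<tau>. J (linepath p p' \<tau>) = C * (\<tau>\<^sup>2 - \<tau> + 1 / 6)"
    "\<forall>\<tau>. J' (linepath p p' \<tau>) = C' * (\<tau>\<^sup>2 - \<tau> + 1 / 6)"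
    by (auto simp: legendre_multiple_def)
  then have "\<forall>\<tau>. x * J (linepath p p' \<tau>) + y * J' (linepath p p' \<tau>) = (x * C + y * C') * (\<tau>\<^sup>2 - \<tau> + 1 / 6)"
    by (simp only: distrib_right mult.assoc simp_thms)
  then show ?thesis unfolding legendre_multiple_def by blast
qed

text \<open>Indices are shifted by one, so that the cells outside the grid also have natural indices.\<close>

definition shifted :: "nat \<Rightarrow> nat \<Rightarrow> (nat \<times> nat \<Rightarrow> plane \<Rightarrow> real) \<Rightarrow> nat \<Rightarrow> nat \<Rightarrow> plane \<Rightarrow> real" where
  "shifted m n q a b = (if 0 < a \<and> a \<le> m \<and> 0 < b \<and> b \<le> n then q (a - 1, b - 1) else (\<lambda>_. 0))"

text \<open>Every edge of the grid is listed exactly once, with the cells on its two sides. On a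
  boundary edge one of them is the zero function of \<open>shifted\<close>, so interior and boundary
  conditions take one form.\<close>

definition moment_matched ::
  "nat \<Rightarrow> nat \<Rightarrow> (nat \<Rightarrow> real) \<Rightarrow> (nat \<Rightarrow> real) \<Rightarrow> (nat \<times> nat \<Rightarrow> plane \<Rightarrow> real) \<Rightarrow> bool" where
  "moment_matched m n X Y q \<longleftrightarrow>
     (\<forall>i\<le>m. \<forall>j<n. legendre_multiple (X i, Y j) (X i, Y (Suc j))
        (\<lambda>p. shifted m n q (Suc i) (Suc j) p - shifted m n q i (Suc j) p)) \<and>
     (\<forall>i<m. \<forall>j\<le>n. legendre_multiple (X i, Y j) (X (Suc i), Y j)
        (\<lambda>p. shifted m n q (Suc i) (Suc j) p - shifted m n q (Suc i) j p))"

lemma shifted_in_P_2: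
  assumes "\<forall>K\<in>cells m n. q K \<in> P 2"
  shows "shifted m n q a b \<in> P 2"
  using assms P_zero by (auto simp: shifted_def cells_def)

lemma moment_matched_lincomb:
  assumes "moment_matched m n X Y q" "moment_matched m n X Y r"
  shows "moment_matched m n X Y (\<lambda>K p. x * q K p + y * r K p)"
proof -
  have *: "shifted m n (\<lambda>K p. x * q K p + y * r K p) a b p - shifted m n (\<lambda>K p. x * q K p + y * r K p) a' b' p =
     x * (shifted m n q a b p - shifted m n q a' b' p) + y * (shifted m n r a b p - shifted m n r a' b' p)"
    for a b a' b' p
    by (simp add: shifted_def algebra_simps)
  show ?thesis
    using assms unfolding moment_matched_def * by (auto intro!: legendre_multiple_lincomb)
qed

text \<open>Since the grid lines are distinct, the end points of an edge determine the one or two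
  cells to which it belongs. Quantifying over pairs of cells with a common edge then amounts to
  quantifying over edges with their two sides.\<close>

lemma V_MC_eq:
  assumes "rectangular_subdivision \<Omega> m n X Y"
  shows "V_MC \<Omega> m n X Y = {w \<in> L2 \<Omega>. \<exists>q. (\<forall>K\<in>cells m n. q K \<in> P 2 \<and> agrees_on w (cell X Y K) (q K)) \<and>
     moment_matched m n X Y q}"
proof -
  have X: "X i = X i' \<longleftrightarrow> i = i'" if "i \<le> m" "i' \<le> m" for i i'
    using assms that by (auto simp: rectangular_subdivision_def strict_mono_on_eq)
  have Y: "Y i = Y i' \<longleftrightarrow> i = i'" if "i \<le> n" "i' \<le> n" for i i'
    using assms that by (auto simp: rectangular_subdivision_def strict_mono_on_eq)
  have "((\<forall>K\<in>cells m n. \<forall>K'\<in>cells m n. \<forall>e\<in>edges X Y K \<inter> edges X Y K'. K \<noteq> K' \<longrightarrow>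
           (\<forall>v\<in>P 1. edge_integral e (\<lambda>p. (q K p - q K' p) * v p) = 0)) \<and>
        (\<forall>K\<in>cells m n. \<forall>e\<in>edges X Y K. (\<forall>K'\<in>cells m n. e \<in> edges X Y K' \<longrightarrow> K' = K) \<longrightarrow>
           (\<forall>v\<in>P 1. edge_integral e (\<lambda>p. q K p * v p) = 0))) \<longleftrightarrow> moment_matched m n X Y q"
    (is "?int \<and> ?bdry \<longleftrightarrow> _")
    if q: "\<forall>K\<in>cells m n. q K \<in> P 2" for q
  proof -
    define lm where "lm = (\<lambda>e. legendre_multiple (fst e) (snd e))"
    have ne: "fst e \<noteq> snd e" if "K \<in> cells m n" "e \<in> edges X Y K" for K e
      using that by (cases K) (auto simp: cells_def X Y)
    have diff: "(\<lambda>p. q K p - q K' p) \<in> P 2" if "K \<in> cells m n" "K' \<in> cells m n" for K K'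
      using P_lincomb[of "q K" 2 "q K'" 1 "-1"] q that by simp
    have edge: "(\<forall>v\<in>P 1. edge_integral e (\<lambda>p. J p * v p) = 0) \<longleftrightarrow> lm e J"
      if "K \<in> cells m n" "e \<in> edges X Y K" "J \<in> P 2" for K e J
      using edge_integral_zero_iff[OF that(3) ne[OF that(1,2)]] by (simp add: lm_def)
    have int: "?int \<longleftrightarrow> (\<forall>K\<in>cells m n. \<forall>K'\<in>cells m n. \<forall>e\<in>edges X Y K \<inter> edges X Y K'. K \<noteq> K' \<longrightarrow>
           lm e (\<lambda>p. q K p - q K' p))"
      by (intro ball_cong refl imp_cong edge diff; blast)
    have bdry: "?bdry \<longleftrightarrow> (\<forall>K\<in>cells m n. \<forall>e\<in>edges X Y K. (\<forall>K'\<in>cells m n. e \<in> edges X Y K' \<longrightarrow> K' = K) \<longrightarrow>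
           lm e (q K))"
      using q by (intro ball_cong refl imp_cong edge; blast)
    show ?thesis
      unfolding int bdry
    proof (intro iffI conjI)
      assume *: "(\<forall>K\<in>cells m n. \<forall>K'\<in>cells m n. \<forall>e\<in>edges X Y K \<inter> edges X Y K'. K \<noteq> K' \<longrightarrow>
           lm e (\<lambda>p. q K p - q K' p)) \<and>
         (\<forall>K\<in>cells m n. \<forall>e\<in>edges X Y K. (\<forall>K'\<in>cells m n. e \<in> edges X Y K' \<longrightarrow> K' = K) \<longrightarrow> lm e (q K))"
      then have i: "\<And>K K' e. K \<in> cells m n \<Longrightarrow> K' \<in> cells m n \<Longrightarrow> e \<in> edges X Y K \<Longrightarrow> e \<in> edges X Y K' \<Longrightarrow>
          K \<noteq> K' \<Longrightarrow> lm e (\<lambda>p. q K p - q K' p)"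
        and b: "\<And>K e. K \<in> cells m n \<Longrightarrow> e \<in> edges X Y K \<Longrightarrow>
          (\<And>K'. K' \<in> cells m n \<Longrightarrow> e \<in> edges X Y K' \<Longrightarrow> K' = K) \<Longrightarrow> lm e (q K)"
        by blast+
      have m: "1 \<le> m" and n: "1 \<le> n" using assms by (auto simp: rectangular_subdivision_def)
      have "lm ((X i, Y j), (X i, Y (Suc j)))
          (\<lambda>p. shifted m n q (Suc i) (Suc j) p - shifted m n q i (Suc j) p)" if "i \<le> m" "j < n" for i j
      proof -
        \<comment> \<open>Left boundary, right boundary, interior: only in the last case are there
          cells of the grid on both sides.\<close>
        consider "i = 0" | k where "i = Suc k" "i = m" | k where "i = Suc k" "i < m"
          using \<open>i \<le> m\<close> by (cases i) fastforce+
        then show ?thesis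
        proof cases
          case 1
          then show ?thesis
            using b[of "(0, j)" "((X i, Y j), (X i, Y (Suc j)))"] that m
            by (auto simp: shifted_def cells_def X Y)
        next
          case 2
          then show ?thesis
            using b[of "(k, j)" "((X i, Y j), (X i, Y (Suc j)))"] that m
            by (auto simp: shifted_def cells_def X Y lm_def legendre_multiple_uminus)
        next
          case 3
          then show ?thesis
            using i[of "(i, j)" "(k, j)" "((X i, Y j), (X i, Y (Suc j)))"] that m
            by (auto simp: shifted_def cells_def X Y)
        qed
      qed
      moreover have "lm ((X i, Y j), (X (Suc i), Y j))
          (\<lambda>p. shifted m n q (Suc i) (Suc j) p - shifted m n q (Suc i) j p)" if "i < m" "j \<le> n" for i j
      proof -
        consider "j = 0" | k where "j = Suc k" "j = n" | k where "j = Suc k" "j < n"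
          using \<open>j \<le> n\<close> by (cases j) fastforce+
        then show ?thesis
        proof cases
          case 1
          then show ?thesis
            using b[of "(i, 0)" "((X i, Y j), (X (Suc i), Y j))"] that n
            by (auto simp: shifted_def cells_def X Y)
        next
          case 2
          then show ?thesis
            using b[of "(i, k)" "((X i, Y j), (X (Suc i), Y j))"] that n
            by (auto simp: shifted_def cells_def X Y lm_def legendre_multiple_uminus)
        next
          case 3
          then show ?thesis
            using i[of "(i, j)" "(i, k)" "((X i, Y j), (X (Suc i), Y j))"] that n
            by (auto simp: shifted_def cells_def X Y)
        qed
      qed
      ultimately show "moment_matched m n X Y q" by (simp add: moment_matched_def lm_def)
    next
      assume "moment_matched m n X Y q"
      then have v: "\<And>i j. i \<le> m \<Longrightarrow> j < n \<Longrightarrow> lm ((X i, Y j), (X i, Y (Suc j)))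
          (\<lambda>p. shifted m n q (Suc i) (Suc j) p - shifted m n q i (Suc j) p)"
        and h: "\<And>i j. i < m \<Longrightarrow> j \<le> n \<Longrightarrow> lm ((X i, Y j), (X (Suc i), Y j))
          (\<lambda>p. shifted m n q (Suc i) (Suc j) p - shifted m n q (Suc i) j p)"
        by (simp_all add: moment_matched_def lm_def)
      \<comment> \<open>In \<open>V_MC\<close> two neighbours occur in both orders, in
        \<open>moment_matched\<close> in one order only.\<close>
      have swap: "lm e (\<lambda>p. q K p - q K' p) \<longleftrightarrow> lm e (\<lambda>p. q K' p - q K p)" for e K K'
        using legendre_multiple_uminus[of "fst e" "snd e" "\<lambda>p. q K p - q K' p"] by (simp add: lm_def)
      have v': "lm ((X (Suc i), Y j), (X (Suc i), Y (Suc j))) (\<lambda>p. q (Suc i, j) p - q (i, j) p)"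
        if "Suc i < m" "j < n" for i j
        using v[of "Suc i" j] that by (simp add: shifted_def)
      have h': "lm ((X i, Y (Suc j)), (X (Suc i), Y (Suc j))) (\<lambda>p. q (i, Suc j) p - q (i, j) p)"
        if "i < m" "Suc j < n" for i j
        using h[of i "Suc j"] that by (simp add: shifted_def)
      show "\<forall>K\<in>cells m n. \<forall>K'\<in>cells m n. \<forall>e\<in>edges X Y K \<inter> edges X Y K'. K \<noteq> K' \<longrightarrow>
           lm e (\<lambda>p. q K p - q K' p)"
      proof (intro ballI impI)
        fix K K' e assume K: "K \<in> cells m n" "K' \<in> cells m n" and e: "e \<in> edges X Y K \<inter> edges X Y K'"
          and "K \<noteq> K'"
        obtain i j where ij: "K = (i, j)" "i < m" "j < n" using K by (auto simp: cells_def)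
        obtain i' j' where ij': "K' = (i', j')" "i' < m" "j' < n" using K by (auto simp: cells_def)
        \<comment> \<open>Distinct cells with a common edge are neighbours in a row or in a column,
          in either order.\<close>
        have "(i' = Suc i \<and> j' = j \<and> e = ((X i', Y j), (X i', Y (Suc j)))) \<or>
          (i = Suc i' \<and> j' = j \<and> e = ((X i, Y j), (X i, Y (Suc j)))) \<or>
          (i' = i \<and> j' = Suc j \<and> e = ((X i, Y j'), (X (Suc i), Y j'))) \<or>
          (i' = i \<and> j = Suc j' \<and> e = ((X i, Y j), (X (Suc i), Y j)))"
        proof -
          have eqs: "X i = X i' \<longleftrightarrow> i = i'" "X i = X (Suc i') \<longleftrightarrow> i = Suc i'" "X (Suc i) = X i' \<longleftrightarrow> Suc i = i'"
            "X (Suc i) = X (Suc i') \<longleftrightarrow> i = i'"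
            "Y j = Y j' \<longleftrightarrow> j = j'" "Y j = Y (Suc j') \<longleftrightarrow> j = Suc j'" "Y (Suc j) = Y j' \<longleftrightarrow> Suc j = j'"
            "Y (Suc j) = Y (Suc j') \<longleftrightarrow> j = j'"
            using ij ij' by (simp_all add: X Y)
          have e': "e \<in> edges X Y (i', j')" and ne: "i \<noteq> i' \<or> j \<noteq> j'"
            using e \<open>K \<noteq> K'\<close> ij ij' by auto
          consider "e = ((X i, Y j), (X (Suc i), Y j))" | "e = ((X i, Y (Suc j)), (X (Suc i), Y (Suc j)))" |
            "e = ((X i, Y j), (X i, Y (Suc j)))" | "e = ((X (Suc i), Y j), (X (Suc i), Y (Suc j)))"
            using e ij by auto
          then show ?thesis
          proof cases
            case 1
            then have "i' = i \<and> j = Suc j'"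
              using e' ne by (simp only: edges.simps insert_iff empty_iff prod.inject eqs) presburger
            with 1 show ?thesis by blast
          next
            case 2
            then have "i' = i \<and> j' = Suc j"
              using e' ne by (simp only: edges.simps insert_iff empty_iff prod.inject eqs) presburger
            with 2 show ?thesis by blast
          next
            case 3
            then have "i = Suc i' \<and> j' = j"
              using e' ne by (simp only: edges.simps insert_iff empty_iff prod.inject eqs) presburger
            with 3 show ?thesis by blast
          next
            case 4
            then have "i' = Suc i \<and> j' = j"
              using e' ne by (simp only: edges.simps insert_iff empty_iff prod.inject eqs) presburger
            with 4 show ?thesis by blast
          qed
        qed
        then show "lm e (\<lambda>p. q K p - q K' p)"
          using v'[of i j] v'[of i' j] h'[of i j] h'[of i j'] swap[of e K K'] ij ij'
          by (elim disjE conjE) (simp_all only:)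
      qed
      show "\<forall>K\<in>cells m n. \<forall>e\<in>edges X Y K. (\<forall>K'\<in>cells m n. e \<in> edges X Y K' \<longrightarrow> K' = K) \<longrightarrow> lm e (q K)"
      proof (intro ballI impI)
        fix K e assume K: "K \<in> cells m n" and e: "e \<in> edges X Y K"
          and u: "\<forall>K'\<in>cells m n. e \<in> edges X Y K' \<longrightarrow> K' = K"
        obtain i j where ij: "K = (i, j)" "i < m" "j < n" using K by (auto simp: cells_def)
        consider "e = ((X i, Y j), (X (Suc i), Y j))" | "e = ((X i, Y (Suc j)), (X (Suc i), Y (Suc j)))" |
          "e = ((X i, Y j), (X i, Y (Suc j)))" | "e = ((X (Suc i), Y j), (X (Suc i), Y (Suc j)))"
          using e ij by auto
        then show "lm e (q K)"
        proof cases
          case 1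
          \<comment> \<open>Otherwise the cell below would contain the same edge, against the
            uniqueness of \<open>K\<close>; the other three sides are treated alike.\<close>
          have "j = 0"
          proof (rule ccontr)
            assume "j \<noteq> 0"
            then have "(i, j - 1) \<in> cells m n" "e \<in> edges X Y (i, j - 1)" using ij 1 by (auto simp: cells_def)
            then have "(i, j - 1) = K" using u by blast
            then show False using ij \<open>j \<noteq> 0\<close> by auto
          qed
          then show ?thesis using h[of i 0] 1 ij by (simp add: shifted_def)
        next
          case 2
          have "Suc j = n"
          proof (rule ccontr)
            assume "Suc j \<noteq> n"
            then have "(i, Suc j) \<in> cells m n" "e \<in> edges X Y (i, Suc j)" using ij 2 by (auto simp: cells_def)
            then have "(i, Suc j) = K" using u by blast
            then show False using ij by auto
          qed
          then show ?thesis using h[of i "Suc j"] 2 ij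
            by (auto simp: shifted_def lm_def legendre_multiple_uminus)
        next
          case 3
          have "i = 0"
          proof (rule ccontr)
            assume "i \<noteq> 0"
            then have "(i - 1, j) \<in> cells m n" "e \<in> edges X Y (i - 1, j)" using ij 3 by (auto simp: cells_def)
            then have "(i - 1, j) = K" using u by blast
            then show False using ij \<open>i \<noteq> 0\<close> by auto
          qed
          then show ?thesis using v[of 0 j] 3 ij by (simp add: shifted_def)
        next
          case 4
          have "Suc i = m"
          proof (rule ccontr)
            assume "Suc i \<noteq> m"
            then have "(Suc i, j) \<in> cells m n" "e \<in> edges X Y (Suc i, j)" using ij 4 by (auto simp: cells_def)
            then have "(Suc i, j) = K" using u by blast
            then show False using ij by auto
          qed
          then show ?thesis using v[of "Suc i" j] 4 ij
            by (auto simp: shifted_def lm_def legendre_multiple_uminus)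
        qed
      qed
    qed
  qed
  note equiv = this
  show ?thesis
    unfolding V_MC_def
  proof (rule Collect_cong, rule conj_cong[OF refl], rule iff_exI)
    fix w q
    show "((\<forall>K\<in>cells m n. q K \<in> P 2 \<and> agrees_on w (cell X Y K) (q K)) \<and>
        (\<forall>K\<in>cells m n. \<forall>K'\<in>cells m n. \<forall>e\<in>edges X Y K \<inter> edges X Y K'. K \<noteq> K' \<longrightarrow>
           (\<forall>v\<in>P 1. edge_integral e (\<lambda>p. (q K p - q K' p) * v p) = 0)) \<and>
        (\<forall>K\<in>cells m n. \<forall>e\<in>edges X Y K. (\<forall>K'\<in>cells m n. e \<in> edges X Y K' \<longrightarrow> K' = K) \<longrightarrow>
           (\<forall>v\<in>P 1. edge_integral e (\<lambda>p. q K p * v p) = 0))) \<longleftrightarrow>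
      ((\<forall>K\<in>cells m n. q K \<in> P 2 \<and> agrees_on w (cell X Y K) (q K)) \<and> moment_matched m n X Y q)"
      by (rule conj_cong[OF refl], rule equiv) simp
  qed
qed

subsection \<open>Smooth functions of one variable\<close>

text \<open>The derivative is existentially quantified rather than given by an operator, so that
  each induction step can supply an explicit formula as witness.\<close>

primrec Ck_real :: "nat \<Rightarrow> (real \<Rightarrow> real) \<Rightarrow> bool" where
  "Ck_real 0 f \<longleftrightarrow> continuous_on UNIV f"
| "Ck_real (Suc k) f \<longleftrightarrow> (\<exists>f'. (\<forall>x. (f has_real_derivative f' x) (at x)) \<and> Ck_real k f')"

lemma Ck_real_Suc_imp: "Ck_real (Suc k) f \<Longrightarrow> Ck_real k f"
proof (induction k arbitrary: f)
  case 0
  then show ?case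
    by (auto intro!: continuous_at_imp_continuous_on intro: DERIV_isCont)
next
  case (Suc k)
  then show ?case by (metis Ck_real.simps(2))
qed

text \<open>The two-coefficient form stands for sums, differences and multiples at once; simpler
  expressions are padded with a factor \<open>1\<close> or a summand with factor \<open>0\<close> to
  fit it.\<close>

lemma Ck_real_lincomb:
  "Ck_real k f \<Longrightarrow> Ck_real k g \<Longrightarrow> Ck_real k (\<lambda>x. a * f x + b * g x)"
proof (induction k arbitrary: f g)
  case 0
  then show ?case by (auto intro!: continuous_intros)
next
  case (Suc k)
  then obtain f' g' where
    "\<And>x. (f has_real_derivative f' x) (at x)" "\<And>x. (g has_real_derivative g' x) (at x)"
    "Ck_real k f'" "Ck_real k g'" by auto
  then show ?case using Suc.IH[of f' g']
    by (auto intro!: exI[of _ "\<lambda>x. a * f' x + b * g' x"] derivative_eq_intros)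
qed

lemma Ck_real_mult: "Ck_real k f \<Longrightarrow> Ck_real k g \<Longrightarrow> Ck_real k (\<lambda>x. f x * g x)"
proof (induction k arbitrary: f g)
  case 0
  then show ?case by (auto intro!: continuous_intros)
next
  case (Suc k)
  then obtain f' g' where d:
    "\<And>x. (f has_real_derivative f' x) (at x)" "\<And>x. (g has_real_derivative g' x) (at x)"
    "Ck_real k f'" "Ck_real k g'" by auto
  have "Ck_real k (\<lambda>x. 1 * (f' x * g x) + 1 * (f x * g' x))"
    using Suc.prems[THEN Ck_real_Suc_imp] d by (intro Ck_real_lincomb Suc.IH)
  moreover have "((\<lambda>x. f x * g x) has_real_derivative 1 * (f' x * g x) + 1 * (f x * g' x)) (at x)" for x
    using DERIV_mult[OF d(1)[of x] d(2)[of x]] by (simp add: algebra_simps)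
  ultimately show ?case
    by (intro iffD2[OF Ck_real.simps(2)] exI[of _ "\<lambda>x. 1 * (f' x * g x) + 1 * (f x * g' x)"] conjI allI)
qed

lemma Ck_real_affine: "Ck_real k f \<Longrightarrow> Ck_real k (\<lambda>x. f (a * x + b))"
proof (induction k arbitrary: f)
  case 0
  then have "continuous_on UNIV (f \<circ> (\<lambda>x. a * x + b))"
    by (intro continuous_on_compose continuous_intros) (auto intro: continuous_on_subset)
  then show ?case by (simp add: o_def)
next
  case (Suc k)
  then obtain f' where d: "\<And>x. (f has_real_derivative f' x) (at x)" "Ck_real k f'" by auto
  have "((\<lambda>x. f (a * x + b)) has_real_derivative a * f' (a * x + b) + 0 * f' (a * x + b)) (at x)" for x
  proof -
    have "((\<lambda>x. a * x + b) has_real_derivative a) (at x)" by (auto intro!: derivative_eq_intros)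
    from DERIV_chain2[OF d(1) this] show ?thesis by (simp add: mult.commute)
  qed
  moreover have "Ck_real k (\<lambda>x. a * f' (a * x + b) + 0 * f' (a * x + b))"
    using Suc d by (intro Ck_real_lincomb) auto
  ultimately show ?case
    by (intro iffD2[OF Ck_real.simps(2)] exI[of _ "\<lambda>x. a * f' (a * x + b) + 0 * f' (a * x + b)"] conjI allI)
qed

lemma poly_div_exp_tendsto_0: "((\<lambda>u. poly p u / exp u) \<longlongrightarrow> (0 :: real)) at_top"
proof -
  have "((\<lambda>u. \<Sum>i\<le>degree p. coeff p i * (u ^ i / exp u)) \<longlongrightarrow> (\<Sum>i\<le>degree p. coeff p i * 0)) at_top"
    by (intro tendsto_sum tendsto_mult tendsto_const tendsto_power_div_exp_0)
  then show ?thesis by (simp add: poly_altdef sum_divide_distrib)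
qed

text \<open>The polynomial is arbitrary so that the family is closed under differentiation: with
  \<open>u = 1 / x\<close> the derivative of \<open>p(u) exp(-u)\<close> is
  \<open>u^2 (p(u) - p'(u)) exp(-u)\<close>. At 0 the exponential beats every polynomial in
  \<open>u\<close>.\<close>

lemma Ck_real_flat: "Ck_real k (\<lambda>x. if x \<le> 0 then 0 else poly p (1 / x) * exp (- (1 / x)))"
proof (induction k arbitrary: p)
  case (Suc k)
  define f where "f = (\<lambda>p x :: real. if x \<le> 0 then 0 else poly p (1 / x) * exp (- (1 / x)))"
  define p' where "p' = [:0, 0, 1:] * (p - pderiv p)"
  have "(f p has_real_derivative f p' x) (at x)" for x
  proof -
    consider "x < 0" | "x = 0" | "x > 0" by linarith
    then show ?thesis
    proof cases
      case 1
      have "((\<lambda>_. 0) has_real_derivative f p' x) (at x)" using 1 by (simp add: f_def)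
      then show ?thesis
        by (rule has_field_derivative_transform_within_open[of _ _ _ "{..<0}"]) (use 1 in \<open>auto simp: f_def\<close>)
    next
      case 3
      have "((\<lambda>x. poly p (1 / x) * exp (- (1 / x))) has_real_derivative f p' x) (at x)"
      proof -
        have "((\<lambda>x. 1 / x) has_real_derivative - (1 / x\<^sup>2)) (at x)"
          using 3 by (auto intro!: derivative_eq_intros simp: power2_eq_square)
        note D = this DERIV_chain2[OF poly_DERIV this, of p]
        show ?thesis using 3
          by (auto intro!: derivative_eq_intros D simp: f_def p'_def algebra_simps power2_eq_square)
      qed
      then show ?thesis
        by (rule has_field_derivative_transform_within_open[of _ _ _ "{0<..}"]) (use 3 in \<open>auto simp: f_def\<close>)
    next
      case 2
      have "((\<lambda>h. f p h / h) \<longlongrightarrow> 0) (at_left 0)"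
        by (rule tendsto_eventually) (auto simp: f_def eventually_at_filter)
      moreover have "((\<lambda>h. f p h / h) \<longlongrightarrow> 0) (at_right 0)"
      proof -
        \<comment> \<open>Dividing by \<open>h\<close> multiplies the polynomial by
          \<open>u = 1 / h\<close>, which is the effect of \<open>pCons 0\<close>.\<close>
        have "((\<lambda>h. poly (pCons 0 p) (1 / h) / exp (1 / h)) \<longlongrightarrow> 0) (at_right 0)"
          using filterlim_compose[OF poly_div_exp_tendsto_0 filterlim_inverse_at_top_right, of "pCons 0 p"]
          by (simp only: inverse_eq_divide)
        moreover have "\<forall>\<^sub>F h in at_right 0. poly (pCons 0 p) (1 / h) / exp (1 / h) = f p h / h"
          by (auto simp: f_def eventually_at_filter exp_minus field_simps)
        ultimately show ?thesis by (rule Lim_transform_eventually)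
      qed
      ultimately have "((\<lambda>h. f p h / h) \<longlongrightarrow> 0) (at 0)" by (simp add: filterlim_at_split)
      then show ?thesis using 2 unfolding DERIV_def f_def by (simp cong: if_cong)
    qed
  qed
  moreover have "Ck_real k (f p')" using Suc.IH by (simp add: f_def)
  ultimately have "Ck_real (Suc k) (f p)" unfolding Ck_real.simps by blast
  then show ?case by (simp only: f_def)
next
  case 0
  define f where "f = (\<lambda>x :: real. if x \<le> 0 then 0 else poly p (1 / x) * exp (- (1 / x)))"
  have "isCont f x" for x
  proof -
    consider "x < 0" | "x = 0" | "x > 0" by linarith
    then show ?thesis
    proof cases
      case 1
      then have "\<forall>\<^sub>F y in nhds x. y \<in> {..<0}" by (intro eventually_nhds_in_open) auto
      then have "\<forall>\<^sub>F y in nhds x. f y = 0" by eventually_elim (auto simp: f_def)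
      then show ?thesis using isCont_cong[of f "\<lambda>_. 0"] by simp
    next
      case 3
      then have "\<forall>\<^sub>F y in nhds x. y \<in> {0<..}" by (intro eventually_nhds_in_open) auto
      then have "\<forall>\<^sub>F y in nhds x. f y = poly p (1 / y) * exp (- (1 / y))" by eventually_elim (auto simp: f_def)
      moreover have "isCont (\<lambda>y. poly p (1 / y) * exp (- (1 / y))) x"
        using 3 by (auto intro!: continuous_intros)
      ultimately show ?thesis using isCont_cong by fast
    next
      case 2
      have "(f \<longlongrightarrow> 0) (at_left 0)"
        by (rule tendsto_eventually) (auto simp: f_def eventually_at_filter)
      moreover have "(f \<longlongrightarrow> 0) (at_right 0)"
      proof -
        have "((\<lambda>h. poly p (1 / h) / exp (1 / h)) \<longlongrightarrow> 0) (at_right 0)"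
          using filterlim_compose[OF poly_div_exp_tendsto_0 filterlim_inverse_at_top_right, of "p"]
          by (simp only: inverse_eq_divide)
        moreover have "\<forall>\<^sub>F h in at_right 0. poly p (1 / h) / exp (1 / h) = f h"
          by (auto simp: f_def eventually_at_filter exp_minus field_simps)
        ultimately show ?thesis by (rule Lim_transform_eventually)
      qed
      ultimately show ?thesis using 2 by (simp add: filterlim_at_split isCont_def f_def)
    qed
  qed
  then show ?case by (simp add: continuous_at_imp_continuous_on f_def)
qed

lemma continuous_antiderivative_exists:
  fixes f :: "real \<Rightarrow> real"
  assumes "continuous_on UNIV f"
  obtains F where "\<And>x. (F has_real_derivative f x) (at x)"
  using einterval_antiderivative[of "-\<infinity>" "\<infinity>" f] assms
  by (auto simp: continuous_on_eq_continuous_at has_real_derivative_iff_has_vector_derivative)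

text \<open>The step is a primitive of a smooth bump on the unit interval, normalized by its total
  increase.\<close>

lemma smooth_step_exists:
  obtains S where "\<And>k. Ck_real k S" "\<And>x. x \<le> 0 \<Longrightarrow> S x = 0" "\<And>x. 1 \<le> x \<Longrightarrow> S x = 1"
    "\<And>x. 0 \<le> S x" "\<And>x. S x \<le> 1"
proof -
  define \<eta> where "\<eta> = (\<lambda>x :: real. if x \<le> 0 then 0 else poly 1 (1 / x) * exp (- (1 / x)))"
  \<comment> \<open>A flat function times its mirror image about 1/2: positive exactly between 0 and
    1.\<close>
  define \<rho> where "\<rho> = (\<lambda>x. \<eta> x * \<eta> (-1 * x + 1))"
  have \<rho>: "Ck_real k \<rho>" for k
    unfolding \<rho>_def \<eta>_def by (intro Ck_real_mult Ck_real_flat Ck_real_affine[OF Ck_real_flat])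
  obtain F where F: "\<And>x. (F has_real_derivative \<rho> x) (at x)"
    using continuous_antiderivative_exists \<rho>[of 0] by auto
  have \<rho>_nonneg: "0 \<le> \<rho> x" for x by (simp add: \<rho>_def \<eta>_def)
  have mono: "F x \<le> F y" if "x \<le> y" for x y
    using DERIV_nonneg_imp_nondecreasing[OF that] F \<rho>_nonneg by blast
  have const: "F x = F y" if "\<And>z. x < z \<Longrightarrow> z < y \<Longrightarrow> \<rho> z = 0" "x \<le> y" for x y
  proof (cases "x = y")
    case False
    with that have "x < y" by simp
    from MVT2[OF this F] obtain z where "x < z" "z < y" "F y - F x = (y - x) * \<rho> z" by auto
    then show ?thesis using that by simp
  qed simp
  have "F 0 < F 1"
  proof -
    from MVT2[OF zero_less_one F] obtain z where z: "0 < z" "z < 1" "F 1 - F 0 = (1 - 0) * \<rho> z" by auto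
    then have "0 < \<rho> z" by (simp add: \<rho>_def \<eta>_def)
    then show ?thesis using z by simp
  qed
  define S where "S = (\<lambda>x. (F x - F 0) / (F 1 - F 0))"
  have S0: "S x = 0" if "x \<le> 0" for x
    using const[of x 0] that by (auto simp: S_def \<rho>_def \<eta>_def)
  have S1: "S x = 1" if "1 \<le> x" for x
  proof -
    have "F 1 = F x" by (rule const) (use that in \<open>auto simp: \<rho>_def \<eta>_def\<close>)
    with \<open>F 0 < F 1\<close> show ?thesis unfolding S_def by (metis diff_gt_0_iff_gt divide_self less_irrefl)
  qed
  have Smono: "S x \<le> S y" if "x \<le> y" for x y
    using mono[OF that] \<open>F 0 < F 1\<close> by (simp add: S_def divide_right_mono)
  have DS: "(S has_real_derivative \<rho> x / (F 1 - F 0) + 0 * \<rho> x) (at x)" for x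
    unfolding S_def using \<open>F 0 < F 1\<close> by (auto intro!: derivative_eq_intros F)
  have "Ck_real k S" for k
  proof (rule Ck_real_Suc_imp)
    have "Ck_real k (\<lambda>x. 1 / (F 1 - F 0) * \<rho> x + 0 * \<rho> x)" by (intro Ck_real_lincomb \<rho>)
    then show "Ck_real (Suc k) S" using DS by (intro iffD2[OF Ck_real.simps(2)] exI[of _ "\<lambda>x. \<rho> x / (F 1 - F 0)"]) auto
  qed
  moreover have "0 \<le> S x" for x using Smono[of "min 0 x" x] S0[of "min 0 x"] by simp
  moreover have "S x \<le> 1" for x using Smono[of x "max 1 x"] S1[of "max 1 x"] by simp
  ultimately show ?thesis using that S0 S1 by blast
qed

subsection \<open>Smooth approximation of hat functions\<close>

text \<open>The hat is a combination of three ramps, one per kink, whose coefficients are the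
  changes of slope. In this form it suffices to smooth the single function
  \<open>max 0\<close>.\<close>

definition hat :: "real \<Rightarrow> real \<Rightarrow> real \<Rightarrow> real \<Rightarrow> real" where
  "hat a b c x = 1 / (b - a) * max 0 (x - a) - (1 / (b - a) + 1 / (c - b)) * max 0 (x - b) +
     1 / (c - b) * max 0 (x - c)"

text \<open>The inequality at \<open>a\<close> is strict and the one at \<open>c\<close> is not, so
  that the slope is 0 at both end points. A gradient built from it then vanishes off the open box,
  as \<open>sq_integrable\<close> demands.\<close>

definition hat_slope :: "real \<Rightarrow> real \<Rightarrow> real \<Rightarrow> real \<Rightarrow> real" where
  "hat_slope a b c x = 1 / (b - a) * of_bool (a < x) - (1 / (b - a) + 1 / (c - b)) * of_bool (b < x) +
     1 / (c - b) * of_bool (c \<le> x)"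

lemma hat_simps:
  assumes "a < b" "b < c"
  shows "x \<le> a \<Longrightarrow> hat a b c x = 0" "a \<le> x \<Longrightarrow> x \<le> b \<Longrightarrow> hat a b c x = (x - a) / (b - a)"
    "b \<le> x \<Longrightarrow> x \<le> c \<Longrightarrow> hat a b c x = (c - x) / (c - b)" "c \<le> x \<Longrightarrow> hat a b c x = 0"
proof -
  have max: "max 0 z = (if z \<le> 0 then 0 else z)" for z :: real by simp
  have left: "1 / (b - a) * (x - a) - 1 / (b - a) * (x - b) = 1"
    and right: "1 / (c - b) * (x - b) - 1 / (c - b) * (x - c) = 1"
    using assms by (simp_all add: diff_divide_distrib[symmetric])
  show "x \<le> a \<Longrightarrow> hat a b c x = 0" "a \<le> x \<Longrightarrow> x \<le> b \<Longrightarrow> hat a b c x = (x - a) / (b - a)"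
    using assms by (simp_all add: hat_def max)
  have "hat a b c x = 1 - 1 / (c - b) * (x - b)" if "b \<le> x" "x \<le> c"
  proof -
    have "max 0 (x - a) = x - a" "max 0 (x - b) = x - b" "max 0 (x - c) = 0" using assms that by simp_all
    then have "hat a b c x = (1 / (b - a) * (x - a) - 1 / (b - a) * (x - b)) - 1 / (c - b) * (x - b)"
      unfolding hat_def by (simp add: distrib_right del: times_divide_eq_left)
    then show ?thesis by (simp only: left)
  qed
  moreover have "1 - 1 / (c - b) * (x - b) = (c - x) / (c - b)"
    using assms by (simp add: field_simps)
  ultimately show "b \<le> x \<Longrightarrow> x \<le> c \<Longrightarrow> hat a b c x = (c - x) / (c - b)" by simp
  show "hat a b c x = 0" if "c \<le> x"
  proof -
    have "max 0 (x - a) = x - a" "max 0 (x - b) = x - b" "max 0 (x - c) = x - c" using assms that by simp_all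
    then have "hat a b c x = 1 / (b - a) * (x - a) - 1 / (b - a) * (x - b) -
        (1 / (c - b) * (x - b) - 1 / (c - b) * (x - c))"
      unfolding hat_def by (simp add: distrib_right del: times_divide_eq_left)
    then show ?thesis by (simp only: left right)
  qed
qed

lemma hat_slope_outside:
  assumes "a < b" "b < c" "x \<le> a \<or> c \<le> x"
  shows "hat_slope a b c x = 0"
  using assms by (auto simp: hat_slope_def)

text \<open>Each ramp is replaced by a rescaled primitive of a smooth step. The outer kinks are
  moved inwards so that the support is compact in the open interval, and the slopes are adjusted so
  that the function still returns to 0. The slopes stay bounded as the scale \<open>k n\<close>
  grows, which is what dominated convergence needs.\<close>

lemma hat_smooth_approx:
  assumes "a < b" "b < c"
  obtains \<Phi> \<Phi>' :: "nat \<Rightarrow> real \<Rightarrow> real" and M where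
    "\<And>n k. Ck_real k (\<Phi> n)" "\<And>n x. (\<Phi> n has_real_derivative \<Phi>' n x) (at x)"
    "\<And>n. \<exists>\<alpha> \<gamma>. a < \<alpha> \<and> \<gamma> < c \<and> (\<forall>x. x \<notin> {\<alpha>..\<gamma>} \<longrightarrow> \<Phi> n x = 0)"
    "\<And>x. (\<lambda>n. \<Phi> n x) \<longlonglongrightarrow> hat a b c x"
    "\<And>x. x \<notin> {a, b, c} \<Longrightarrow> (\<lambda>n. \<Phi>' n x) \<longlonglongrightarrow> hat_slope a b c x"
    "\<And>n x. \<bar>\<Phi> n x\<bar> \<le> M" "\<And>n x. \<bar>\<Phi>' n x\<bar> \<le> M"
proof -
  obtain S where S: "\<And>k. Ck_real k S" "\<And>x. x \<le> 0 \<Longrightarrow> S x = 0" "\<And>x. 1 \<le> x \<Longrightarrow> S x = 1"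
    "\<And>x. 0 \<le> S x" "\<And>x. S x \<le> 1"
    using smooth_step_exists by blast
  obtain R0 where R0: "\<And>x. (R0 has_real_derivative S x) (at x)"
    using continuous_antiderivative_exists S(1)[of 0] by auto
  \<comment> \<open>\<open>R\<close> vanishes up to 0 and equals \<open>x - r\<close> from 1 on; the
    defect \<open>r\<close> disappears when the coefficients of the three ramps add up to 0.\<close>
  define R where "R = (\<lambda>x. R0 x - R0 0)"
  define r where "r = 1 - R 1"
  have DR: "(R has_real_derivative S x) (at x)" for x
    unfolding R_def by (auto intro!: derivative_eq_intros R0)
  have R_smooth: "Ck_real k R" for k
    by (rule Ck_real_Suc_imp) (use DR S(1) in auto)
  have R_neg: "R x = 0" if "x \<le> 0" for x
  proof (cases "x = 0")
    case False
    then obtain z where "x < z" "z < 0" "R 0 - R x = (0 - x) * S z"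
      using MVT2[of x 0 R S] DR \<open>x \<le> 0\<close> by auto
    then show ?thesis using S(2)[of z] by (simp add: R_def)
  qed (simp add: R_def)
  have R_pos: "R x = x - r" if "1 \<le> x" for x
  proof (cases "x = 1")
    case False
    then obtain z where "1 < z" "z < x" "R x - R 1 = (x - 1) * S z"
      using MVT2[of 1 x R S] DR \<open>1 \<le> x\<close> by auto
    then show ?thesis using S(3)[of z] by (simp add: r_def)
  qed (simp add: r_def)
  \<comment> \<open>The constant added to \<open>n\<close> makes \<open>1 / k n\<close> at most a
    quarter of both \<open>b - a\<close> and \<open>c - b\<close> for every \<open>n\<close>, so the
    shifted kinks keep their order and the denominators below stay positive.\<close>
  define k :: "nat \<Rightarrow> real" where "k n = real n + (4 / (b - a) + 4 / (c - b))" for n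
  have k_pos: "0 < k n" for n using assms by (simp add: k_def add_nonneg_pos)
  have k_ge: "4 / (b - a) \<le> k n" "4 / (c - b) \<le> k n" for n using assms by (simp_all add: k_def)
  have k_inv: "1 / k n \<le> (b - a) / 4" "1 / k n \<le> (c - b) / 4" for n
    using k_ge[of n] k_pos[of n] assms by (simp_all add: field_simps)
  have k_lim: "filterlim k at_top sequentially"
    unfolding k_def
    by (rule filterlim_tendsto_add_at_top[OF tendsto_const filterlim_real_sequentially,
          of "4 / (b - a) + 4 / (c - b)", unfolded add.commute[of _ "real _"]])
  have kinv_lim: "(\<lambda>n. 1 / k n) \<longlonglongrightarrow> 0"
    using tendsto_divide_0[OF tendsto_const filterlim_at_top_imp_at_infinity[OF k_lim]] .
  have k_pos_lim: "filterlim (\<lambda>n. k n * y + d) at_top sequentially" if "0 < y" for y d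
    using filterlim_tendsto_add_at_top[OF tendsto_const
        filterlim_tendsto_pos_mult_at_top[OF tendsto_const that k_lim], of d]
    by (simp add: ac_simps)
  have k_neg_lim: "filterlim (\<lambda>n. k n * y + d) at_bot sequentially" if "y < 0" for y d
  proof -
    have "filterlim (\<lambda>n. - (k n * (- y) + (- d))) at_bot sequentially"
      using k_pos_lim[of "- y" "- d"] that unfolding filterlim_uminus_at_bot by (simp add: ac_simps)
    then show ?thesis by (simp add: add.commute)
  qed
  have S_lim: "(\<lambda>n. S (k n * y + d)) \<longlonglongrightarrow> of_bool (0 < y)" if "y \<noteq> 0" for y d
  proof (cases "0 < y")
    case True
    then have "\<forall>\<^sub>F n in sequentially. 1 \<le> k n * y + d"
      using k_pos_lim by (simp add: filterlim_at_top)
    then have "\<forall>\<^sub>F n in sequentially. S (k n * y + d) = of_bool (0 < y)"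
      by eventually_elim (use True S(3) in auto)
    then show ?thesis by (rule tendsto_eventually)
  next
    case False
    then have "\<forall>\<^sub>F n in sequentially. k n * y + d \<le> 0"
      using k_neg_lim[of y] that by (simp add: filterlim_at_bot)
    then have "\<forall>\<^sub>F n in sequentially. S (k n * y + d) = of_bool (0 < y)"
      by eventually_elim (use False S(2) in auto)
    then show ?thesis by (rule tendsto_eventually)
  qed
  \<comment> \<open>The fixed offset \<open>d\<close> is divided by \<open>k n\<close> and so leaves
    no trace in the limit.\<close>
  have R_lim: "(\<lambda>n. R (k n * y + d) / k n) \<longlonglongrightarrow> max 0 y" for y d
  proof -
    consider "0 < y" | "y < 0" | "y = 0" by linarith
    then show ?thesis
    proof cases
      case 1
      have "(\<lambda>n. y + (d - r) * (1 / k n)) \<longlonglongrightarrow> y + (d - r) * 0"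
        by (intro tendsto_intros kinv_lim)
      moreover have "\<forall>\<^sub>F n in sequentially. 1 \<le> k n * y + d"
        using k_pos_lim[OF 1] by (simp add: filterlim_at_top)
      then have "\<forall>\<^sub>F n in sequentially. y + (d - r) * (1 / k n) = R (k n * y + d) / k n"
      proof eventually_elim
        case (elim n)
        then show ?case using k_pos[of n] by (simp add: R_pos field_simps)
      qed
      ultimately show ?thesis using 1 by (auto intro: Lim_transform_eventually)
    next
      case 2
      then have "\<forall>\<^sub>F n in sequentially. k n * y + d \<le> 0"
        using k_neg_lim[of y] by (simp add: filterlim_at_bot)
      then have "\<forall>\<^sub>F n in sequentially. R (k n * y + d) / k n = max 0 y"
        by eventually_elim (use 2 R_neg in auto)
      then show ?thesis by (rule tendsto_eventually)
    next
      case 3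
      then show ?thesis using tendsto_mult[OF tendsto_const kinv_lim, of "R d"] by simp
    qed
  qed
  \<comment> \<open>These are the slopes of the piecewise linear hat of height 1 with kinks at
    \<open>a + 1 / k n\<close>, \<open>b\<close> and \<open>c - 2 / k n\<close>.\<close>
  define \<alpha> where "\<alpha> n = 1 / (b - a - 1 / k n)" for n
  define \<gamma> where "\<gamma> n = 1 / (c - b - 2 * (1 / k n))" for n
  have den: "(b - a) / 2 \<le> b - a - 1 / k n" "(c - b) / 2 \<le> c - b - 2 * (1 / k n)" for n
    using k_inv[of n] assms by (simp_all add: field_simps)
  have \<alpha>_bd: "0 \<le> \<alpha> n" "\<alpha> n \<le> 2 / (b - a)" for n
    using den(1)[of n] assms by (simp_all add: \<alpha>_def divide_simps)
  have \<gamma>_bd: "0 \<le> \<gamma> n" "\<gamma> n \<le> 2 / (c - b)" for n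
    using den(2)[of n] assms by (simp_all add: \<gamma>_def divide_simps)
  have \<alpha>_lim: "\<alpha> \<longlonglongrightarrow> 1 / (b - a)"
    using tendsto_divide[OF tendsto_const tendsto_diff[OF tendsto_const kinv_lim], of "b - a" 1] assms
    by (simp add: \<alpha>_def[abs_def])
  have \<gamma>_lim: "\<gamma> \<longlonglongrightarrow> 1 / (c - b)"
    using tendsto_divide[OF tendsto_const tendsto_diff[OF tendsto_const tendsto_mult[OF tendsto_const kinv_lim]],
        of "c - b" 2 1] assms
    by (simp add: \<gamma>_def[abs_def])
  \<comment> \<open>The offset -1 starts the first ramp at \<open>a + 1 / k n\<close>; the offset 2
    starts the last one at \<open>c - 2 / k n\<close> and makes it affine from
    \<open>c - 1 / k n\<close> on, still before \<open>c\<close>.\<close>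
  define u where "u x n = k n * (x - a) + (-1)" for x n
  define v where "v x n = k n * (x - b) + 0" for x n
  define w where "w x n = k n * (x - c) + 2" for x n
  define \<Phi> where "\<Phi> n x = \<alpha> n * (R (u x n) / k n) - (\<alpha> n + \<gamma> n) * (R (v x n) / k n) + \<gamma> n * (R (w x n) / k n)"
    for n x
  define \<Phi>' where "\<Phi>' n x = \<alpha> n * S (u x n) - (\<alpha> n + \<gamma> n) * S (v x n) + \<gamma> n * S (w x n)" for n x
  define M where "M = 4 / (b - a) + 4 / (c - b)"
  have M: "0 \<le> M" using assms by (simp add: M_def)
  have smooth: "Ck_real l (\<Phi> n)" for n l
  proof -
    have arg: "k n * (x - y) + d = k n * x + (d - k n * y)" for x y d by (simp add: right_diff_distrib)
    have "\<Phi> n = (\<lambda>x. 1 * (\<alpha> n / k n * R (k n * x + (-1 - k n * a)) +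
          (- ((\<alpha> n + \<gamma> n) / k n)) * R (k n * x + (0 - k n * b))) + \<gamma> n / k n * R (k n * x + (2 - k n * c)))"
      unfolding \<Phi>_def u_def v_def w_def arg by simp
    then show ?thesis by (simp only:) (intro Ck_real_lincomb Ck_real_affine R_smooth)
  qed
  have DRk: "((\<lambda>x. R (k n * (x - y) + d) / k n) has_real_derivative S (k n * (x - y) + d)) (at x)" for n x y d
  proof -
    have "((\<lambda>x. k n * (x - y) + d) has_real_derivative k n) (at x)"
      by (auto intro!: derivative_eq_intros)
    from DERIV_cdivide[OF DERIV_chain2[OF DR this], of "k n"] show ?thesis using k_pos[of n] by simp
  qed
  have deriv: "(\<Phi> n has_real_derivative \<Phi>' n x) (at x)" for n x
    unfolding \<Phi>_def \<Phi>'_def u_def v_def w_def by (intro DERIV_add DERIV_diff DERIV_cmult DRk)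
  have left: "\<Phi> n x = 0" if "x < a + 1 / k n" for n x
  proof -
    have "u x n \<le> 0" using that k_pos[of n] by (simp add: u_def field_simps)
    moreover have "v x n \<le> 0"
      using that k_pos[of n] k_inv(1)[of n] assms unfolding v_def by (simp add: mult_le_0_iff)
    moreover have "w x n \<le> 0"
    proof -
      have "x - c \<le> - (2 * (1 / k n))" using that k_inv[of n] assms by (simp add: field_simps)
      then show ?thesis unfolding w_def using k_pos[of n] by (simp add: field_simps)
    qed
    ultimately show ?thesis by (simp add: \<Phi>_def R_neg)
  qed
  have right: "\<Phi> n x = 0" if "c - 1 / k n < x" for n x
  proof -
    have kx: "k n * (x - c) \<ge> -1" using that k_pos[of n] by (simp add: field_simps)
    have kc: "4 \<le> k n * (c - b)" using k_ge(2)[of n] assms by (simp add: field_simps)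
    have ka: "4 \<le> k n * (b - a)" using k_ge(1)[of n] assms by (simp add: field_simps)
    have "1 \<le> w x n" using kx by (simp add: w_def)
    moreover have "1 \<le> v x n" using kx kc by (simp add: v_def algebra_simps)
    moreover have "1 \<le> u x n" using kx kc ka by (simp add: u_def algebra_simps)
    ultimately have "\<Phi> n x = \<alpha> n * ((u x n - r) / k n) - (\<alpha> n + \<gamma> n) * ((v x n - r) / k n) +
        \<gamma> n * ((w x n - r) / k n)"
      by (simp add: \<Phi>_def R_pos)
    also have "(u x n - r) / k n = x - a - 1 / k n - r / k n"
      using k_pos[of n] by (simp add: u_def diff_divide_distrib)
    also have "(v x n - r) / k n = x - b - r / k n"
      using k_pos[of n] by (simp add: v_def diff_divide_distrib)
    also have "(w x n - r) / k n = x - c + 2 * (1 / k n) - r / k n"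
      using k_pos[of n] by (simp add: w_def diff_divide_distrib add_divide_distrib)
    \<comment> \<open>The three coefficients add up to 0, so both \<open>x\<close> and
      \<open>r\<close> cancel; what is left vanishes by the choice of \<open>\<alpha>\<close> and
      \<open>\<gamma>\<close>.\<close>
    also have "\<alpha> n * (x - a - 1 / k n - r / k n) - (\<alpha> n + \<gamma> n) * (x - b - r / k n) +
        \<gamma> n * (x - c + 2 * (1 / k n) - r / k n) = \<alpha> n * (b - a - 1 / k n) - \<gamma> n * (c - b - 2 * (1 / k n))"
      by algebra
    also have "\<dots> = 1 - 1"
      using den[of n] assms by (simp add: \<alpha>_def \<gamma>_def)
    finally show ?thesis by simp
  qed
  have supp: "\<exists>\<alpha> \<gamma>. a < \<alpha> \<and> \<gamma> < c \<and> (\<forall>x. x \<notin> {\<alpha>..\<gamma>} \<longrightarrow> \<Phi> n x = 0)" for n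
    using left[of _ n] right[of n] k_pos[of n]
    by (intro exI[of _ "a + 1 / k n"] exI[of _ "c - 1 / k n"]) (auto simp: not_le)
  have lim: "(\<lambda>n. \<Phi> n x) \<longlonglongrightarrow> hat a b c x" for x
    unfolding \<Phi>_def hat_def u_def v_def w_def by (intro tendsto_intros R_lim \<alpha>_lim \<gamma>_lim)
  have lim': "(\<lambda>n. \<Phi>' n x) \<longlonglongrightarrow> hat_slope a b c x" if "x \<notin> {a, b, c}" for x
  proof -
    have "(\<lambda>n. \<Phi>' n x) \<longlonglongrightarrow> 1 / (b - a) * of_bool (0 < x - a) -
        (1 / (b - a) + 1 / (c - b)) * of_bool (0 < x - b) + 1 / (c - b) * of_bool (0 < x - c)"
      unfolding \<Phi>'_def u_def v_def w_def using that by (intro tendsto_intros S_lim \<alpha>_lim \<gamma>_lim) auto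
    then show ?thesis using that by (simp add: hat_slope_def le_less)
  qed
  have bd': "\<bar>\<Phi>' n x\<bar> \<le> M" for n x
  proof -
    have abs: "\<bar>z * S y\<bar> \<le> \<bar>z\<bar>" for z y
      using S(4)[of y] S(5)[of y] by (simp add: abs_mult mult_left_le)
    have "\<bar>\<Phi>' n x\<bar> \<le> \<bar>\<alpha> n\<bar> + \<bar>\<alpha> n + \<gamma> n\<bar> + \<bar>\<gamma> n\<bar>"
      using abs[of "\<alpha> n" "u x n"] abs[of "\<alpha> n + \<gamma> n" "v x n"] abs[of "\<gamma> n" "w x n"]
      unfolding \<Phi>'_def by linarith
    also have "\<dots> = 2 * \<alpha> n + 2 * \<gamma> n" using \<alpha>_bd \<gamma>_bd by simp
    also have "\<dots> \<le> 2 * (2 / (b - a)) + 2 * (2 / (c - b))"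
      by (intro add_mono mult_left_mono \<alpha>_bd \<gamma>_bd) auto
    also have "\<dots> = M" by (simp add: M_def)
    finally show ?thesis .
  qed
  \<comment> \<open>Inside the interval this is the mean value theorem starting from
    \<open>a\<close>, where the function is 0.\<close>
  have bd: "\<bar>\<Phi> n x\<bar> \<le> M * (c - a)" for n x
  proof (cases "a < x \<and> x < c")
    case True
    then obtain z where "\<Phi> n x - \<Phi> n a = (x - a) * \<Phi>' n z"
      using MVT2[of a x "\<Phi> n" "\<Phi>' n"] deriv by blast
    moreover have "\<Phi> n a = 0" using left[of a n] k_pos[of n] by simp
    ultimately have "\<bar>\<Phi> n x\<bar> = (x - a) * \<bar>\<Phi>' n z\<bar>" using True by (simp add: abs_mult)
    also have "\<dots> \<le> (c - a) * M" using True bd' by (intro mult_mono) auto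
    finally show ?thesis by (simp add: mult.commute)
  next
    case False
    then have "x \<le> a \<or> c \<le> x" by auto
    moreover have "0 < 1 / k n" using k_pos[of n] by simp
    ultimately have "x < a + 1 / k n \<or> c - 1 / k n < x" by linarith
    then have "\<Phi> n x = 0" using left right by blast
    then show ?thesis using M assms by simp
  qed
  have bdM: "\<bar>\<Phi> n x\<bar> \<le> M + M * (c - a)" "\<bar>\<Phi>' n x\<bar> \<le> M + M * (c - a)" for n x
  proof -
    have "0 \<le> M * (c - a)" using M assms by simp
    then show "\<bar>\<Phi> n x\<bar> \<le> M + M * (c - a)" "\<bar>\<Phi>' n x\<bar> \<le> M + M * (c - a)"
      using bd[of n x] bd'[of n x] M by linarith+
  qed
  show ?thesis
    by (rule that[OF smooth deriv supp lim lim' bdM])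
qed

subsection \<open>Square-integrable functions and test functions\<close>

lemma plane_Basis: "(Basis :: plane set) = {(1, 0), (0, 1)}"
  by (auto simp: Basis_prod_def)

lemma box_Pair: "(s, t) \<in> box (a, b) (c, d) \<longleftrightarrow> a < s \<and> s < c \<and> b < t \<and> t < d" for a b c d s t :: real
  by (auto simp: mem_box plane_Basis)

lemma cbox_Pair: "(s, t) \<in> cbox (a, b) (c, d) \<longleftrightarrow> a \<le> s \<and> s \<le> c \<and> b \<le> t \<and> t \<le> d" for a b c d s t :: real
  by (auto simp: mem_box plane_Basis)

lemma set_integral_eq_integral:
  fixes h :: "plane \<Rightarrow> real"
  assumes "\<And>p. p \<notin> \<Omega> \<Longrightarrow> h p = 0"
  shows "(LINT p:\<Omega>|lborel. h p) = integral\<^sup>L lborel h"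
  unfolding set_lebesgue_integral_def
  by (rule Bochner_Integration.integral_cong) (use assms in \<open>auto simp: indicator_def\<close>)

lemma integrable_bounded_support:
  fixes f :: "plane \<Rightarrow> real"
  assumes "f \<in> borel_measurable borel" "A \<in> sets borel" "bounded A"
    "\<And>p. \<bar>f p\<bar> \<le> M" "\<And>p. p \<notin> A \<Longrightarrow> f p = 0"
  shows "integrable lborel f"
proof (rule integrableI_bounded_set[where A = A and B = M])
  show "emeasure lborel A < \<infinity>" using emeasure_bounded_finite[OF \<open>bounded A\<close>] by simp
qed (use assms in auto)

lemma integral_bounded_convergence:
  fixes f :: "plane \<Rightarrow> real"
  assumes "f \<in> borel_measurable borel" "\<And>n. s n \<in> borel_measurable borel"
    and "A \<in> sets borel" "bounded A"
    and "\<And>n p. \<bar>s n p\<bar> \<le> M" "\<And>n p. p \<notin> A \<Longrightarrow> s n p = 0"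
    and "AE p in lborel. (\<lambda>n. s n p) \<longlonglongrightarrow> f p"
  shows "(\<lambda>n. integral\<^sup>L lborel (s n)) \<longlonglongrightarrow> integral\<^sup>L lborel f"
proof (rule integral_dominated_convergence[where w = "\<lambda>p. M * indicator A p"])
  have "0 \<le> M" using assms(5)[of 0 0] by linarith
  then show "integrable lborel (\<lambda>p. M * indicator A p)"
    by (intro integrable_bounded_support[of _ A M]) (use assms in \<open>auto simp: indicator_def\<close>)
  show "AE p in lborel. norm (s n p) \<le> M * indicator A p" for n
    using assms(5,6) by (auto simp: indicator_def)
qed (use assms in auto)

lemma sq_integrable_bounded:
  assumes "f \<in> borel_measurable borel" "\<Omega> \<in> sets borel" "bounded \<Omega>"
    "\<And>p. \<bar>f p\<bar> \<le> M" "\<And>p. p \<notin> \<Omega> \<Longrightarrow> f p = 0"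
  shows "f \<in> sq_integrable \<Omega>"
proof -
  have "integrable lborel (\<lambda>p. (f p)\<^sup>2)"
  proof (rule integrable_bounded_support[of _ \<Omega> "M\<^sup>2"])
    show "\<bar>(f p)\<^sup>2\<bar> \<le> M\<^sup>2" for p using power_mono[OF assms(4)[of p], of 2] by simp
  qed (use assms in auto)
  then show ?thesis using assms by (simp add: sq_integrable_def)
qed

lemma sq_integrable_mult_integrable:
  assumes "f \<in> sq_integrable \<Omega>" "g \<in> sq_integrable \<Omega>"
  shows "integrable lborel (\<lambda>p. f p * g p)"
proof (rule Bochner_Integration.integrable_bound)
  show "integrable lborel (\<lambda>p. (f p)\<^sup>2 + (g p)\<^sup>2)" using assms by (simp add: sq_integrable_def)
  show "AE p in lborel. norm (f p * g p) \<le> norm ((f p)\<^sup>2 + (g p)\<^sup>2)"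
  proof (intro AE_I2)
    fix p
    have "2 * \<bar>f p * g p\<bar> \<le> (f p)\<^sup>2 + (g p)\<^sup>2"
      using sum_squares_bound[of "\<bar>f p\<bar>" "\<bar>g p\<bar>"] by (simp add: abs_mult)
    then show "norm (f p * g p) \<le> norm ((f p)\<^sup>2 + (g p)\<^sup>2)" by simp
  qed
qed (use assms in \<open>auto simp: sq_integrable_def\<close>)

lemma sq_integrable_lincomb:
  assumes f: "f \<in> sq_integrable \<Omega>" and g: "g \<in> sq_integrable \<Omega>"
  shows "(\<lambda>p. x * f p + y * g p) \<in> sq_integrable \<Omega>"
proof -
  have "integrable lborel (\<lambda>p. x\<^sup>2 * (f p)\<^sup>2 + 2 * x * y * (f p * g p) + y\<^sup>2 * (g p)\<^sup>2)"
    using sq_integrable_mult_integrable[OF f g] f g by (simp add: sq_integrable_def)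
  moreover have "(x * f p + y * g p)\<^sup>2 = x\<^sup>2 * (f p)\<^sup>2 + 2 * x * y * (f p * g p) + y\<^sup>2 * (g p)\<^sup>2" for p
    by (simp add: power2_eq_square algebra_simps)
  moreover have "(\<lambda>p. x * f p + y * g p) \<in> borel_measurable lborel"
    using f g by (intro borel_measurable_add borel_measurable_times) (auto simp: sq_integrable_def)
  ultimately show ?thesis using f g by (simp add: sq_integrable_def)
qed

lemma bounded_of_compact_support:
  fixes f :: "plane \<Rightarrow> real"
  assumes "continuous_on UNIV f" "compact C" "\<And>p. p \<notin> C \<Longrightarrow> f p = 0"
  obtains M where "\<And>p. \<bar>f p\<bar> \<le> M"
proof -
  have "bounded (f ` C)"
    by (intro compact_imp_bounded compact_continuous_image continuous_on_subset[OF assms(1)] assms) auto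
  then obtain M where M: "\<And>p. p \<in> C \<Longrightarrow> \<bar>f p\<bar> \<le> M" by (auto simp: bounded_iff)
  have "\<bar>f p\<bar> \<le> max 0 M" for p
    using M[of p] assms(3)[of p] by (cases "p \<in> C") auto
  then show ?thesis using that by blast
qed

lemma partial_eqI: "(f has_derivative f') (at p) \<Longrightarrow> partial b f p = f' b"
  unfolding partial_def using frechet_derivative_at by metis

lemma partial_zero_outside:
  assumes "closed C" "\<And>p. p \<notin> C \<Longrightarrow> \<phi> p = 0" "p \<notin> C"
  shows "partial b \<phi> p = 0"
proof -
  have "(\<phi> has_derivative (\<lambda>_. 0)) (at p)"
    by (rule has_derivative_transform_within_open[where f = "\<lambda>_. 0" and s = "- C"])
       (use assms in \<open>auto simp: open_Compl\<close>)
  then show ?thesis by (rule partial_eqI)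
qed

lemma test_functionE:
  assumes "\<phi> \<in> test_functions \<Omega>"
  obtains C where "compact C" "C \<subseteq> \<Omega>" "\<And>p. p \<notin> C \<Longrightarrow> \<phi> p = 0" "\<And>b p. p \<notin> C \<Longrightarrow> partial b \<phi> p = 0"
    "continuous_on UNIV \<phi>" "\<And>p. \<phi> differentiable (at p)" "\<And>b. b \<in> Basis \<Longrightarrow> continuous_on UNIV (partial b \<phi>)"
proof -
  have Ck: "Ck 0 \<phi>" "Ck 1 \<phi>" using assms unfolding test_functions_def by blast+
  obtain C where "compact C" "C \<subseteq> \<Omega>" "\<forall>p. p \<notin> C \<longrightarrow> \<phi> p = 0"
    using assms unfolding test_functions_def by blast
  then show ?thesis using Ck that[of C] partial_zero_outside[of C \<phi>] compact_imp_closed[of C]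
    by (auto simp: differentiable_on_def)
qed

lemma sq_integrable_compact_support:
  assumes "continuous_on UNIV f" "compact C" "C \<subseteq> \<Omega>" "\<And>p. p \<notin> C \<Longrightarrow> f p = 0"
  shows "f \<in> sq_integrable \<Omega>"
proof -
  obtain M where "\<And>p. \<bar>f p\<bar> \<le> M"
    using bounded_of_compact_support[OF assms(1,2,4)] by blast
  then have "f \<in> sq_integrable C"
    by (intro sq_integrable_bounded borel_measurable_continuous_onI assms)
       (use assms in \<open>auto intro: compact_imp_bounded borel_compact\<close>)
  then show ?thesis using assms(3) by (auto simp: sq_integrable_def)
qed

lemma test_function_sq_integrable: "\<phi> \<in> test_functions \<Omega> \<Longrightarrow> \<phi> \<in> sq_integrable \<Omega>"
  by (elim test_functionE) (rule sq_integrable_compact_support)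

lemma partial_test_function_sq_integrable:
  "\<phi> \<in> test_functions \<Omega> \<Longrightarrow> b \<in> Basis \<Longrightarrow> partial b \<phi> \<in> sq_integrable \<Omega>"
  by (elim test_functionE) (rule sq_integrable_compact_support)

lemma partial_lincomb:
  assumes "f differentiable (at p)" "g differentiable (at p)"
  shows "partial b (\<lambda>p. x * f p + y * g p) p = x * partial b f p + y * partial b g p"
proof -
  have "((\<lambda>p. x * f p + y * g p) has_derivative
      (\<lambda>h. x * frechet_derivative f (at p) h + y * frechet_derivative g (at p) h)) (at p)"
    using assms by (auto intro!: derivative_eq_intros simp flip: frechet_derivative_works)
  from partial_eqI[OF this] show ?thesis by (simp add: partial_def)
qed

lemma Ck_lincomb: "Ck k f \<Longrightarrow> Ck k g \<Longrightarrow> Ck k (\<lambda>p. x * f p + y * g p)"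
proof (induction k arbitrary: f g)
  case 0
  then show ?case by (auto intro!: continuous_intros)
next
  case (Suc k)
  then have diff: "\<And>p. f differentiable (at p)" "\<And>p. g differentiable (at p)"
    by (auto simp: differentiable_on_def)
  have "partial b (\<lambda>p. x * f p + y * g p) = (\<lambda>p. x * partial b f p + y * partial b g p)" for b
    by (intro ext partial_lincomb diff)
  then show ?case using Suc diff by (simp add: differentiable_on_def)
qed

lemma test_functions_lincomb:
  assumes "\<phi> \<in> test_functions \<Omega>" "\<psi> \<in> test_functions \<Omega>"
  shows "(\<lambda>p. x * \<phi> p + y * \<psi> p) \<in> test_functions \<Omega>"
proof -
  obtain C where C: "compact C" "C \<subseteq> \<Omega>" "\<forall>p. p \<notin> C \<longrightarrow> \<phi> p = 0"
    using assms unfolding test_functions_def by blast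
  obtain D where D: "compact D" "D \<subseteq> \<Omega>" "\<forall>p. p \<notin> D \<longrightarrow> \<psi> p = 0"
    using assms unfolding test_functions_def by blast
  have "compact (C \<union> D)" "C \<union> D \<subseteq> \<Omega>" "\<forall>p. p \<notin> C \<union> D \<longrightarrow> x * \<phi> p + y * \<psi> p = 0"
    using C D by auto
  moreover have "\<forall>k. Ck k (\<lambda>p. x * \<phi> p + y * \<psi> p)"
    using assms by (auto simp: test_functions_def intro: Ck_lincomb)
  ultimately show ?thesis unfolding test_functions_def by blast
qed

text \<open>Restriction to a line parallel to \<open>b\<close> gives access to one-variable tools:
  the mean value theorem for difference quotients and the estimate of increments by the
  derivative.\<close>

lemma has_real_derivative_along:
  assumes "\<phi> differentiable (at (p + t *\<^sub>R b))"
  shows "((\<lambda>t. \<phi> (p + t *\<^sub>R b)) has_real_derivative partial b \<phi> (p + t *\<^sub>R b)) (at t)"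
proof -
  have "((\<lambda>t. p + t *\<^sub>R b) has_derivative (\<lambda>s. s *\<^sub>R b)) (at t)"
    by (auto intro!: derivative_eq_intros)
  moreover have D: "(\<phi> has_derivative frechet_derivative \<phi> (at (p + t *\<^sub>R b))) (at (p + t *\<^sub>R b))"
    using assms by (simp add: frechet_derivative_works)
  ultimately have "((\<lambda>t. \<phi> (p + t *\<^sub>R b)) has_derivative
      (\<lambda>s. frechet_derivative \<phi> (at (p + t *\<^sub>R b)) (s *\<^sub>R b))) (at t)"
    by (rule has_derivative_compose)
  moreover have "frechet_derivative \<phi> (at (p + t *\<^sub>R b)) (s *\<^sub>R b) = partial b \<phi> (p + t *\<^sub>R b) * s" for s
    using linear_scale[OF has_derivative_linear[OF D], of s b] by (simp add: partial_def)
  ultimately show ?thesis by (simp add: has_field_derivative_def)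
qed

section \<open>Translations and integration by parts\<close>

lemma integral_translate:
  fixes f :: "plane \<Rightarrow> real"
  assumes "f \<in> borel_measurable borel"
  shows "(LINT p|lborel. f (p + c)) = integral\<^sup>L lborel f"
proof -
  have "integral\<^sup>L (distr lborel borel ((+) c)) f = (LINT p|lborel. f (c + p))"
    using assms by (intro integral_distr) auto
  then show ?thesis by (simp add: lborel_distr_plus add.commute)
qed

lemma nn_integral_translate:
  fixes f :: "plane \<Rightarrow> ennreal"
  assumes "f \<in> borel_measurable borel"
  shows "(\<integral>\<^sup>+ p. f (p + c) \<partial>lborel) = integral\<^sup>N lborel f"
proof -
  have "integral\<^sup>N (distr lborel borel ((+) c)) f = (\<integral>\<^sup>+ p. f (c + p) \<partial>lborel)"
    using assms by (intro nn_integral_distr) auto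
  then show ?thesis by (simp add: lborel_distr_plus add.commute)
qed

lemma AE_translate:
  fixes c :: plane
  assumes "AE p in lborel. R p"
  shows "AE p in lborel. R (p + c)"
proof -
  have "AE p in distr lborel borel ((+) c). R p" using assms by (simp only: lborel_distr_plus)
  from AE_distrD[OF _ this] show ?thesis by (simp add: add.commute)
qed

text \<open>The difference quotients have integral zero, as Lebesgue measure is translation invariant.\<close>

lemma integral_partial_eq_zero:
  assumes diff: "\<And>p. \<phi> differentiable (at p)" and cont: "continuous_on UNIV (partial b \<phi>)"
    and C: "compact C" "\<And>p. p \<notin> C \<Longrightarrow> \<phi> p = 0"
  shows "integral\<^sup>L lborel (partial b \<phi>) = 0"
proof -
  have cont\<phi>: "continuous_on UNIV \<phi>"
    using diff by (intro continuous_at_imp_continuous_on ballI differentiable_imp_continuous_within)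
  note [measurable] = borel_measurable_continuous_onI[OF cont\<phi>] borel_measurable_continuous_onI[OF cont]
  have zero: "partial b \<phi> p = 0" if "p \<notin> C" for p
    using partial_zero_outside[OF compact_imp_closed[OF C(1)] C(2) that] .
  obtain M where M: "\<And>p. \<bar>partial b \<phi> p\<bar> \<le> M"
    using bounded_of_compact_support[OF cont C(1) zero] by blast
  obtain M' where M': "\<And>p. \<bar>\<phi> p\<bar> \<le> M'"
    using bounded_of_compact_support[OF cont\<phi> C] by blast
  obtain r where r: "\<And>p. p \<in> C \<Longrightarrow> norm p \<le> r"
    using compact_imp_bounded[OF C(1)] by (auto simp: bounded_iff)
  define h where "h n = inverse (real (Suc n))" for n
  have h: "0 < h n" "h n \<le> 1" for n by (auto simp: h_def field_simps)
  have h_lim: "h \<longlonglongrightarrow> 0" unfolding h_def by (rule LIMSEQ_inverse_real_of_nat)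
  define s where "s n p = (\<phi> (p + h n *\<^sub>R b) - \<phi> p) / h n" for n p
  \<comment> \<open>The difference quotients are bounded by the mean value theorem and, as
    \<open>h n \<le> 1\<close>, vanish off one fixed ball, so dominated convergence applies.\<close>
  have "(\<lambda>n. integral\<^sup>L lborel (s n)) \<longlonglongrightarrow> integral\<^sup>L lborel (partial b \<phi>)"
  proof (rule integral_bounded_convergence[where A = "cball 0 (r + norm b)" and M = M])
    show "s n \<in> borel_measurable borel" for n unfolding s_def by measurable
    show "\<bar>s n p\<bar> \<le> M" for n p
    proof -
      have "((\<lambda>t. \<phi> (p + t *\<^sub>R b)) has_real_derivative partial b \<phi> (p + t *\<^sub>R b)) (at t)" for t
        by (intro has_real_derivative_along diff)
      from MVT2[OF h(1)[of n], OF this] obtain z where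
        "\<phi> (p + h n *\<^sub>R b) - \<phi> (p + 0 *\<^sub>R b) = (h n - 0) * partial b \<phi> (p + z *\<^sub>R b)" by blast
      then have "s n p = partial b \<phi> (p + z *\<^sub>R b)" using h(1)[of n] by (simp add: s_def)
      then show ?thesis using M by simp
    qed
    show "s n p = 0" if "p \<notin> cball 0 (r + norm b)" for n p
    proof -
      have p: "r + norm b < norm p" using that by simp
      have "norm (h n *\<^sub>R b) \<le> norm b" using h[of n] by (simp add: mult_left_le_one_le)
      then have "r < norm (p + h n *\<^sub>R b)" using p norm_diff_ineq[of p "h n *\<^sub>R b"] by linarith
      moreover have "r < norm p" using p norm_ge_zero[of b] by linarith
      ultimately have "p \<notin> C" "p + h n *\<^sub>R b \<notin> C" by (auto dest!: r)
      then show ?thesis by (simp add: s_def C(2))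
    qed
    show "AE p in lborel. (\<lambda>n. s n p) \<longlonglongrightarrow> partial b \<phi> p"
    proof (intro AE_I2)
      fix p
      have "((\<lambda>t. (\<phi> (p + t *\<^sub>R b) - \<phi> p) / t) \<longlongrightarrow> partial b \<phi> p) (at 0)"
        using has_real_derivative_along[of \<phi> p 0 b] diff by (simp add: DERIV_def)
      moreover have "filterlim h (at 0) sequentially"
        using h(1) h_lim by (auto simp: filterlim_at intro!: always_eventually less_imp_neq[symmetric])
      ultimately show "(\<lambda>n. s n p) \<longlonglongrightarrow> partial b \<phi> p"
        unfolding s_def by (rule filterlim_compose)
    qed
  qed auto
  moreover have "integral\<^sup>L lborel (s n) = 0" for n
  proof -
    have int: "integrable lborel \<phi>" "integrable lborel (\<lambda>p. \<phi> (p + h n *\<^sub>R b))"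
    proof -
      show "integrable lborel \<phi>"
        by (rule integrable_bounded_support[of _ C M']) (use C M' in \<open>auto intro: compact_imp_bounded borel_compact\<close>)
      show "integrable lborel (\<lambda>p. \<phi> (p + h n *\<^sub>R b))"
      proof (rule integrable_bounded_support[of _ "(\<lambda>p. - (h n *\<^sub>R b) + p) ` C" M'])
        show "\<phi> (p + h n *\<^sub>R b) = 0" if "p \<notin> (\<lambda>p. - (h n *\<^sub>R b) + p) ` C" for p
          using that C(2)[of "p + h n *\<^sub>R b"] by (force simp: image_iff)
      qed (use C M' compact_translation_subtract in \<open>auto intro!: compact_imp_bounded borel_compact\<close>)
    qed
    have "integral\<^sup>L lborel (s n) = ((LINT p|lborel. \<phi> (p + h n *\<^sub>R b)) - integral\<^sup>L lborel \<phi>) / h n"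
      unfolding s_def using int by simp
    then show ?thesis by (simp add: integral_translate)
  qed
  ultimately show ?thesis by (simp add: LIMSEQ_const_iff)
qed

text \<open>The product has compact support, so its derivative integrates to 0; the product rule
  splits that integral.\<close>

lemma integration_by_parts_test_functions:
  assumes "\<phi> \<in> test_functions \<Omega>" "\<psi> \<in> test_functions \<Omega>" "b \<in> Basis"
  shows "(LINT p|lborel. \<phi> p * partial b \<psi> p) = - (LINT p|lborel. partial b \<phi> p * \<psi> p)"
proof -
  obtain C where \<phi>: "compact C" "C \<subseteq> \<Omega>" "\<And>p. p \<notin> C \<Longrightarrow> \<phi> p = 0"
    "continuous_on UNIV \<phi>" "\<And>p. \<phi> differentiable (at p)" "continuous_on UNIV (partial b \<phi>)"
    using test_functionE[OF assms(1)] assms(3) by metis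
  obtain D where \<psi>: "continuous_on UNIV \<psi>" "\<And>p. \<psi> differentiable (at p)" "continuous_on UNIV (partial b \<psi>)"
    using test_functionE[OF assms(2)] assms(3) by metis
  have der: "((\<lambda>p. \<phi> p * \<psi> p) has_derivative
      (\<lambda>h. \<phi> p * frechet_derivative \<psi> (at p) h + frechet_derivative \<phi> (at p) h * \<psi> p)) (at p)" for p
    using \<phi>(5)[of p] \<psi>(2)[of p] by (intro has_derivative_mult) (simp_all flip: frechet_derivative_works)
  have eq: "partial b (\<lambda>p. \<phi> p * \<psi> p) = (\<lambda>p. \<phi> p * partial b \<psi> p + partial b \<phi> p * \<psi> p)"
    by (rule ext, subst partial_eqI[OF der]) (simp add: partial_def)
  have "integral\<^sup>L lborel (partial b (\<lambda>p. \<phi> p * \<psi> p)) = 0"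
  proof (rule integral_partial_eq_zero[OF _ _ \<phi>(1)])
    show "(\<lambda>p. \<phi> p * \<psi> p) differentiable at p" for p using \<phi>(5) \<psi>(2) by simp
    show "continuous_on UNIV (partial b (\<lambda>p. \<phi> p * \<psi> p))"
      unfolding eq by (intro continuous_intros \<phi> \<psi>)
  qed (use \<phi> in auto)
  moreover have "integrable lborel (\<lambda>p. \<phi> p * partial b \<psi> p)" "integrable lborel (\<lambda>p. partial b \<phi> p * \<psi> p)"
    by (intro sq_integrable_mult_integrable[of _ \<Omega>] test_function_sq_integrable
        partial_test_function_sq_integrable assms)+
  ultimately show ?thesis by (simp add: eq)
qed

subsection \<open>The space \<open>H10\<close>\<close>

lemma sq_integrableD:
  assumes "f \<in> sq_integrable \<Omega>"
  shows "f \<in> borel_measurable borel" "p \<notin> \<Omega> \<Longrightarrow> f p = 0" "integrable lborel (\<lambda>p. (f p)\<^sup>2)"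
  using assms by (auto simp: sq_integrable_def simp del: split_paired_All)

lemma integral_sq_eq:
  assumes "f \<in> sq_integrable \<Omega>" "g \<in> sq_integrable \<Omega>"
  shows "(LINT p:\<Omega>|lborel. (f p - g p)\<^sup>2) = (LINT p|lborel. (f p - g p)\<^sup>2)"
  by (rule set_integral_eq_integral) (use assms in \<open>auto simp: sq_integrable_def\<close>)

lemma weak_partial_iff:
  assumes "f \<in> sq_integrable \<Omega>" "g \<in> sq_integrable \<Omega>"
  shows "weak_partial \<Omega> b f g \<longleftrightarrow>
    (\<forall>\<psi>\<in>test_functions \<Omega>. (LINT p|lborel. f p * partial b \<psi> p) = - (LINT p|lborel. g p * \<psi> p))"
proof -
  have "(LINT p:\<Omega>|lborel. f p * \<psi> p) = (LINT p|lborel. f p * \<psi> p)"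
    "(LINT p:\<Omega>|lborel. g p * \<psi> p) = (LINT p|lborel. g p * \<psi> p)" for \<psi> :: "plane \<Rightarrow> real"
    by (rule set_integral_eq_integral; simp add: sq_integrableD(2)[OF assms(1)] sq_integrableD(2)[OF assms(2)])+
  then show ?thesis unfolding weak_partial_def by simp
qed

text \<open>Dominated convergence is used twice: in the integration by parts formula, which
  identifies \<open>g\<close> as the weak gradient, and in the squared distances, which gives the
  closure condition.\<close>

lemma H10_limitI:
  assumes \<Omega>: "\<Omega> \<in> sets borel" "bounded \<Omega>"
    and f: "f \<in> borel_measurable borel" "\<And>p. \<bar>f p\<bar> \<le> M" "\<And>p. p \<notin> \<Omega> \<Longrightarrow> f p = 0"
    and g: "\<And>b. b \<in> Basis \<Longrightarrow> g b \<in> borel_measurable borel"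
      "\<And>b p. b \<in> Basis \<Longrightarrow> \<bar>g b p\<bar> \<le> M" "\<And>b p. b \<in> Basis \<Longrightarrow> p \<notin> \<Omega> \<Longrightarrow> g b p = 0"
    and \<phi>: "\<And>n. \<phi> n \<in> test_functions \<Omega>" "\<And>n p. \<bar>\<phi> n p\<bar> \<le> M"
      "\<And>n b p. b \<in> Basis \<Longrightarrow> \<bar>partial b (\<phi> n) p\<bar> \<le> M"
    and lim: "AE p in lborel. (\<lambda>n. \<phi> n p) \<longlonglongrightarrow> f p"
      "\<And>b. b \<in> Basis \<Longrightarrow> AE p in lborel. (\<lambda>n. partial b (\<phi> n) p) \<longlonglongrightarrow> g b p"
  shows "ae_class f \<in> H10 \<Omega>"
proof -
  have fsq: "f \<in> sq_integrable \<Omega>" by (rule sq_integrable_bounded[OF f(1) \<Omega> f(2,3)])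
  have gsq: "g b \<in> sq_integrable \<Omega>" if "b \<in> Basis" for b
    by (rule sq_integrable_bounded[OF g(1)[OF that] \<Omega> g(2,3)[OF that]])
  have \<phi>sq: "\<phi> n \<in> sq_integrable \<Omega>" "b \<in> Basis \<Longrightarrow> partial b (\<phi> n) \<in> sq_integrable \<Omega>" for n b
    using \<phi>(1) test_function_sq_integrable partial_test_function_sq_integrable by blast+
  have diff_lim: "(\<lambda>n. LINT p|lborel. (u p - s n p)\<^sup>2) \<longlonglongrightarrow> 0"
    if u: "u \<in> sq_integrable \<Omega>" "\<And>p. \<bar>u p\<bar> \<le> M" and s: "\<And>n. s n \<in> sq_integrable \<Omega>" "\<And>n p. \<bar>s n p\<bar> \<le> M"
      and "AE p in lborel. (\<lambda>n. s n p) \<longlonglongrightarrow> u p" for u s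
  proof -
    have "(\<lambda>n. LINT p|lborel. (u p - s n p)\<^sup>2) \<longlonglongrightarrow> (LINT p|(lborel :: plane measure). (0 :: real))"
    proof (rule integral_bounded_convergence[OF _ _ \<Omega>, where M = "(2 * M)\<^sup>2"])
      show "(\<lambda>p. (u p - s n p)\<^sup>2) \<in> borel_measurable borel" for n
        using sq_integrableD(1)[OF u(1)] sq_integrableD(1)[OF s(1)] by measurable
      show "\<bar>(u p - s n p)\<^sup>2\<bar> \<le> (2 * M)\<^sup>2" for n p
      proof -
        have "\<bar>u p - s n p\<bar> \<le> 2 * M" using u(2)[of p] s(2)[of n p] by linarith
        from power_mono[OF this, of 2] show ?thesis by simp
      qed
      show "(u p - s n p)\<^sup>2 = 0" if "p \<notin> \<Omega>" for n p
        using sq_integrableD(2)[OF u(1) that] sq_integrableD(2)[OF s(1) that] by simp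
      show "AE p in lborel. (\<lambda>n. (u p - s n p)\<^sup>2) \<longlonglongrightarrow> 0"
        using that(5) by eventually_elim (auto intro!: tendsto_eq_intros)
    qed auto
    then show ?thesis by simp
  qed
  have weak: "weak_partial \<Omega> b f (g b)" if b: "b \<in> Basis" for b
    unfolding weak_partial_iff[OF fsq gsq[OF b]]
  proof
    fix \<psi> assume \<psi>: "\<psi> \<in> test_functions \<Omega>"
    have \<psi>sq: "\<psi> \<in> sq_integrable \<Omega>" "partial b \<psi> \<in> sq_integrable \<Omega>"
      using \<psi> b test_function_sq_integrable partial_test_function_sq_integrable by blast+
    have lim': "(\<lambda>n. LINT p|lborel. s n p * \<zeta> p) \<longlonglongrightarrow> (LINT p|lborel. u p * \<zeta> p)"
      if u: "u \<in> sq_integrable \<Omega>" and s: "\<And>n. s n \<in> sq_integrable \<Omega>" "\<And>n p. \<bar>s n p\<bar> \<le> M"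
        and l: "AE p in lborel. (\<lambda>n. s n p) \<longlonglongrightarrow> u p"
        and \<zeta>: "\<zeta> \<in> sq_integrable \<Omega>" "\<And>p. \<bar>\<zeta> p\<bar> \<le> N" for u s \<zeta> N
    proof (rule integral_bounded_convergence[OF _ _ \<Omega>, where M = "M * N"])
      show "(\<lambda>p. u p * \<zeta> p) \<in> borel_measurable borel" "(\<lambda>p. s n p * \<zeta> p) \<in> borel_measurable borel" for n
        using sq_integrableD(1)[OF u(1)] sq_integrableD(1)[OF s(1)] sq_integrableD(1)[OF \<zeta>(1)] by measurable
      show "\<bar>s n p * \<zeta> p\<bar> \<le> M * N" for n p
        unfolding abs_mult using s(2)[of n p] \<zeta>(2)[of p] by (intro mult_mono) auto
      show "s n p * \<zeta> p = 0" if "p \<notin> \<Omega>" for n p using sq_integrableD(2)[OF s(1) that] by simp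
      show "AE p in lborel. (\<lambda>n. s n p * \<zeta> p) \<longlonglongrightarrow> u p * \<zeta> p"
        using l by eventually_elim (auto intro!: tendsto_intros)
    qed
    obtain C where C: "compact C" "\<And>p. p \<notin> C \<Longrightarrow> \<psi> p = 0" "\<And>p. p \<notin> C \<Longrightarrow> partial b \<psi> p = 0"
      "continuous_on UNIV \<psi>" "continuous_on UNIV (partial b \<psi>)"
      using test_functionE[OF \<psi>] b by metis
    obtain N where N: "\<And>p. \<bar>\<psi> p\<bar> \<le> N" using bounded_of_compact_support[OF C(4,1,2)] by blast
    obtain N' where N': "\<And>p. \<bar>partial b \<psi> p\<bar> \<le> N'" using bounded_of_compact_support[OF C(5,1,3)] by blast
    have "(\<lambda>n. LINT p|lborel. \<phi> n p * partial b \<psi> p) \<longlonglongrightarrow> (LINT p|lborel. f p * partial b \<psi> p)"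
      by (rule lim'[OF fsq \<phi>sq(1) \<phi>(2) lim(1) \<psi>sq(2) N'])
    moreover have "(\<lambda>n. - (LINT p|lborel. partial b (\<phi> n) p * \<psi> p)) \<longlonglongrightarrow> - (LINT p|lborel. g b p * \<psi> p)"
      by (intro tendsto_minus lim'[OF gsq[OF b] \<phi>sq(2)[OF b] \<phi>(3)[OF b] lim(2)[OF b] \<psi>sq(1) N])
    ultimately show "(LINT p|lborel. f p * partial b \<psi> p) = - (LINT p|lborel. g b p * \<psi> p)"
      using integration_by_parts_test_functions[OF \<phi>(1) \<psi> b] LIMSEQ_unique by simp
  qed
  have "\<exists>\<zeta>\<in>test_functions \<Omega>. (LINT p:\<Omega>|lborel. (f p - \<zeta> p)\<^sup>2) +
        (\<Sum>b\<in>Basis. LINT p:\<Omega>|lborel. (g b p - partial b \<zeta> p)\<^sup>2) < \<epsilon>" if "0 < \<epsilon>" for \<epsilon>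
  proof -
    have "(\<lambda>n. (LINT p|lborel. (f p - \<phi> n p)\<^sup>2) +
        (\<Sum>b\<in>Basis. LINT p|lborel. (g b p - partial b (\<phi> n) p)\<^sup>2)) \<longlonglongrightarrow> 0 + (\<Sum>b\<in>(Basis :: plane set). 0)"
      by (intro tendsto_add tendsto_sum diff_lim fsq gsq \<phi>sq f g \<phi> lim)
    then have "\<forall>\<^sub>F n in sequentially. (LINT p|lborel. (f p - \<phi> n p)\<^sup>2) +
        (\<Sum>b\<in>Basis. LINT p|lborel. (g b p - partial b (\<phi> n) p)\<^sup>2) < \<epsilon>"
      using that by (intro order_tendstoD(2)) auto
    then obtain n where "(LINT p|lborel. (f p - \<phi> n p)\<^sup>2) +
        (\<Sum>b\<in>Basis. LINT p|lborel. (g b p - partial b (\<phi> n) p)\<^sup>2) < \<epsilon>"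
      by (auto simp: eventually_sequentially)
    then show ?thesis
      using \<phi>(1) by (intro bexI[of _ "\<phi> n"]) (simp_all add: integral_sq_eq fsq gsq \<phi>sq)
  qed
  then show ?thesis unfolding H10_def using fsq gsq weak by blast
qed

text \<open>A first partial derivative of such a product is a combination of two products of the
  same kind with one order of smoothness less; the components of \<open>b\<close> are constant
  coefficients.\<close>

lemma Ck_tensor:
  "Ck_real k F \<Longrightarrow> Ck_real k G \<Longrightarrow> Ck k (\<lambda>p. F (fst p) * G (snd p))"
proof (induction k arbitrary: F G)
  case 0
  then show ?case
    by (auto intro!: continuous_intros continuous_on_compose2[of UNIV F] continuous_on_compose2[of UNIV G])
next
  case (Suc k)
  then obtain F' G' where
    D: "\<And>x. (F has_real_derivative F' x) (at x)" "\<And>x. (G has_real_derivative G' x) (at x)"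
      "Ck_real k F'" "Ck_real k G'" by auto
  have der: "((\<lambda>p. F (fst p) * G (snd p)) has_derivative
      (\<lambda>h. F (fst p) * (snd h * G' (snd p)) + fst h * F' (fst p) * G (snd p))) (at p)" for p
    by (intro has_derivative_mult DERIV_compose_FDERIV[OF D(1)] DERIV_compose_FDERIV[OF D(2)] has_derivative_fst has_derivative_snd has_derivative_ident)
  have "partial b (\<lambda>p. F (fst p) * G (snd p)) =
      (\<lambda>p. snd b * (F (fst p) * G' (snd p)) + fst b * (F' (fst p) * G (snd p)))" for b
    by (simp add: fun_eq_iff partial_eqI[OF der])
  moreover have "Ck k (\<lambda>p. snd b * (F (fst p) * G' (snd p)) + fst b * (F' (fst p) * G (snd p)))" for b :: plane
    using Suc.prems[THEN Ck_real_Suc_imp] D by (intro Ck_lincomb Suc.IH)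
  ultimately show ?case using differentiableI[OF der] by (simp add: differentiable_on_def)
qed

lemma partial_tensor:
  assumes "\<And>x. (F has_real_derivative F' x) (at x)" "\<And>x. (G has_real_derivative G' x) (at x)"
  shows "partial (1, 0) (\<lambda>p. F (fst p) * G (snd p)) p = F' (fst p) * G (snd p)"
    "partial (0, 1) (\<lambda>p. F (fst p) * G (snd p)) p = F (fst p) * G' (snd p)"
proof -
  have der: "((\<lambda>p. F (fst p) * G (snd p)) has_derivative
      (\<lambda>h. F (fst p) * (snd h * G' (snd p)) + fst h * F' (fst p) * G (snd p))) (at p)"
    by (intro has_derivative_mult DERIV_compose_FDERIV[OF assms(1)] DERIV_compose_FDERIV[OF assms(2)] has_derivative_fst has_derivative_snd has_derivative_ident)
  show "partial (1, 0) (\<lambda>p. F (fst p) * G (snd p)) p = F' (fst p) * G (snd p)"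
    "partial (0, 1) (\<lambda>p. F (fst p) * G (snd p)) p = F (fst p) * G' (snd p)"
    by (simp_all add: partial_eqI[OF der])
qed

lemma AE_fst_neq: "AE p in (lborel :: plane measure). fst p \<noteq> x"
  and AE_snd_neq: "AE p in (lborel :: plane measure). snd p \<noteq> x"
  using AE_lborel_inner_neq[of "(1, 0) :: plane" x] AE_lborel_inner_neq[of "(0, 1) :: plane" x]
  by (simp_all add: plane_Basis inner_prod_def)

lemma hat_slope_bound:
  assumes "a < b" "b < c"
  shows "\<bar>hat_slope a b c x\<bar> \<le> 2 / (b - a) + 2 / (c - b)"
proof -
  have bound: "\<bar>u * of_bool A - (u + v) * of_bool B + v * of_bool C\<bar> \<le> 2 * u + 2 * v"
    if "0 \<le> u" "0 \<le> v" for u v :: real and A B C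
    using that by (cases A; cases B; cases C) auto
  show ?thesis using bound[of "1 / (b - a)" "1 / (c - b)"] assms unfolding hat_slope_def by simp
qed

text \<open>Products of the one-dimensional approximations serve as test functions. Each partial
  derivative has one slope factor and one value factor, both bounded, and converges off six lines
  parallel to the axes.\<close>

lemma hat_tensor_in_H10:
  assumes abc: "x0 \<le> a" "a < b" "b < c" "c \<le> x1" and abc': "y0 \<le> a'" "a' < b'" "b' < c'" "c' \<le> y1"
  shows "ae_class (\<lambda>p. hat a b c (fst p) * hat a' b' c' (snd p)) \<in> H10 (box (x0, y0) (x1, y1))"
proof -
  obtain \<Phi> \<Phi>' M where \<Phi>: "\<And>n k. Ck_real k (\<Phi> n)" "\<And>n x. (\<Phi> n has_real_derivative \<Phi>' n x) (at x)"
    "\<And>n. \<exists>\<alpha> \<gamma>. a < \<alpha> \<and> \<gamma> < c \<and> (\<forall>x. x \<notin> {\<alpha>..\<gamma>} \<longrightarrow> \<Phi> n x = 0)"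
    "\<And>x. (\<lambda>n. \<Phi> n x) \<longlonglongrightarrow> hat a b c x"
    "\<And>x. x \<notin> {a, b, c} \<Longrightarrow> (\<lambda>n. \<Phi>' n x) \<longlonglongrightarrow> hat_slope a b c x"
    "\<And>n x. \<bar>\<Phi> n x\<bar> \<le> M" "\<And>n x. \<bar>\<Phi>' n x\<bar> \<le> M"
    using hat_smooth_approx[OF abc(2,3)] by blast
  obtain \<Psi> \<Psi>' N where \<Psi>: "\<And>n k. Ck_real k (\<Psi> n)" "\<And>n x. (\<Psi> n has_real_derivative \<Psi>' n x) (at x)"
    "\<And>n. \<exists>\<alpha> \<gamma>. a' < \<alpha> \<and> \<gamma> < c' \<and> (\<forall>x. x \<notin> {\<alpha>..\<gamma>} \<longrightarrow> \<Psi> n x = 0)"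
    "\<And>x. (\<lambda>n. \<Psi> n x) \<longlonglongrightarrow> hat a' b' c' x"
    "\<And>x. x \<notin> {a', b', c'} \<Longrightarrow> (\<lambda>n. \<Psi>' n x) \<longlonglongrightarrow> hat_slope a' b' c' x"
    "\<And>n x. \<bar>\<Psi> n x\<bar> \<le> N" "\<And>n x. \<bar>\<Psi>' n x\<bar> \<le> N"
    using hat_smooth_approx[OF abc'(2,3)] by blast
  let ?\<Omega> = "box (x0, y0) (x1, y1)"
  \<comment> \<open>The bounds have to cover the limiting slopes as well as the
    approximations.\<close>
  define B where "B = 2 / (b - a) + 2 / (c - b) + M"
  define B' where "B' = 2 / (b' - a') + 2 / (c' - b') + N"
  have MN: "0 \<le> M" "0 \<le> N" using \<Phi>(6)[of 0 0] \<Psi>(6)[of 0 0] by linarith+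
  have hat_bd: "\<bar>hat a b c x\<bar> \<le> M" "\<bar>hat a' b' c' x\<bar> \<le> N" for x
    using tendsto_rabs[OF \<Phi>(4)[of x]] tendsto_rabs[OF \<Psi>(4)[of x]] \<Phi>(6) \<Psi>(6)
    by (auto intro: LIMSEQ_le_const2)
  have slope_bd: "\<bar>hat_slope a b c x\<bar> \<le> B" "M \<le> B" for x
    using hat_slope_bound[OF abc(2,3), of x] abc MN by (simp_all add: B_def)
  have slope_bd': "\<bar>hat_slope a' b' c' x\<bar> \<le> B'" "N \<le> B'" for x
    using hat_slope_bound[OF abc'(2,3), of x] abc' MN by (simp_all add: B'_def)
  have mult_bd: "\<bar>u * v\<bar> \<le> B * B'" if "\<bar>u\<bar> \<le> B" "\<bar>v\<bar> \<le> B'" for u v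
    unfolding abs_mult using that by (intro mult_mono) auto
  define \<phi> where "\<phi> n p = \<Phi> n (fst p) * \<Psi> n (snd p)" for n and p :: plane
  define g where "g e p = (if e = (1, 0) then hat_slope a b c (fst p) * hat a' b' c' (snd p)
      else hat a b c (fst p) * hat_slope a' b' c' (snd p))" for e p :: plane
  have \<phi>_partial: "partial (1, 0) (\<phi> n) p = \<Phi>' n (fst p) * \<Psi> n (snd p)"
      "partial (0, 1) (\<phi> n) p = \<Phi> n (fst p) * \<Psi>' n (snd p)" for n p
    unfolding \<phi>_def by (rule partial_tensor[OF \<Phi>(2) \<Psi>(2)])+
  \<comment> \<open>Outside the open box one factor vanishes together with its slope, so both
    components of the gradient vanish. On the boundary this rests on the values of
    \<open>hat_slope\<close> at the end points.\<close>
  have outside: "hat a b c (fst p) = 0 \<and> hat_slope a b c (fst p) = 0 \<or>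
      hat a' b' c' (snd p) = 0 \<and> hat_slope a' b' c' (snd p) = 0" if "p \<notin> ?\<Omega>" for p
  proof -
    obtain s t where p: "p = (s, t)" by (cases p)
    have "s \<le> a \<or> c \<le> s \<or> t \<le> a' \<or> c' \<le> t"
      using that abc abc' unfolding p box_Pair by linarith
    then consider "s \<le> a \<or> c \<le> s" | "t \<le> a' \<or> c' \<le> t" by blast
    then show ?thesis
      using hat_slope_outside[OF abc(2,3), of s] hat_slope_outside[OF abc'(2,3), of t]
        hat_simps(1,4)[OF abc(2,3), of s] hat_simps(1,4)[OF abc'(2,3), of t]
      by cases (auto simp: p)
  qed
  show ?thesis
  proof (rule H10_limitI[where M = "B * B'" and g = g and \<phi> = \<phi>])
    show "(\<lambda>p. hat a b c (fst p) * hat a' b' c' (snd p)) \<in> borel_measurable borel"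
      unfolding hat_def borel_prod[symmetric] by measurable
    show "g e \<in> borel_measurable borel" for e
      unfolding g_def hat_def hat_slope_def of_bool_def borel_prod[symmetric] by measurable
    show "\<bar>hat a b c (fst p) * hat a' b' c' (snd p)\<bar> \<le> B * B'" for p :: plane
      using hat_bd slope_bd slope_bd' by (intro mult_bd) (blast intro: order_trans)+
    show "\<bar>g e p\<bar> \<le> B * B'" for e p
      unfolding g_def using hat_bd slope_bd slope_bd' by (auto intro!: mult_bd intro: order_trans)
    show "\<bar>\<phi> n p\<bar> \<le> B * B'" for n p
      unfolding \<phi>_def using \<Phi>(6) \<Psi>(6) slope_bd slope_bd' by (intro mult_bd) (blast intro: order_trans)+
    show "\<bar>partial e (\<phi> n) p\<bar> \<le> B * B'" if "e \<in> Basis" for e n p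
    proof -
      have "\<bar>\<Phi> n x\<bar> \<le> B" "\<bar>\<Phi>' n x\<bar> \<le> B" "\<bar>\<Psi> n x\<bar> \<le> B'" "\<bar>\<Psi>' n x\<bar> \<le> B'" for x
        using \<Phi>(6,7)[of n x] \<Psi>(6,7)[of n x] slope_bd(2) slope_bd'(2) by linarith+
      then show ?thesis using that by (auto simp: plane_Basis \<phi>_partial intro!: mult_bd)
    qed
    show "hat a b c (fst p) * hat a' b' c' (snd p) = 0" "g e p = 0" if "p \<notin> ?\<Omega>" for e p
      using outside[OF that] by (auto simp: g_def)
    show "\<phi> n \<in> test_functions ?\<Omega>" for n
    proof -
      obtain \<alpha> \<gamma> where 1: "a < \<alpha>" "\<gamma> < c" "\<And>x. x \<notin> {\<alpha>..\<gamma>} \<Longrightarrow> \<Phi> n x = 0" using \<Phi>(3)[of n] by blast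
      obtain \<alpha>' \<gamma>' where 2: "a' < \<alpha>'" "\<gamma>' < c'" "\<And>x. x \<notin> {\<alpha>'..\<gamma>'} \<Longrightarrow> \<Psi> n x = 0" using \<Psi>(3)[of n] by blast
      have "cbox (\<alpha>, \<alpha>') (\<gamma>, \<gamma>') \<subseteq> ?\<Omega>"
        using 1 2 abc abc' by (auto simp: box_Pair cbox_Pair)
      moreover have "\<phi> n p = 0" if "p \<notin> cbox (\<alpha>, \<alpha>') (\<gamma>, \<gamma>')" for p
        using that 1(3)[of "fst p"] 2(3)[of "snd p"] by (cases p) (auto simp: \<phi>_def cbox_Pair)
      moreover have "Ck k (\<phi> n)" for k unfolding \<phi>_def by (intro Ck_tensor \<Phi> \<Psi>)
      ultimately show ?thesis
        unfolding test_functions_def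
        by (intro CollectI conjI allI exI[of _ "cbox (\<alpha>, \<alpha>') (\<gamma>, \<gamma>')"] impI compact_cbox)
    qed
    show "AE p in lborel. (\<lambda>n. \<phi> n p) \<longlonglongrightarrow> hat a b c (fst p) * hat a' b' c' (snd p)"
      unfolding \<phi>_def by (intro AE_I2 tendsto_mult \<Phi> \<Psi>)
    show "AE p in lborel. (\<lambda>n. partial e (\<phi> n) p) \<longlonglongrightarrow> g e p" if "e \<in> Basis" for e
      using AE_fst_neq[of a] AE_fst_neq[of b] AE_fst_neq[of c] AE_snd_neq[of a'] AE_snd_neq[of b'] AE_snd_neq[of c']
    proof eventually_elim
      case (elim p)
      then have "(\<lambda>n. \<Phi>' n (fst p)) \<longlonglongrightarrow> hat_slope a b c (fst p)" "(\<lambda>n. \<Psi>' n (snd p)) \<longlonglongrightarrow> hat_slope a' b' c' (snd p)"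
        using \<Phi>(5) \<Psi>(5) by auto
      then show ?case using that \<Phi>(4) \<Psi>(4) by (auto simp: plane_Basis \<phi>_partial g_def intro!: tendsto_mult)
    qed
  qed auto
qed

section \<open>Linear structure of \<open>H10\<close>\<close>

lemma H10_E:
  assumes "w \<in> H10 \<Omega>"
  obtains f g where "w = ae_class f" "f \<in> sq_integrable \<Omega>"
    "\<forall>b\<in>Basis. g b \<in> sq_integrable \<Omega> \<and> weak_partial \<Omega> b f (g b)"
    "\<forall>\<epsilon>>0. \<exists>\<phi>\<in>test_functions \<Omega>. (LINT p:\<Omega>|lborel. (f p - \<phi> p)\<^sup>2) +
        (\<Sum>b\<in>Basis. LINT p:\<Omega>|lborel. (g b p - partial b \<phi> p)\<^sup>2) < \<epsilon>"
  using assms unfolding H10_def by (elim CollectE exE conjE)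

lemma subspace_H10: "subspace (H10 \<Omega>)"
proof (rule subspaceI)
  have zero: "(\<lambda>_. 0) \<in> test_functions \<Omega>"
  proof -
    have "Ck k (\<lambda>_. 0)" for k
    proof (induction k)
      case (Suc k)
      have "partial b (\<lambda>_. 0) = (\<lambda>_. 0)" for b
        using partial_eqI[OF has_derivative_const] by (simp add: fun_eq_iff)
      then show ?case using Suc by simp
    qed simp
    then show ?thesis unfolding test_functions_def by (auto intro!: exI[of _ "{}"])
  qed
  have p0: "partial b (\<lambda>_. 0) p = 0" for b p using partial_eqI[OF has_derivative_const] by simp
  have sq0: "(\<lambda>_. 0) \<in> sq_integrable \<Omega>" by (simp add: sq_integrable_def)
  have "\<exists>f g. (0 :: ae_fun) = ae_class f \<and> f \<in> sq_integrable \<Omega> \<and>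
     (\<forall>b\<in>Basis. g b \<in> sq_integrable \<Omega> \<and> weak_partial \<Omega> b f (g b)) \<and>
     (\<forall>\<epsilon>>0. \<exists>\<phi>\<in>test_functions \<Omega>.
        (LINT p:\<Omega>|lborel. (f p - \<phi> p)\<^sup>2) +
        (\<Sum>b\<in>Basis. LINT p:\<Omega>|lborel. (g b p - partial b \<phi> p)\<^sup>2) < \<epsilon>)"
    using zero sq0 p0
    by (intro exI[of _ "\<lambda>_. 0"] exI[of _ "\<lambda>_ _. 0"])
       (auto simp: weak_partial_iff zero_ae_fun_def partial_eqI[OF has_derivative_const] simp del: split_paired_All intro!: bexI[of _ "\<lambda>_. 0"])
  then show "0 \<in> H10 \<Omega>" unfolding H10_def by blast
  have lincomb: "x *\<^sub>R u + y *\<^sub>R v \<in> H10 \<Omega>" if u: "u \<in> H10 \<Omega>" and v: "v \<in> H10 \<Omega>" for u v x y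
  proof -
    obtain f g where f: "u = ae_class f" "f \<in> sq_integrable \<Omega>"
      "\<forall>b\<in>Basis. g b \<in> sq_integrable \<Omega> \<and> weak_partial \<Omega> b f (g b)"
      "\<forall>\<epsilon>>0. \<exists>\<phi>\<in>test_functions \<Omega>. (LINT p:\<Omega>|lborel. (f p - \<phi> p)\<^sup>2) +
        (\<Sum>b\<in>Basis. LINT p:\<Omega>|lborel. (g b p - partial b \<phi> p)\<^sup>2) < \<epsilon>"
      using H10_E[OF u] .
    obtain f' g' where f': "v = ae_class f'" "f' \<in> sq_integrable \<Omega>"
      "\<forall>b\<in>Basis. g' b \<in> sq_integrable \<Omega> \<and> weak_partial \<Omega> b f' (g' b)"
      "\<forall>\<epsilon>>0. \<exists>\<phi>\<in>test_functions \<Omega>. (LINT p:\<Omega>|lborel. (f' p - \<phi> p)\<^sup>2) +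
        (\<Sum>b\<in>Basis. LINT p:\<Omega>|lborel. (g' b p - partial b \<phi> p)\<^sup>2) < \<epsilon>"
      using H10_E[OF v] .
    let ?f = "\<lambda>p. x * f p + y * f' p" and ?g = "\<lambda>b p. x * g b p + y * g' b p"
    have fsq: "?f \<in> sq_integrable \<Omega>" by (intro sq_integrable_lincomb f f')
    have gsq: "?g b \<in> sq_integrable \<Omega>" if "b \<in> Basis" for b
      using f(3) f'(3) that by (intro sq_integrable_lincomb) auto
    have "weak_partial \<Omega> b ?f (?g b)" if b: "b \<in> Basis" for b
      unfolding weak_partial_iff[OF fsq gsq[OF b]]
    proof
      fix \<psi> assume \<psi>: "\<psi> \<in> test_functions \<Omega>"
      note \<psi>sq = test_function_sq_integrable[OF \<psi>] partial_test_function_sq_integrable[OF \<psi> b]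
      have "weak_partial \<Omega> b f (g b)" "g b \<in> sq_integrable \<Omega>"
        "weak_partial \<Omega> b f' (g' b)" "g' b \<in> sq_integrable \<Omega>"
        using f(3) f'(3) b by blast+
      then have "(LINT p|lborel. f p * partial b \<psi> p) = - (LINT p|lborel. g b p * \<psi> p)"
        "(LINT p|lborel. f' p * partial b \<psi> p) = - (LINT p|lborel. g' b p * \<psi> p)"
        using weak_partial_iff[OF f(2)] weak_partial_iff[OF f'(2)] \<psi> by blast+
      moreover have "integrable lborel (\<lambda>p. f p * partial b \<psi> p)" "integrable lborel (\<lambda>p. f' p * partial b \<psi> p)"
        "integrable lborel (\<lambda>p. g b p * \<psi> p)" "integrable lborel (\<lambda>p. g' b p * \<psi> p)"
        using f(2,3) f'(2,3) b \<psi>sq by (auto intro!: sq_integrable_mult_integrable)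
      ultimately show "(LINT p|lborel. ?f p * partial b \<psi> p) = - (LINT p|lborel. ?g b p * \<psi> p)"
        by (simp add: distrib_right mult.assoc)
    qed
    moreover have "\<exists>\<phi>\<in>test_functions \<Omega>. (LINT p:\<Omega>|lborel. (?f p - \<phi> p)\<^sup>2) +
        (\<Sum>b\<in>Basis. LINT p:\<Omega>|lborel. (?g b p - partial b \<phi> p)\<^sup>2) < \<epsilon>" if "\<epsilon> > 0" for \<epsilon>
    proof -
      \<comment> \<open>The two errors enter with the factors \<open>2 x^2\<close> and
        \<open>2 y^2\<close>; the summand 1 keeps the denominator positive and the final inequality
        strict.\<close>
      define \<delta> where "\<delta> = \<epsilon> / (2 * x\<^sup>2 + 2 * y\<^sup>2 + 1)"
      have den: "0 < 2 * x\<^sup>2 + 2 * y\<^sup>2 + 1" by (simp add: add_nonneg_pos)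
      then have "0 < \<delta>" using that by (simp add: \<delta>_def)
      obtain \<phi> where \<phi>: "\<phi> \<in> test_functions \<Omega>" "(LINT p:\<Omega>|lborel. (f p - \<phi> p)\<^sup>2) +
        (\<Sum>b\<in>Basis. LINT p:\<Omega>|lborel. (g b p - partial b \<phi> p)\<^sup>2) < \<delta>" using f(4) \<open>0 < \<delta>\<close> by blast
      obtain \<psi> where \<psi>: "\<psi> \<in> test_functions \<Omega>" "(LINT p:\<Omega>|lborel. (f' p - \<psi> p)\<^sup>2) +
        (\<Sum>b\<in>Basis. LINT p:\<Omega>|lborel. (g' b p - partial b \<psi> p)\<^sup>2) < \<delta>" using f'(4) \<open>0 < \<delta>\<close> by blast
      define \<zeta> where "\<zeta> = (\<lambda>p. x * \<phi> p + y * \<psi> p)"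
      have \<zeta>: "\<zeta> \<in> test_functions \<Omega>" unfolding \<zeta>_def by (intro test_functions_lincomb \<phi> \<psi>)
      have partial: "partial b \<zeta> = (\<lambda>p. x * partial b \<phi> p + y * partial b \<psi> p)" for b
        unfolding \<zeta>_def using \<phi>(1) \<psi>(1) by (intro ext partial_lincomb) (auto elim: test_functionE)
      \<comment> \<open>The inequality \<open>(s + t)^2 \<le> 2 s^2 + 2 t^2\<close>,
        integrated.\<close>
      have le: "(LINT p:\<Omega>|lborel. ((x * u p + y * u' p) - (x * s p + y * s' p))\<^sup>2) \<le>
          2 * x\<^sup>2 * (LINT p:\<Omega>|lborel. (u p - s p)\<^sup>2) + 2 * y\<^sup>2 * (LINT p:\<Omega>|lborel. (u' p - s' p)\<^sup>2)"
        if u: "u \<in> sq_integrable \<Omega>" "u' \<in> sq_integrable \<Omega>" "s \<in> sq_integrable \<Omega>" "s' \<in> sq_integrable \<Omega>"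
        for u u' s s'
      proof -
        have d: "(\<lambda>p. u p - s p) \<in> sq_integrable \<Omega>" "(\<lambda>p. u' p - s' p) \<in> sq_integrable \<Omega>"
          using sq_integrable_lincomb[OF u(1,3), of 1 "-1"] sq_integrable_lincomb[OF u(2,4), of 1 "-1"] by simp_all
        have "(LINT p|lborel. ((x * u p + y * u' p) - (x * s p + y * s' p))\<^sup>2) \<le>
          (LINT p|lborel. 2 * x\<^sup>2 * (u p - s p)\<^sup>2 + 2 * y\<^sup>2 * (u' p - s' p)\<^sup>2)"
        proof (rule integral_mono)
          have "(\<lambda>p. x * (u p - s p) + y * (u' p - s' p)) \<in> sq_integrable \<Omega>"
            by (rule sq_integrable_lincomb[OF d])
          moreover have "x * (u p - s p) + y * (u' p - s' p) = (x * u p + y * u' p) - (x * s p + y * s' p)" for p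
            by (simp add: algebra_simps)
          ultimately show "integrable lborel (\<lambda>p. ((x * u p + y * u' p) - (x * s p + y * s' p))\<^sup>2)"
            by (simp add: sq_integrable_def)
          show "integrable lborel (\<lambda>p. 2 * x\<^sup>2 * (u p - s p)\<^sup>2 + 2 * y\<^sup>2 * (u' p - s' p)\<^sup>2)"
            using d by (simp add: sq_integrable_def)
          show "((x * u p + y * u' p) - (x * s p + y * s' p))\<^sup>2 \<le>
              2 * x\<^sup>2 * (u p - s p)\<^sup>2 + 2 * y\<^sup>2 * (u' p - s' p)\<^sup>2" for p
            using zero_le_power2[of "x * (u p - s p) - y * (u' p - s' p)"]
            by (simp add: power2_eq_square algebra_simps)
        qed
        then show ?thesis
          using sq_integrableD(3)[OF d(1)] sq_integrableD(3)[OF d(2)]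
          unfolding integral_sq_eq[OF u(1,3)] integral_sq_eq[OF u(2,4)]
            integral_sq_eq[OF sq_integrable_lincomb[OF u(1,2)] sq_integrable_lincomb[OF u(3,4)]]
          by simp
      qed
      have "(LINT p:\<Omega>|lborel. (?f p - \<zeta> p)\<^sup>2) +
          (\<Sum>b\<in>Basis. LINT p:\<Omega>|lborel. (?g b p - partial b \<zeta> p)\<^sup>2) \<le>
        (2 * x\<^sup>2 * (LINT p:\<Omega>|lborel. (f p - \<phi> p)\<^sup>2) + 2 * y\<^sup>2 * (LINT p:\<Omega>|lborel. (f' p - \<psi> p)\<^sup>2)) +
        (\<Sum>b\<in>Basis. 2 * x\<^sup>2 * (LINT p:\<Omega>|lborel. (g b p - partial b \<phi> p)\<^sup>2) +
           2 * y\<^sup>2 * (LINT p:\<Omega>|lborel. (g' b p - partial b \<psi> p)\<^sup>2))"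
        unfolding partial unfolding \<zeta>_def
        using f(3) f'(3)
        by (intro add_mono sum_mono le f(2) f'(2) test_function_sq_integrable[OF \<phi>(1)]
            test_function_sq_integrable[OF \<psi>(1)] partial_test_function_sq_integrable[OF \<phi>(1)]
            partial_test_function_sq_integrable[OF \<psi>(1)]) auto
      also have "\<dots> = 2 * x\<^sup>2 * ((LINT p:\<Omega>|lborel. (f p - \<phi> p)\<^sup>2) +
           (\<Sum>b\<in>Basis. LINT p:\<Omega>|lborel. (g b p - partial b \<phi> p)\<^sup>2)) +
         2 * y\<^sup>2 * ((LINT p:\<Omega>|lborel. (f' p - \<psi> p)\<^sup>2) +
           (\<Sum>b\<in>Basis. LINT p:\<Omega>|lborel. (g' b p - partial b \<psi> p)\<^sup>2))"
        by (simp add: sum.distrib sum_distrib_left distrib_left)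
      also have "\<dots> \<le> 2 * x\<^sup>2 * \<delta> + 2 * y\<^sup>2 * \<delta>"
        using \<phi>(2) \<psi>(2) by (intro add_mono mult_left_mono) auto
      also have "\<dots> < (2 * x\<^sup>2 + 2 * y\<^sup>2 + 1) * \<delta>" using \<open>0 < \<delta>\<close> by (simp add: distrib_right)
      also have "\<dots> = \<epsilon>" using den by (simp add: \<delta>_def)
      finally show ?thesis using \<zeta> by blast
    qed
    moreover have "x *\<^sub>R u + y *\<^sub>R v = ae_class ?f"
      by (simp add: f(1) f'(1) scaleR_ae_fun.abs_eq plus_ae_fun.abs_eq)
    ultimately show ?thesis
      unfolding H10_def using fsq gsq by (intro CollectI exI[of _ ?f] exI[of _ ?g]) auto
  qed
  show "u + v \<in> H10 \<Omega>" if "u \<in> H10 \<Omega>" "v \<in> H10 \<Omega>" for u v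
    using lincomb[OF that, of 1 1] by simp
  show "c *\<^sub>R u \<in> H10 \<Omega>" if "u \<in> H10 \<Omega>" for c u
    using lincomb[OF that that, of c 0] by simp
qed

subsection \<open>Traces of functions in \<open>H10\<close>\<close>

text \<open>Cauchy-Schwarz, obtained by integrating the nonnegative function
  \<open>(d' t - c)^2\<close> with \<open>c\<close> the mean slope over
  \<open>{0..h}\<close>.\<close>

lemma square_increment_le:
  fixes d d' :: "real \<Rightarrow> real"
  assumes h: "0 < h" and d: "\<And>t. (d has_real_derivative d' t) (at t)" and cont: "continuous_on UNIV d'"
  shows "ennreal ((d h - d 0)\<^sup>2) \<le> ennreal h * (\<integral>\<^sup>+ t. ennreal ((d' t)\<^sup>2) * indicator {0..h} t \<partial>lborel)"
proof -
  have cont': "continuous_on {0..h} d'" using cont by (rule continuous_on_subset) simp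
  define c where "c = (d h - d 0) / h"
  have 1: "(d' has_integral (d h - d 0)) {0..h}"
    using h d by (intro fundamental_theorem_of_calculus)
      (auto simp flip: has_real_derivative_iff_has_vector_derivative intro: has_field_derivative_at_within)
  obtain I where I: "((\<lambda>t. (d' t)\<^sup>2) has_integral I) {0..h}"
    using integrable_continuous_interval[of 0 h "\<lambda>t. (d' t)\<^sup>2"] cont'
    by (auto intro!: continuous_intros simp: integrable_on_def)
  have "((\<lambda>t. (d' t)\<^sup>2 - 2 * c * d' t + c\<^sup>2) has_integral I - 2 * c * (d h - d 0) + h * c\<^sup>2) {0..h}"
    using has_integral_const_real[of "c\<^sup>2" 0 h] h
    by (intro has_integral_add has_integral_diff has_integral_mult_right I 1) simp_all
  then have "0 \<le> I - 2 * c * (d h - d 0) + h * c\<^sup>2"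
  proof (rule has_integral_nonneg)
    show "0 \<le> (d' t)\<^sup>2 - 2 * c * d' t + c\<^sup>2" for t
      using zero_le_power2[of "d' t - c"] by (simp add: power2_eq_square algebra_simps)
  qed
  moreover have hc: "h * c = d h - d 0" using h by (simp add: c_def)
  then have "h * c\<^sup>2 = c * (d h - d 0)" "(d h - d 0)\<^sup>2 = h * (c * (d h - d 0))"
    unfolding power2_eq_square by (metis mult.assoc mult.commute)+
  ultimately have le: "(d h - d 0)\<^sup>2 \<le> h * I"
    using h by (simp add: mult_left_mono)
  have "0 \<le> I" using I by (rule has_integral_nonneg) simp
  have "(\<integral>\<^sup>+ t. ennreal ((d' t)\<^sup>2) * indicator {0..h} t \<partial>lborel) = ennreal I"
    by (rule nn_integral_has_integral_lebesgue'[OF _ I]) simp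
  then show ?thesis using le h \<open>0 \<le> I\<close> by (simp flip: ennreal_mult)
qed

text \<open>The one-dimensional estimate holds on each line parallel to \<open>b\<close> and is
  integrated over \<open>p\<close>. After exchanging the integrals, every translate of the
  derivative contributes the same amount, which yields the second factor \<open>h\<close>.\<close>

lemma nn_integral_increment_le:
  assumes \<phi>: "\<And>p. \<phi> differentiable (at p)" "continuous_on UNIV (partial b \<phi>)" and h: "0 < h"
  shows "(\<integral>\<^sup>+ p. ennreal ((\<phi> (p + h *\<^sub>R b) - \<phi> p)\<^sup>2) \<partial>lborel) \<le>
    ennreal (h\<^sup>2) * (\<integral>\<^sup>+ p. ennreal ((partial b \<phi> p)\<^sup>2) \<partial>lborel)"
proof -
  note [measurable] = borel_measurable_continuous_onI[OF \<phi>(2)]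
  define F where "F t p = ennreal ((partial b \<phi> (p + t *\<^sub>R b))\<^sup>2) * indicator {0..h} t" for t p
  have meas: "(\<lambda>(t, p). F t p) \<in> borel_measurable (lborel \<Otimes>\<^sub>M lborel)"
    unfolding F_def by measurable
  have "(\<integral>\<^sup>+ p. ennreal ((\<phi> (p + h *\<^sub>R b) - \<phi> p)\<^sup>2) \<partial>lborel) \<le>
      (\<integral>\<^sup>+ p. ennreal h * (\<integral>\<^sup>+ t. F t p \<partial>lborel) \<partial>lborel)"
  proof (rule nn_integral_mono)
    fix p
    have "continuous_on UNIV (\<lambda>t. partial b \<phi> (p + t *\<^sub>R b))"
      by (intro continuous_on_compose2[OF \<phi>(2)] continuous_intros) auto
    from square_increment_le[OF h has_real_derivative_along[OF \<phi>(1)] this]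
    show "ennreal ((\<phi> (p + h *\<^sub>R b) - \<phi> p)\<^sup>2) \<le> ennreal h * (\<integral>\<^sup>+ t. F t p \<partial>lborel)"
      by (simp add: F_def)
  qed
  also have "\<dots> = ennreal h * (\<integral>\<^sup>+ p. (\<integral>\<^sup>+ t. F t p \<partial>lborel) \<partial>lborel)"
  proof (rule nn_integral_cmult)
    have "(\<lambda>(p, t). F t p) \<in> borel_measurable (lborel \<Otimes>\<^sub>M lborel)"
      unfolding F_def by measurable
    then show "(\<lambda>p. \<integral>\<^sup>+ t. F t p \<partial>lborel) \<in> borel_measurable lborel"
      by (rule lborel.borel_measurable_nn_integral)
  qed
  also have "(\<integral>\<^sup>+ p. (\<integral>\<^sup>+ t. F t p \<partial>lborel) \<partial>lborel) = (\<integral>\<^sup>+ t. (\<integral>\<^sup>+ p. F t p \<partial>lborel) \<partial>lborel)"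
    by (rule lborel_pair.Fubini'[OF meas])
  also have "\<dots> = (\<integral>\<^sup>+ t. (\<integral>\<^sup>+ p. ennreal ((partial b \<phi> p)\<^sup>2) \<partial>lborel) * indicator {0..h} (t :: real) \<partial>lborel)"
  proof (rule nn_integral_cong)
    fix t
    have "(\<integral>\<^sup>+ p. F t p \<partial>lborel) = (\<integral>\<^sup>+ p. ennreal ((partial b \<phi> (p + t *\<^sub>R b))\<^sup>2) \<partial>lborel) * indicator {0..h} t"
      unfolding F_def by (rule nn_integral_multc) measurable
    then show "(\<integral>\<^sup>+ p. F t p \<partial>lborel) = (\<integral>\<^sup>+ p. ennreal ((partial b \<phi> p)\<^sup>2) \<partial>lborel) * indicator {0..h} t"
      by (simp add: nn_integral_translate[of "\<lambda>p. ennreal ((partial b \<phi> p)\<^sup>2)"])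
  qed
  also have "\<dots> = (\<integral>\<^sup>+ p. ennreal ((partial b \<phi> p)\<^sup>2) \<partial>lborel) * ennreal h"
    using h by (subst nn_integral_cmult_indicator) auto
  finally show ?thesis using h by (simp add: power2_eq_square ennreal_mult ac_simps)
qed

text \<open>For each \<open>h\<close> a test function is chosen with squared error at most
  \<open>h^2\<close>; its own increments are controlled by its gradient. Splitting the increment of
  \<open>f\<close> into three terms costs a factor 3, and 3 + 3 + 3 (2 G + 2) is 12 + 6 G.\<close>

lemma H10_increment_bound:
  assumes "w \<in> H10 \<Omega>"
  obtains f C where "w = ae_class f" "f \<in> sq_integrable \<Omega>"
    "\<And>b h. b \<in> Basis \<Longrightarrow> 0 < h \<Longrightarrow>
       (\<integral>\<^sup>+ p. ennreal ((f (p + h *\<^sub>R b) - f p)\<^sup>2) \<partial>lborel) \<le> ennreal (C * h\<^sup>2)"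
proof -
  obtain f g where f: "w = ae_class f" "f \<in> sq_integrable \<Omega>"
    and g: "\<forall>b\<in>Basis. g b \<in> sq_integrable \<Omega> \<and> weak_partial \<Omega> b f (g b)"
    and approx: "\<forall>\<epsilon>>0. \<exists>\<phi>\<in>test_functions \<Omega>. (LINT p:\<Omega>|lborel. (f p - \<phi> p)\<^sup>2) +
        (\<Sum>b\<in>Basis. LINT p:\<Omega>|lborel. (g b p - partial b \<phi> p)\<^sup>2) < \<epsilon>"
    using H10_E[OF assms] .
  note fm [measurable] = sq_integrableD(1)[OF f(2)]
  define G where "G = (\<Sum>b\<in>Basis. LINT p|lborel. (g b p)\<^sup>2)"
  have nn_eq: "(\<integral>\<^sup>+ p. ennreal ((u p)\<^sup>2) \<partial>lborel) = ennreal (LINT p|lborel. (u p)\<^sup>2)"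
    if "u \<in> sq_integrable \<Omega>" for u
    by (rule nn_integral_eq_integral) (use sq_integrableD(3)[OF that] in auto)
  have "(\<integral>\<^sup>+ p. ennreal ((f (p + h *\<^sub>R b) - f p)\<^sup>2) \<partial>lborel) \<le> ennreal ((12 + 6 * G) * h\<^sup>2)"
    if b: "b \<in> Basis" and h: "0 < h" for b h
  proof -
    \<comment> \<open>The error of the function has to be of order \<open>h^2\<close>, that of the
      gradient only bounded.\<close>
    define \<epsilon> where "\<epsilon> = min 1 (h\<^sup>2)"
    have \<epsilon>: "0 < \<epsilon>" "\<epsilon> \<le> 1" "\<epsilon> \<le> h\<^sup>2" using h by (auto simp: \<epsilon>_def)
    from approx \<epsilon>(1) obtain \<phi> where \<phi>: "\<phi> \<in> test_functions \<Omega>" and small: "(LINT p:\<Omega>|lborel. (f p - \<phi> p)\<^sup>2) +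
        (\<Sum>b\<in>Basis. LINT p:\<Omega>|lborel. (g b p - partial b \<phi> p)\<^sup>2) < \<epsilon>" by blast
    have gb: "g b \<in> sq_integrable \<Omega>" using g b by blast
    note \<phi>sq = test_function_sq_integrable[OF \<phi>] partial_test_function_sq_integrable[OF \<phi> b]
    note [measurable] = sq_integrableD(1)[OF \<phi>sq(1)] sq_integrableD(1)[OF \<phi>sq(2)] sq_integrableD(1)[OF gb]
    have nonneg: "0 \<le> (LINT p:\<Omega>|lborel. (u p)\<^sup>2)" for u :: "plane \<Rightarrow> real"
      unfolding set_lebesgue_integral_def by (intro Bochner_Integration.integral_nonneg) simp
    define D where "D = (\<lambda>p. f p - \<phi> p)"
    define E where "E = (\<lambda>p. g b p - partial b \<phi> p)"
    have D: "D \<in> sq_integrable \<Omega>" and E: "E \<in> sq_integrable \<Omega>"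
      using sq_integrable_lincomb[OF f(2) \<phi>sq(1), of 1 "-1"] sq_integrable_lincomb[OF gb \<phi>sq(2), of 1 "-1"]
      by (simp_all add: D_def E_def)
    note [measurable] = sq_integrableD(1)[OF D] sq_integrableD(1)[OF E]
    have D_small: "(\<integral>\<^sup>+ p. ennreal ((D p)\<^sup>2) \<partial>lborel) \<le> ennreal (h\<^sup>2)"
    proof -
      have "(LINT p:\<Omega>|lborel. (f p - \<phi> p)\<^sup>2) \<le> \<epsilon>"
        using small sum_nonneg[of Basis "\<lambda>b. LINT p:\<Omega>|lborel. (g b p - partial b \<phi> p)\<^sup>2"] nonneg by force
      then have "(LINT p|lborel. (D p)\<^sup>2) \<le> h\<^sup>2"
        using \<epsilon> unfolding D_def integral_sq_eq[OF f(2) \<phi>sq(1)] by linarith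
      then show ?thesis unfolding nn_eq[OF D] by (rule ennreal_leI)
    qed
    have E_small: "(\<integral>\<^sup>+ p. ennreal ((E p)\<^sup>2) \<partial>lborel) \<le> ennreal 1"
    proof -
      have "(LINT p:\<Omega>|lborel. (g b p - partial b \<phi> p)\<^sup>2) \<le>
          (\<Sum>b\<in>Basis. LINT p:\<Omega>|lborel. (g b p - partial b \<phi> p)\<^sup>2)"
        using b nonneg by (intro member_le_sum) auto
      then have "(LINT p|lborel. (E p)\<^sup>2) \<le> 1"
        using small \<epsilon> nonneg[of "\<lambda>p. f p - \<phi> p"] unfolding E_def integral_sq_eq[OF gb \<phi>sq(2)] by linarith
      then show ?thesis unfolding nn_eq[OF E] by (rule ennreal_leI)
    qed
    have g_le: "(\<integral>\<^sup>+ p. ennreal ((g b p)\<^sup>2) \<partial>lborel) \<le> ennreal G"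
      unfolding nn_eq[OF gb] G_def using b by (intro ennreal_leI member_le_sum) auto
    have G: "0 \<le> G" unfolding G_def by (intro sum_nonneg) simp
    have partial_le: "(\<integral>\<^sup>+ p. ennreal ((partial b \<phi> p)\<^sup>2) \<partial>lborel) \<le> ennreal (2 * G + 2)"
    proof -
      have "(\<integral>\<^sup>+ p. ennreal ((partial b \<phi> p)\<^sup>2) \<partial>lborel) \<le>
          (\<integral>\<^sup>+ p. 2 * ennreal ((g b p)\<^sup>2) + 2 * ennreal ((E p)\<^sup>2) \<partial>lborel)"
      proof (rule nn_integral_mono)
        fix p
        have "(partial b \<phi> p)\<^sup>2 \<le> 2 * (g b p)\<^sup>2 + 2 * (E p)\<^sup>2"
          using zero_le_power2[of "g b p + E p"] unfolding E_def by (simp add: power2_eq_square algebra_simps)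
        then have "ennreal ((partial b \<phi> p)\<^sup>2) \<le> ennreal (2 * (g b p)\<^sup>2 + 2 * (E p)\<^sup>2)" by (rule ennreal_leI)
        then show "ennreal ((partial b \<phi> p)\<^sup>2) \<le> 2 * ennreal ((g b p)\<^sup>2) + 2 * ennreal ((E p)\<^sup>2)"
          by (simp add: ennreal_plus ennreal_mult)
      qed
      also have "\<dots> = 2 * (\<integral>\<^sup>+ p. ennreal ((g b p)\<^sup>2) \<partial>lborel) + 2 * (\<integral>\<^sup>+ p. ennreal ((E p)\<^sup>2) \<partial>lborel)"
        by (simp add: nn_integral_add nn_integral_cmult)
      also have "\<dots> \<le> 2 * ennreal G + 2 * ennreal 1"
        by (intro add_mono mult_left_mono g_le E_small) auto
      also have "\<dots> = ennreal (2 * G + 2)" using G by (simp add: ennreal_plus ennreal_mult)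
      finally show ?thesis .
    qed
    have \<phi>_le: "(\<integral>\<^sup>+ p. ennreal ((\<phi> (p + h *\<^sub>R b) - \<phi> p)\<^sup>2) \<partial>lborel) \<le> ennreal (h\<^sup>2) * ennreal (2 * G + 2)"
    proof (rule order_trans[OF nn_integral_increment_le[OF _ _ h]])
      show "\<phi> differentiable (at p)" for p using \<phi> by (auto elim: test_functionE)
      show "continuous_on UNIV (partial b \<phi>)" using \<phi> b by (auto elim: test_functionE)
    qed (intro mult_left_mono partial_le, simp)
    have "(\<integral>\<^sup>+ p. ennreal ((f (p + h *\<^sub>R b) - f p)\<^sup>2) \<partial>lborel) \<le>
        (\<integral>\<^sup>+ p. 3 * ennreal ((D (p + h *\<^sub>R b))\<^sup>2) + 3 * ennreal ((D p)\<^sup>2) +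
           3 * ennreal ((\<phi> (p + h *\<^sub>R b) - \<phi> p)\<^sup>2) \<partial>lborel)"
    proof (rule nn_integral_mono)
      fix p
      have sq: "(x + y - z)\<^sup>2 \<le> 3 * x\<^sup>2 + 3 * z\<^sup>2 + 3 * y\<^sup>2" for x y z :: real
        using zero_le_power2[of "x - y"] zero_le_power2[of "x + z"] zero_le_power2[of "y + z"]
        by (simp add: power2_eq_square algebra_simps)
      have "f (p + h *\<^sub>R b) - f p = D (p + h *\<^sub>R b) + (\<phi> (p + h *\<^sub>R b) - \<phi> p) - D p"
        by (simp add: D_def)
      then have "(f (p + h *\<^sub>R b) - f p)\<^sup>2 \<le> 3 * (D (p + h *\<^sub>R b))\<^sup>2 + 3 * (D p)\<^sup>2 + 3 * (\<phi> (p + h *\<^sub>R b) - \<phi> p)\<^sup>2"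
        using sq by simp
      then have "ennreal ((f (p + h *\<^sub>R b) - f p)\<^sup>2) \<le>
          ennreal (3 * (D (p + h *\<^sub>R b))\<^sup>2 + 3 * (D p)\<^sup>2 + 3 * (\<phi> (p + h *\<^sub>R b) - \<phi> p)\<^sup>2)"
        by (rule ennreal_leI)
      then show "ennreal ((f (p + h *\<^sub>R b) - f p)\<^sup>2) \<le> 3 * ennreal ((D (p + h *\<^sub>R b))\<^sup>2) + 3 * ennreal ((D p)\<^sup>2) +
           3 * ennreal ((\<phi> (p + h *\<^sub>R b) - \<phi> p)\<^sup>2)"
        by (simp add: ennreal_plus ennreal_mult)
    qed
    also have "\<dots> = 3 * (\<integral>\<^sup>+ p. ennreal ((D (p + h *\<^sub>R b))\<^sup>2) \<partial>lborel) + 3 * (\<integral>\<^sup>+ p. ennreal ((D p)\<^sup>2) \<partial>lborel) +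
        3 * (\<integral>\<^sup>+ p. ennreal ((\<phi> (p + h *\<^sub>R b) - \<phi> p)\<^sup>2) \<partial>lborel)"
      by (simp add: nn_integral_add nn_integral_cmult)
    also have "(\<integral>\<^sup>+ p. ennreal ((D (p + h *\<^sub>R b))\<^sup>2) \<partial>lborel) = (\<integral>\<^sup>+ p. ennreal ((D p)\<^sup>2) \<partial>lborel)"
      by (rule nn_integral_translate[of "\<lambda>p. ennreal ((D p)\<^sup>2)"]) measurable
    also have "3 * (\<integral>\<^sup>+ p. ennreal ((D p)\<^sup>2) \<partial>lborel) + 3 * (\<integral>\<^sup>+ p. ennreal ((D p)\<^sup>2) \<partial>lborel) +
        3 * (\<integral>\<^sup>+ p. ennreal ((\<phi> (p + h *\<^sub>R b) - \<phi> p)\<^sup>2) \<partial>lborel) \<le>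
      3 * ennreal (h\<^sup>2) + 3 * ennreal (h\<^sup>2) + 3 * (ennreal (h\<^sup>2) * ennreal (2 * G + 2))"
      by (intro add_mono mult_left_mono D_small \<phi>_le) auto
    also have "\<dots> = ennreal (3 * h\<^sup>2 + 3 * h\<^sup>2 + 3 * (h\<^sup>2 * (2 * G + 2)))"
    proof -
      have e3: "3 * ennreal x = ennreal (3 * x)" if "0 \<le> x" for x
        using that by (simp add: ennreal_mult)
      have add3: "ennreal x + ennreal y + ennreal z = ennreal (x + y + z)" if "0 \<le> x" "0 \<le> y" "0 \<le> z" for x y z
        using that by simp
      have "ennreal (h\<^sup>2) * ennreal (2 * G + 2) = ennreal (h\<^sup>2 * (2 * G + 2))"
        using G by (intro ennreal_mult[symmetric]) auto
      moreover have "0 \<le> h\<^sup>2 * (2 * G + 2)" using G by simp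
      ultimately show ?thesis by (simp only: e3 zero_le_power2) (intro add3; simp)
    qed
    also have "3 * h\<^sup>2 + 3 * h\<^sup>2 + 3 * (h\<^sup>2 * (2 * G + 2)) = (12 + 6 * G) * h\<^sup>2" by algebra
    finally show ?thesis .
  qed
  then show ?thesis using that f by blast
qed

text \<open>The strip lies on the lower side of the line through \<open>z\<close> perpendicular to
  \<open>b\<close>, and shifting by \<open>h\<close> along \<open>b\<close> carries all of it across
  that line. Its measure is of first order in \<open>h\<close>, whereas the increments of an
  \<open>H10\<close> function leave room only for second order.\<close>

lemma strip_exists:
  fixes z b :: plane
  assumes "b \<in> Basis" "0 < h" "h \<le> \<eta>"
  obtains A where "A \<in> sets borel" "emeasure lborel A = ennreal (2 * \<eta> * h)"
    "\<And>p. p \<in> A \<Longrightarrow> dist z p < 3 * \<eta> \<and> z \<bullet> b - h < p \<bullet> b \<and> p \<bullet> b < z \<bullet> b"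
proof -
  obtain x y where z: "z = (x, y)" by (cases z)
  have dist: "dist z (s, t) < 3 * \<eta>" if "\<bar>x - s\<bar> < \<eta>" "\<bar>y - t\<bar> < \<eta>" for s t
  proof -
    have "dist z (s, t) \<le> \<bar>x - s\<bar> + \<bar>y - t\<bar>"
      using norm_Pair_le[of "x - s" "y - t"] by (simp add: z dist_norm)
    then show ?thesis using that assms by linarith
  qed
  consider "b = (1, 0)" | "b = (0, 1)" using assms by (auto simp: plane_Basis)
  then show ?thesis
  proof cases
    case 1
    have em: "emeasure lborel (box (x - h, y - \<eta>) (x, y + \<eta>)) = ennreal (2 * \<eta> * h)"
      using assms by (subst emeasure_lborel_box) (auto simp: plane_Basis ac_simps)
    have pr: "dist z p < 3 * \<eta> \<and> z \<bullet> b - h < p \<bullet> b \<and> p \<bullet> b < z \<bullet> b" if "p \<in> box (x - h, y - \<eta>) (x, y + \<eta>)" for p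
    proof -
      obtain s t where p: "p = (s, t)" by (cases p)
      show ?thesis using that assms dist[of s t] unfolding p box_Pair by (auto simp: z 1)
    qed
    show ?thesis by (rule that[OF _ em pr]) simp_all
  next
    case 2
    have em: "emeasure lborel (box (x - \<eta>, y - h) (x + \<eta>, y)) = ennreal (2 * \<eta> * h)"
      using assms by (subst emeasure_lborel_box) (auto simp: plane_Basis ac_simps)
    have pr: "dist z p < 3 * \<eta> \<and> z \<bullet> b - h < p \<bullet> b \<and> p \<bullet> b < z \<bullet> b" if "p \<in> box (x - \<eta>, y - h) (x + \<eta>, y)" for p
    proof -
      obtain s t where p: "p = (s, t)" by (cases p)
      show ?thesis using that assms dist[of s t] unfolding p box_Pair by (auto simp: z 2)
    qed
    show ?thesis by (rule that[OF _ em pr]) simp_all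
  qed
qed

text \<open>A jump of size \<open>4 * \<delta>\<close> would make the squared increments integrate to at least \<open>8 * \<delta>\<^sup>2 * \<eta> * h\<close>,
  which is not \<open>O(h\<^sup>2)\<close>.\<close>

lemma traces_agree:
  fixes z b :: plane
  assumes f: "f \<in> borel_measurable borel" and b: "b \<in> Basis"
    and bound: "\<And>h. 0 < h \<Longrightarrow> (\<integral>\<^sup>+ p. ennreal ((f (p + h *\<^sub>R b) - f p)\<^sup>2) \<partial>lborel) \<le> ennreal (C * h\<^sup>2)"
    and r: "0 < r"
    and right: "AE p in lborel. p \<in> ball z r \<and> z \<bullet> b < p \<bullet> b \<longrightarrow> f p = q p"
    and left: "AE p in lborel. p \<in> ball z r \<and> p \<bullet> b < z \<bullet> b \<longrightarrow> f p = q' p"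
    and cont: "isCont q z" "isCont q' z"
  shows "q z = q' z"
proof (rule ccontr)
  assume "q z \<noteq> q' z"
  define \<delta> where "\<delta> = \<bar>q z - q' z\<bar> / 4"
  have \<delta>: "0 < \<delta>" using \<open>q z \<noteq> q' z\<close> by (simp add: \<delta>_def)
  obtain r1 where r1: "0 < r1" "\<And>p. dist z p < r1 \<Longrightarrow> \<bar>q p - q z\<bar> < \<delta>"
    using cont(1) \<delta> unfolding continuous_at_eps_delta dist_real_def dist_commute[of _ z] by blast
  obtain r2 where r2: "0 < r2" "\<And>p. dist z p < r2 \<Longrightarrow> \<bar>q' p - q' z\<bar> < \<delta>"
    using cont(2) \<delta> unfolding continuous_at_eps_delta dist_real_def dist_commute[of _ z] by blast
  \<comment> \<open>Points of the strip are within \<open>3 * \<eta>\<close> of \<open>z\<close> and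
    their shifts within \<open>4 * \<eta>\<close>, so both stay where \<open>q\<close> and
    \<open>q'\<close> are close to their values at \<open>z\<close>.\<close>
  define \<eta> where "\<eta> = min r (min r1 r2) / 4"
  have \<eta>: "0 < \<eta>" "4 * \<eta> \<le> r" "4 * \<eta> \<le> r1" "4 * \<eta> \<le> r2" using r r1 r2 by (auto simp: \<eta>_def)
  \<comment> \<open>Small enough that the upper bound \<open>C * h^2\<close> is at most
    \<open>\<delta>^2 * \<eta> * h\<close>, one eighth of the lower bound.\<close>
  define h where "h = min \<eta> (\<delta>\<^sup>2 * \<eta> / (\<bar>C\<bar> + 1))"
  have h: "0 < h" "h \<le> \<eta>" using \<eta> \<delta> by (auto simp: h_def)
  have Ch: "\<bar>C\<bar> * h \<le> \<delta>\<^sup>2 * \<eta>"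
  proof -
    have "\<bar>C\<bar> * h \<le> (\<bar>C\<bar> + 1) * h" using h by simp
    also have "\<dots> \<le> (\<bar>C\<bar> + 1) * (\<delta>\<^sup>2 * \<eta> / (\<bar>C\<bar> + 1))" by (intro mult_left_mono) (auto simp: h_def)
    also have "\<dots> = \<delta>\<^sup>2 * \<eta>" by simp
    finally show ?thesis .
  qed
  obtain A where A: "A \<in> sets borel" "emeasure lborel A = ennreal (2 * \<eta> * h)"
    "\<And>p. p \<in> A \<Longrightarrow> dist z p < 3 * \<eta> \<and> z \<bullet> b - h < p \<bullet> b \<and> p \<bullet> b < z \<bullet> b"
    using strip_exists[OF b h] by blast
  \<comment> \<open>On the strip \<open>f\<close> is given by \<open>q'\<close>, at the shifted
    points by \<open>q\<close>. Each is within \<open>\<delta>\<close> of its value at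
    \<open>z\<close>, so at least \<open>2 * \<delta>\<close> of the jump
    \<open>4 * \<delta>\<close> remains.\<close>
  have "AE p in lborel. ennreal (4 * \<delta>\<^sup>2) * indicator A p \<le> ennreal ((f (p + h *\<^sub>R b) - f p)\<^sup>2)"
    using left AE_translate[OF right, of "h *\<^sub>R b"]
  proof eventually_elim
    case (elim p)
    show ?case
    proof (cases "p \<in> A")
      case True
      have p: "dist z p < 3 * \<eta>" "z \<bullet> b - h < p \<bullet> b" "p \<bullet> b < z \<bullet> b" using A(3)[OF True] by auto
      have "dist p (p + h *\<^sub>R b) = h" using h b by (simp add: dist_norm)
      then have p': "dist z (p + h *\<^sub>R b) < 4 * \<eta>"
        using dist_triangle[of z "p + h *\<^sub>R b" p] p h by linarith
      have "(p + h *\<^sub>R b) \<bullet> b = p \<bullet> b + h" using b by (simp add: inner_add_left)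
      then have "f p = q' p" "f (p + h *\<^sub>R b) = q (p + h *\<^sub>R b)"
        using elim p p' \<eta> by (auto simp: dist_commute)
      moreover have "\<bar>q (p + h *\<^sub>R b) - q z\<bar> < \<delta>" "\<bar>q' p - q' z\<bar> < \<delta>"
        using r1(2) r2(2) p p' \<eta> by simp_all
      moreover have "\<bar>q z - q' z\<bar> = 4 * \<delta>" by (simp add: \<delta>_def)
      moreover have "2 * d \<le> \<bar>x - y\<bar>" if "\<bar>x - x'\<bar> < d" "\<bar>y - y'\<bar> < d" "\<bar>x' - y'\<bar> = 4 * d" for x y x' y' d :: real
        using that by linarith
      ultimately have "2 * \<delta> \<le> \<bar>f (p + h *\<^sub>R b) - f p\<bar>" by metis
      then have "(2 * \<delta>)\<^sup>2 \<le> \<bar>f (p + h *\<^sub>R b) - f p\<bar>\<^sup>2" using \<delta> by (intro power_mono) auto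
      then show ?thesis using True by (simp add: power_mult_distrib ennreal_leI)
    qed simp
  qed
  then have "(\<integral>\<^sup>+ p. ennreal (4 * \<delta>\<^sup>2) * indicator A p \<partial>lborel) \<le>
      (\<integral>\<^sup>+ p. ennreal ((f (p + h *\<^sub>R b) - f p)\<^sup>2) \<partial>lborel)"
    by (rule nn_integral_mono_AE)
  also have "\<dots> \<le> ennreal (C * h\<^sup>2)" using h by (intro bound)
  also have "(\<integral>\<^sup>+ p. ennreal (4 * \<delta>\<^sup>2) * indicator A p \<partial>lborel) = ennreal (4 * \<delta>\<^sup>2) * ennreal (2 * \<eta> * h)"
    using A by (simp add: nn_integral_cmult_indicator)
  also have "\<dots> = ennreal (4 * \<delta>\<^sup>2 * (2 * \<eta> * h))" using \<eta> h by (simp flip: ennreal_mult)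
  finally have "4 * \<delta>\<^sup>2 * (2 * \<eta> * h) \<le> C * h\<^sup>2"
    using \<delta> \<eta> h by (subst (asm) ennreal_le_iff2) (auto simp: mult_le_0_iff zero_less_mult_iff)
  also have "\<dots> \<le> \<bar>C\<bar> * h * h" using h by (simp add: power2_eq_square mult_right_mono)
  also have "\<dots> \<le> \<delta>\<^sup>2 * \<eta> * h" using Ch h by (intro mult_right_mono) auto
  finally have "7 * (\<delta>\<^sup>2 * \<eta> * h) \<le> 0" by (simp add: ac_simps)
  moreover have "0 < \<delta>\<^sup>2 * \<eta> * h" using \<delta> \<eta> h by simp
  ultimately show False by linarith
qed

subsection \<open>Classes of functions\<close>

lemma agrees_on_ae_class: "agrees_on (ae_class f) K q \<longleftrightarrow> (AE p in lborel. p \<in> K \<longrightarrow> f p = q p)"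
  by (simp add: agrees_on.abs_eq)

lemma ae_class_eq_iff: "ae_class f = ae_class g \<longleftrightarrow> (AE p in lborel. f p = g p)"
  by (rule ae_fun.abs_eq_iff)

lemma agrees_on_lincomb:
  "agrees_on u K q \<Longrightarrow> agrees_on v K r \<Longrightarrow> agrees_on (x *\<^sub>R u + y *\<^sub>R v) K (\<lambda>p. x * q p + y * r p)"
  by transfer (auto elim: eventually_elim2)

lemma ae_class_lincomb: "ae_class (\<lambda>p. x * f p + y * g p) = x *\<^sub>R ae_class f + y *\<^sub>R ae_class g"
  by (simp add: scaleR_ae_fun.abs_eq plus_ae_fun.abs_eq)

lemma ae_class_sum: "ae_class (\<lambda>p. \<Sum>K\<in>A. c K * f K p) = (\<Sum>K\<in>A. c K *\<^sub>R ae_class (f K))"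
proof (induction A rule: infinite_finite_induct)
  case (insert K A)
  then show ?case
    using ae_class_lincomb[of "c K" "f K" 1 "\<lambda>p. \<Sum>K\<in>A. c K * f K p"] by simp
qed (simp_all add: zero_ae_fun_def)

section \<open>Subspaces, spans and almost-everywhere equality\<close>

lemma subspace_by_lincomb:
  fixes V :: "'a :: real_vector set"
  assumes "V \<noteq> {}" "\<And>x y u v. u \<in> V \<Longrightarrow> v \<in> V \<Longrightarrow> x *\<^sub>R u + y *\<^sub>R v \<in> V"
  shows "subspace V"
proof (rule subspaceI)
  obtain u where "u \<in> V" using assms(1) by blast
  then show "0 \<in> V" using assms(2)[of u u 0 0] by simp
  show "u + v \<in> V" if "u \<in> V" "v \<in> V" for u v using assms(2)[OF that, of 1 1] by simp
  show "c *\<^sub>R u \<in> V" if "u \<in> V" for c u using assms(2)[OF that that, of c 0] by simp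
qed

text \<open>Coefficients are attached to the indices and not to the vectors, so that they can be
  chosen and compared cell by cell.\<close>

lemma span_image_eq:
  fixes c :: "'a \<Rightarrow> 'b :: real_vector"
  assumes "finite A"
  shows "span (c ` A) = range (\<lambda>g. \<Sum>K\<in>A. g K *\<^sub>R c K)"
proof
  have "c K \<in> range (\<lambda>g. \<Sum>K\<in>A. g K *\<^sub>R c K)" if "K \<in> A" for K
  proof
    show "c K = (\<Sum>L\<in>A. (if L = K then 1 else 0) *\<^sub>R c L)"
      using assms that by (simp add: if_distrib[of "\<lambda>z. z *\<^sub>R _"] cong: if_cong)
  qed simp
  moreover have "subspace (range (\<lambda>g. \<Sum>K\<in>A. g K *\<^sub>R c K))"
  proof (rule subspace_by_lincomb)
    fix x y u v assume "u \<in> range (\<lambda>g. \<Sum>K\<in>A. g K *\<^sub>R c K)" "v \<in> range (\<lambda>g. \<Sum>K\<in>A. g K *\<^sub>R c K)"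
    then obtain g h where "u = (\<Sum>K\<in>A. g K *\<^sub>R c K)" "v = (\<Sum>K\<in>A. h K *\<^sub>R c K)" by blast
    then have "x *\<^sub>R u + y *\<^sub>R v = (\<Sum>K\<in>A. (x * g K + y * h K) *\<^sub>R c K)"
      by (simp add: scaleR_right.sum scaleR_add_left sum.distrib)
    then show "x *\<^sub>R u + y *\<^sub>R v \<in> range (\<lambda>g. \<Sum>K\<in>A. g K *\<^sub>R c K)"
      by (intro image_eqI[where x = "\<lambda>K. x * g K + y * h K"]) simp_all
  qed simp
  ultimately show "span (c ` A) \<subseteq> range (\<lambda>g. \<Sum>K\<in>A. g K *\<^sub>R c K)"
    by (intro span_minimal) auto
  show "range (\<lambda>g. \<Sum>K\<in>A. g K *\<^sub>R c K) \<subseteq> span (c ` A)"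
    by (auto intro: span_sum span_scale span_base)
qed

text \<open>The set where two continuous functions differ is open, and a nonempty open set is not
  null.\<close>

lemma AE_eq_on_open:
  fixes f g :: "plane \<Rightarrow> real"
  assumes U: "open U" and cont: "continuous_on U f" "continuous_on U g"
    and AE: "AE p in lborel. p \<in> U \<longrightarrow> f p = g p" and p: "p \<in> U"
  shows "f p = g p"
proof (rule ccontr)
  assume ne: "f p \<noteq> g p"
  define S where "S = {p \<in> U. f p - g p \<noteq> 0}"
  have "open S"
    using continuous_open_preimage[OF continuous_on_diff[OF cont] U, of "- {0}"]
    by (simp add: S_def vimage_def Int_def open_Compl)
  have "AE p in lborel. p \<notin> S" using AE by eventually_elim (auto simp: S_def)
  then have "S \<in> null_sets lborel"
    using \<open>open S\<close> by (simp add: AE_iff_null_sets)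
  then have "negligible S"
    unfolding negligible_iff_null_sets by (rule null_sets_completionI)
  moreover have "p \<in> S" using p ne by (simp add: S_def)
  ultimately show False using open_not_negligible[OF \<open>open S\<close>] by blast
qed

lemma theta_prod: "\<theta>1 * \<theta>2 = 1 / 6"
proof -
  have "\<theta>1 * \<theta>2 = 1 / 4 * (1 - (1 / sqrt 3)\<^sup>2)"
    by (simp add: \<theta>1_def \<theta>2_def power2_eq_square algebra_simps)
  then show ?thesis by (simp add: power_divide)
qed

subsection \<open>Quadratic coefficients\<close>

text \<open>Half a second difference at the origin. On \<open>P 2\<close> it is the coefficient of
  \<open>s^2\<close>; in this form it is linear in \<open>q\<close> and involves no choice of a
  representation.\<close>

definition coeff_xx :: "(plane \<Rightarrow> real) \<Rightarrow> real" where
  "coeff_xx q = (q (1, 0) + q (-1, 0) - 2 * q (0, 0)) / 2"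

definition coeff_yy :: "(plane \<Rightarrow> real) \<Rightarrow> real" where
  "coeff_yy q = (q (0, 1) + q (0, -1) - 2 * q (0, 0)) / 2"

lemma P_2_E:
  assumes "q \<in> P 2"
  obtains a b c d where "\<And>s t. q (s, t) = a + b * s + c * t + d * (s * t) + coeff_xx q * s\<^sup>2 + coeff_yy q * t\<^sup>2"
proof -
  from assms obtain a b c d e f where
    *: "\<forall>s t. q (s, t) = a + b * s + c * t + d * (s * t) + e * s\<^sup>2 + f * t\<^sup>2"
    unfolding P_2_iff by blast
  then have "coeff_xx q = e" "coeff_yy q = f" by (simp_all add: coeff_xx_def coeff_yy_def)
  then show ?thesis using * that by blast
qed

text \<open>A multiple \<open>C\<close> of the Legendre polynomial has the value
  \<open>C / 6\<close> at both ends, and a second difference along the edge identifies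
  \<open>C\<close> as the second-order coefficient times the squared length.\<close>

lemma vertical_edge_ends:
  assumes J: "J \<in> P 2" and L: "legendre_multiple (x, y0) (x, y1) J"
  shows "J (x, y0) = coeff_yy J * (y1 - y0)\<^sup>2 / 6" "J (x, y1) = coeff_yy J * (y1 - y0)\<^sup>2 / 6"
proof -
  obtain a b c d where J: "\<And>s t. J (s, t) = a + b * s + c * t + d * (s * t) + coeff_xx J * s\<^sup>2 + coeff_yy J * t\<^sup>2"
    using P_2_E[OF J] by blast
  obtain C where C: "\<And>\<tau>. J (linepath (x, y0) (x, y1) \<tau>) = C * (\<tau>\<^sup>2 - \<tau> + 1 / 6)"
    using L by (auto simp: legendre_multiple_def)
  have lp: "linepath (x, y0) (x, y1) \<tau> = (x, y0 + \<tau> * (y1 - y0))" for \<tau>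
    by (simp add: linepath_def algebra_simps)
  \<comment> \<open>The parameter -1 continues the edge by its own length, which gives three
    equidistant points for the second difference.\<close>
  have ends: "J (x, y0) = C / 6" "J (x, y1) = C / 6" "J (x, y0 - (y1 - y0)) = C * (2 + 1 / 6)"
    using C[of 0] C[of 1] C[of "-1"] unfolding lp by simp_all
  have "J (x, y1) + J (x, y0 - (y1 - y0)) - 2 * J (x, y0) = 2 * coeff_yy J * (y1 - y0)\<^sup>2"
    unfolding J by algebra
  then have "C = coeff_yy J * (y1 - y0)\<^sup>2" unfolding ends by (simp add: field_simps)
  then show "J (x, y0) = coeff_yy J * (y1 - y0)\<^sup>2 / 6" "J (x, y1) = coeff_yy J * (y1 - y0)\<^sup>2 / 6"
    by (simp_all add: ends)
qed

lemma horizontal_edge_ends: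
  assumes J: "J \<in> P 2" and L: "legendre_multiple (x0, y) (x1, y) J"
  shows "J (x0, y) = coeff_xx J * (x1 - x0)\<^sup>2 / 6" "J (x1, y) = coeff_xx J * (x1 - x0)\<^sup>2 / 6"
proof -
  obtain a b c d where J: "\<And>s t. J (s, t) = a + b * s + c * t + d * (s * t) + coeff_xx J * s\<^sup>2 + coeff_yy J * t\<^sup>2"
    using P_2_E[OF J] by blast
  obtain C where C: "\<And>\<tau>. J (linepath (x0, y) (x1, y) \<tau>) = C * (\<tau>\<^sup>2 - \<tau> + 1 / 6)"
    using L by (auto simp: legendre_multiple_def)
  have lp: "linepath (x0, y) (x1, y) \<tau> = (x0 + \<tau> * (x1 - x0), y)" for \<tau>
    by (simp add: linepath_def algebra_simps)
  have ends: "J (x0, y) = C / 6" "J (x1, y) = C / 6" "J (x0 - (x1 - x0), y) = C * (2 + 1 / 6)"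
    using C[of 0] C[of 1] C[of "-1"] unfolding lp by simp_all
  have "J (x1, y) + J (x0 - (x1 - x0), y) - 2 * J (x0, y) = 2 * coeff_xx J * (x1 - x0)\<^sup>2"
    unfolding J by algebra
  then have "C = coeff_xx J * (x1 - x0)\<^sup>2" unfolding ends by (simp add: field_simps)
  then show "J (x0, y) = coeff_xx J * (x1 - x0)\<^sup>2 / 6" "J (x1, y) = coeff_xx J * (x1 - x0)\<^sup>2 / 6"
    by (simp_all add: ends)
qed

text \<open>A quadratic with three zeros vanishes. The assumption speaks of interior points only,
  because traces are compared away from the vertices, where more than two cells meet.\<close>

lemma legendre_multiple_of_zero:
  assumes J: "J \<in> P 2" and zero: "\<And>\<tau>. 0 < \<tau> \<Longrightarrow> \<tau> < 1 \<Longrightarrow> J (linepath p p' \<tau>) = 0"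
  shows "legendre_multiple p p' J"
proof -
  obtain u0 u1 u2 where JL: "\<And>\<tau>. J (linepath p p' \<tau>) = u0 + u1 * \<tau> + u2 * \<tau>\<^sup>2"
    using P_2_linepath[OF J, of p p'] by blast
  have "u0 = 0 \<and> u1 = 0 \<and> u2 = 0"
    using zero[of "1 / 4"] zero[of "1 / 2"] zero[of "3 / 4"] unfolding JL by (simp add: power2_eq_square)
  then have "\<forall>\<tau>. J (linepath p p' \<tau>) = 0 * (\<tau>\<^sup>2 - \<tau> + 1 / 6)" unfolding JL by simp
  then show ?thesis unfolding legendre_multiple_def by blast
qed

text \<open>Linear interpolation in \<open>t\<close> on the two vertical sides, then in
  \<open>s\<close> between them. The nested form is the one in which sums of tensor hats are
  evaluated on a cell.\<close>

lemma bilinear_interpolation: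
  fixes x0 x1 y0 y1 :: real
  assumes B: "\<And>s t. B (s, t) = a + b * s + c * t + d * (s * t)" and ne: "x0 < x1" "y0 < y1"
  shows "B (s, t) =
    (B (x0, y0) * ((y1 - t) / (y1 - y0)) + B (x0, y1) * ((t - y0) / (y1 - y0))) * ((x1 - s) / (x1 - x0)) +
    (B (x1, y0) * ((y1 - t) / (y1 - y0)) + B (x1, y1) * ((t - y0) / (y1 - y0))) * ((s - x0) / (x1 - x0))"
proof -
  have lin: "(u + v * z0) * ((z1 - z) / (z1 - z0)) + (u + v * z1) * ((z - z0) / (z1 - z0)) = u + v * z"
    if "z0 < z1" for u v z z0 z1 :: real
    using that by (simp add: divide_simps) (simp add: algebra_simps)
  have inner: "B (x, y0) * ((y1 - t) / (y1 - y0)) + B (x, y1) * ((t - y0) / (y1 - y0)) = (a + c * t) + (b + d * t) * x" for x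
    using lin[OF ne(2), of "a + b * x" "c + d * x" t] unfolding B by (simp add: algebra_simps)
  show ?thesis
    unfolding inner lin[OF ne(1)] by (simp add: B algebra_simps)
qed

subsection \<open>Sums of hat functions\<close>

lemma grid_interval_exists:
  fixes X :: "nat \<Rightarrow> real"
  assumes "X 0 < s" "s < X m" "\<And>i. i \<le> m \<Longrightarrow> s \<noteq> X i"
  obtains i where "i < m" "X i < s" "s < X (Suc i)"
proof -
  have "\<exists>i<m. X i < s \<and> s < X (Suc i)"
    using assms
  proof (induction m)
    case (Suc m)
    show ?case
    proof (cases "s < X m")
      case True
      then obtain i where "i < m" "X i < s" "s < X (Suc i)" using Suc by force
      then show ?thesis using less_SucI by blast
    next
      case False
      moreover have "s \<noteq> X m" using Suc.prems(3)[of m] by simp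
      ultimately have "X m < s" by simp
      then show ?thesis using Suc.prems(2) by blast
    qed
  qed simp
  then show ?thesis using that by blast
qed

text \<open>On one grid interval only the hats at its two ends are nonzero. The sum runs over
  interior nodes, and the zeros of \<open>u\<close> at \<open>0\<close> and \<open>m\<close> account
  for the missing hats in the first and last interval.\<close>

lemma hat_sum_eq:
  fixes X :: "nat \<Rightarrow> real"
  assumes X: "strict_mono_on {..m} X" and i: "i < m" "X i < s" "s < X (Suc i)" and u: "u 0 = 0" "u m = 0"
  shows "(\<Sum>a\<in>{0<..<m}. u a * hat (X (a - 1)) (X a) (X (Suc a)) s) =
    u i * ((X (Suc i) - s) / (X (Suc i) - X i)) + u (Suc i) * ((s - X i) / (X (Suc i) - X i))"
proof -
  have le: "X a \<le> X b" if "a \<le> b" "b \<le> m" for a b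
    using strict_mono_onD[OF X, of a b] that by (cases "a = b") auto
  have "hat (X (a - 1)) (X a) (X (Suc a)) s = (if a = i then (X (Suc i) - s) / (X (Suc i) - X i) else 0) +
      (if a = Suc i then (s - X i) / (X (Suc i) - X i) else 0)" if a: "a \<in> {0<..<m}" for a
  proof -
    have lt: "X (a - 1) < X a" "X a < X (Suc a)"
      using a by (auto intro!: strict_mono_onD[OF X])
    consider "a = i" | "a = Suc i" | "a < i" | "Suc i < a" by linarith
    then show ?thesis
    proof cases
      case 1
      then show ?thesis using hat_simps(3)[OF lt, of s] i by simp
    next
      case 2
      then show ?thesis using hat_simps(2)[OF lt, of s] i by simp
    next
      case 3
      then have "X (Suc a) \<le> s" using le[of "Suc a" i] i by linarith
      then show ?thesis using hat_simps(4)[OF lt, of s] 3 by simp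
    next
      case 4
      then have "s \<le> X (a - 1)" using le[of "Suc i" "a - 1"] i a by fastforce
      then show ?thesis using hat_simps(1)[OF lt, of s] 4 by simp
    qed
  qed
  then have "(\<Sum>a\<in>{0<..<m}. u a * hat (X (a - 1)) (X a) (X (Suc a)) s) =
      (\<Sum>a\<in>{0<..<m}. (if a = i then u i * ((X (Suc i) - s) / (X (Suc i) - X i)) else 0) +
        (if a = Suc i then u (Suc i) * ((s - X i) / (X (Suc i) - X i)) else 0))"
    by (intro sum.cong) auto
  also have "\<dots> = (if i \<in> {0<..<m} then u i * ((X (Suc i) - s) / (X (Suc i) - X i)) else 0) +
      (if Suc i \<in> {0<..<m} then u (Suc i) * ((s - X i) / (X (Suc i) - X i)) else 0)"
    by (simp add: sum.distrib)
  also have "\<dots> = u i * ((X (Suc i) - s) / (X (Suc i) - X i)) + u (Suc i) * ((s - X i) / (X (Suc i) - X i))"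
  proof -
    have "u i = 0" if "i \<notin> {0<..<m}"
    proof -
      have "i = 0" using that i by simp
      then show ?thesis using u by simp
    qed
    moreover have "u (Suc i) = 0" if "Suc i \<notin> {0<..<m}"
    proof -
      have "Suc i = m" using that i by simp
      then show ?thesis using u by metis
    qed
    ultimately show ?thesis by (auto simp del: greaterThanLessThan_iff)
  qed
  finally show ?thesis .
qed

subsection \<open>The decomposition on a grid\<close>

locale grid =
  fixes \<Omega> :: "plane set" and m n :: nat and X Y :: "nat \<Rightarrow> real"
  assumes subdivision: "rectangular_subdivision \<Omega> m n X Y"
begin

lemma \<Omega>_eq: "\<Omega> = box (X 0, Y 0) (X m, Y n)"
  using subdivision by (simp add: rectangular_subdivision_def)

lemma X_mono: "strict_mono_on {..m} X" and Y_mono: "strict_mono_on {..n} Y"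
  using subdivision by (simp_all add: rectangular_subdivision_def)

lemma X_less: "i < j \<Longrightarrow> j \<le> m \<Longrightarrow> X i < X j"
  by (rule strict_mono_onD[OF X_mono]) auto

lemma Y_less: "i < j \<Longrightarrow> j \<le> n \<Longrightarrow> Y i < Y j"
  by (rule strict_mono_onD[OF Y_mono]) auto

lemma X_le: "i \<le> j \<Longrightarrow> j \<le> m \<Longrightarrow> X i \<le> X j"
  using X_less[of i j] by (cases "i = j") auto

lemma Y_le: "i \<le> j \<Longrightarrow> j \<le> n \<Longrightarrow> Y i \<le> Y j"
  using Y_less[of i j] by (cases "i = j") auto

lemma \<Omega>_borel: "\<Omega> \<in> sets borel" and \<Omega>_bounded: "bounded \<Omega>"
  by (simp_all add: \<Omega>_eq)

lemma finite_cells: "finite (cells m n)"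
  by (simp add: cells_def)

text \<open>The open rectangle with shifted index \<open>(a, b)\<close>. A bound is present only
  where its grid line exists, so index 0 and the indices \<open>Suc m\<close> and
  \<open>Suc n\<close> give the unbounded pieces around the rectangle.\<close>

definition region :: "nat \<Rightarrow> nat \<Rightarrow> plane set" where
  "region a b = {p. (0 < a \<longrightarrow> X (a - 1) < fst p) \<and> (a \<le> m \<longrightarrow> fst p < X a) \<and>
     (0 < b \<longrightarrow> Y (b - 1) < snd p) \<and> (b \<le> n \<longrightarrow> snd p < Y b)}"

text \<open>Elements of \<open>sq_integrable\<close> vanish off the rectangle, so there the zero
  function of \<open>shifted\<close> is the right one. The boundary condition thereby becomes the
  absence of a jump.\<close>

lemma region_shifted:
  assumes f: "f \<in> sq_integrable \<Omega>" and q: "\<forall>K\<in>cells m n. agrees_on (ae_class f) (cell X Y K) (q K)"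
    and ab: "a \<le> Suc m" "b \<le> Suc n"
  shows "AE p in lborel. p \<in> region a b \<longrightarrow> f p = shifted m n q a b p"
proof (cases "0 < a \<and> a \<le> m \<and> 0 < b \<and> b \<le> n")
  case True
  then have "(a - 1, b - 1) \<in> cells m n" by (auto simp: cells_def)
  then have "AE p in lborel. p \<in> cell X Y (a - 1, b - 1) \<longrightarrow> f p = q (a - 1, b - 1) p"
    using q agrees_on_ae_class by blast
  then show ?thesis
  proof eventually_elim
    case (elim p)
    have "p \<in> cell X Y (a - 1, b - 1)" if "p \<in> region a b"
      using that True by (cases p) (auto simp: region_def cbox_Pair)
    then show ?case using elim True by (simp add: shifted_def)
  qed
next
  case False
  have "p \<notin> \<Omega>" if "p \<in> region a b" for p
  proof -
    have "a = 0 \<or> a = Suc m \<or> b = 0 \<or> b = Suc n" using False ab by linarith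
    then show ?thesis using that by (cases p) (auto simp: region_def \<Omega>_eq box_Pair)
  qed
  then have "f p = shifted m n q a b p" if "p \<in> region a b" for p
    using sq_integrableD(2)[OF f] False that by (auto simp: shifted_def)
  then show ?thesis by simp
qed

lemma V_BL_D:
  assumes "w \<in> V_BL \<Omega> m n X Y"
  shows "w \<in> H10 \<Omega>" "K \<in> cells m n \<Longrightarrow> \<exists>q\<in>Q 1. agrees_on w (cell X Y K) q"
  using assms by (simp_all only: V_BL_def mem_Collect_eq)

text \<open>The increment bound excludes jumps at every interior point of every edge, boundary edges
  included, so all jumps vanish along their edges and are trivial Legendre multiples.\<close>

lemma V_BL_subset_V_MC: "V_BL \<Omega> m n X Y \<subseteq> V_MC \<Omega> m n X Y"
proof
  fix w assume w: "w \<in> V_BL \<Omega> m n X Y"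
  then have "\<forall>K. \<exists>q. K \<in> cells m n \<longrightarrow> q \<in> Q 1 \<and> agrees_on w (cell X Y K) q" unfolding V_BL_def by blast
  then obtain q where q: "\<And>K. K \<in> cells m n \<Longrightarrow> q K \<in> Q 1 \<and> agrees_on w (cell X Y K) (q K)"
    by metis
  then have q_P_2: "\<forall>K\<in>cells m n. q K \<in> P 2" using Q_1_subset_P_2 by blast
  have "w \<in> H10 \<Omega>" using w by (simp add: V_BL_def)
  then obtain f C where f: "w = ae_class f" "f \<in> sq_integrable \<Omega>"
    and bound: "\<And>b h. b \<in> Basis \<Longrightarrow> 0 < h \<Longrightarrow>
       (\<integral>\<^sup>+ p. ennreal ((f (p + h *\<^sub>R b) - f p)\<^sup>2) \<partial>lborel) \<le> ennreal (C * h\<^sup>2)"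
    using H10_increment_bound by blast
  have reg: "AE p in lborel. p \<in> region a b \<longrightarrow> f p = shifted m n q a b p" if "a \<le> Suc m" "b \<le> Suc n" for a b
    using region_shifted[OF f(2) _ that] q f(1) by blast
  have P2: "shifted m n q a b \<in> P 2" for a b by (rule shifted_in_P_2[OF q_P_2])
  have cont: "isCont (shifted m n q a b) z" for a b z
    using continuous_on_P_2[OF P2, of UNIV] unfolding continuous_on_eq_continuous_at[OF open_UNIV] by blast
  have diff_P2: "(\<lambda>p. shifted m n q a b p - shifted m n q a' b' p) \<in> P 2" for a b a' b'
    using P_lincomb[OF P2[of a b] P2[of a' b'], of 1 "-1"] by simp
  have open_imp: "open {p. c \<longrightarrow> R p}" if "open {p. R p}" for c and R :: "plane \<Rightarrow> bool"
    using that by (cases c) simp_all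
  \<comment> \<open>The region \<open>a b\<close> is on the upper side of \<open>z\<close> in
    direction \<open>e\<close>, the region \<open>a' b'\<close> on the lower side; \<open>N\<close>
    has to be small enough to meet no other region off the line through \<open>z\<close>.\<close>
  have trace: "shifted m n q a b z = shifted m n q a' b' z"
    if e: "e \<in> Basis" and N: "open N" "z \<in> N"
      and R: "\<And>p. p \<in> N \<Longrightarrow> z \<bullet> e < p \<bullet> e \<Longrightarrow> p \<in> region a b"
      and L: "\<And>p. p \<in> N \<Longrightarrow> p \<bullet> e < z \<bullet> e \<Longrightarrow> p \<in> region a' b'"
      and ab: "a \<le> Suc m" "b \<le> Suc n" "a' \<le> Suc m" "b' \<le> Suc n" for e N z a b a' b'
  proof -
    obtain r where r: "0 < r" "ball z r \<subseteq> N" using N open_contains_ball by blast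
    show ?thesis
    proof (rule traces_agree[OF sq_integrableD(1)[OF f(2)] e bound[OF e] r(1)])
      show "AE p in lborel. p \<in> ball z r \<and> z \<bullet> e < p \<bullet> e \<longrightarrow> f p = shifted m n q a b p"
        using reg[OF ab(1,2)] by eventually_elim (use r R in blast)
      show "AE p in lborel. p \<in> ball z r \<and> p \<bullet> e < z \<bullet> e \<longrightarrow> f p = shifted m n q a' b' p"
        using reg[OF ab(3,4)] by eventually_elim (use r L in blast)
    qed (use cont in auto)
  qed
  have "moment_matched m n X Y q"
    unfolding moment_matched_def
  proof (intro conjI allI impI)
    fix i j assume ij: "i \<le> m" "j < n"
    show "legendre_multiple (X i, Y j) (X i, Y (Suc j))
        (\<lambda>p. shifted m n q (Suc i) (Suc j) p - shifted m n q i (Suc j) p)"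
    proof (rule legendre_multiple_of_zero[OF diff_P2])
      fix \<tau> :: real assume \<tau>: "0 < \<tau>" "\<tau> < 1"
      define y where "y = Y j + \<tau> * (Y (Suc j) - Y j)"
      have lp: "linepath (X i, Y j) (X i, Y (Suc j)) \<tau> = (X i, y)"
        by (simp add: linepath_def y_def algebra_simps)
      have "0 < Y (Suc j) - Y j" using Y_less[of j "Suc j"] ij by simp
      then have "0 < \<tau> * (Y (Suc j) - Y j)" "\<tau> * (Y (Suc j) - Y j) < 1 * (Y (Suc j) - Y j)"
        using \<tau> by (auto intro: mult_strict_right_mono)
      then have y: "Y j < y" "y < Y (Suc j)" unfolding y_def by simp_all
      \<comment> \<open>A neighbourhood of the open edge that reaches up to the next grid line on
        either side; at the boundary the guards drop the bound, as there is no further line.\<close>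
      define N where "N = {p :: plane. (0 < i \<longrightarrow> X (i - 1) < fst p) \<and> (i < m \<longrightarrow> fst p < X (Suc i)) \<and>
          Y j < snd p \<and> snd p < Y (Suc j)}"
      have "open N" unfolding N_def
        by (intro open_Collect_conj open_imp open_Collect_less continuous_intros)
      have "(X i, y) \<in> N" using y ij X_less[of "i - 1" i] X_less[of i "Suc i"] by (auto simp: N_def)
      have "shifted m n q (Suc i) (Suc j) (X i, y) = shifted m n q i (Suc j) (X i, y)"
        by (rule trace[OF _ \<open>open N\<close> \<open>(X i, y) \<in> N\<close>, of "(1, 0)"]) (use ij in \<open>auto simp: plane_Basis N_def region_def\<close>)
      then show "shifted m n q (Suc i) (Suc j) (linepath (X i, Y j) (X i, Y (Suc j)) \<tau>) -
          shifted m n q i (Suc j) (linepath (X i, Y j) (X i, Y (Suc j)) \<tau>) = 0"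
        unfolding lp by simp
    qed
  next
    fix i j assume ij: "i < m" "j \<le> n"
    show "legendre_multiple (X i, Y j) (X (Suc i), Y j)
        (\<lambda>p. shifted m n q (Suc i) (Suc j) p - shifted m n q (Suc i) j p)"
    proof (rule legendre_multiple_of_zero[OF diff_P2])
      fix \<tau> :: real assume \<tau>: "0 < \<tau>" "\<tau> < 1"
      define x where "x = X i + \<tau> * (X (Suc i) - X i)"
      have lp: "linepath (X i, Y j) (X (Suc i), Y j) \<tau> = (x, Y j)"
        by (simp add: linepath_def x_def algebra_simps)
      have "0 < X (Suc i) - X i" using X_less[of i "Suc i"] ij by simp
      then have "0 < \<tau> * (X (Suc i) - X i)" "\<tau> * (X (Suc i) - X i) < 1 * (X (Suc i) - X i)"
        using \<tau> by (auto intro: mult_strict_right_mono)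
      then have x: "X i < x" "x < X (Suc i)" unfolding x_def by simp_all
      define N where "N = {p :: plane. (0 < j \<longrightarrow> Y (j - 1) < snd p) \<and> (j < n \<longrightarrow> snd p < Y (Suc j)) \<and>
          X i < fst p \<and> fst p < X (Suc i)}"
      have "open N" unfolding N_def
        by (intro open_Collect_conj open_imp open_Collect_less continuous_intros)
      have "(x, Y j) \<in> N" using x ij Y_less[of "j - 1" j] Y_less[of j "Suc j"] by (auto simp: N_def)
      have "shifted m n q (Suc i) (Suc j) (x, Y j) = shifted m n q (Suc i) j (x, Y j)"
        by (rule trace[OF _ \<open>open N\<close> \<open>(x, Y j) \<in> N\<close>, of "(0, 1)"]) (use ij in \<open>auto simp: plane_Basis N_def region_def\<close>)
      then show "shifted m n q (Suc i) (Suc j) (linepath (X i, Y j) (X (Suc i), Y j) \<tau>) -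
          shifted m n q (Suc i) j (linepath (X i, Y j) (X (Suc i), Y j) \<tau>) = 0"
        unfolding lp by simp
    qed
  qed
  moreover have "w \<in> L2 \<Omega>" using f by (auto simp: L2_def)
  ultimately show "w \<in> V_MC \<Omega> m n X Y"
    unfolding V_MC_eq[OF subdivision] using q q_P_2 by blast
qed

section \<open>Linear structure of the two finite element spaces\<close>

lemma subspace_V_MC: "subspace (V_MC \<Omega> m n X Y)"
proof (rule subspace_by_lincomb)
  have "(\<lambda>_. 0) \<in> sq_integrable \<Omega>" by (simp add: sq_integrable_def)
  then have "0 \<in> L2 \<Omega>" unfolding L2_def zero_ae_fun_def by simp
  moreover have "moment_matched m n X Y (\<lambda>_ _. 0)"
    by (simp add: moment_matched_def shifted_def legendre_multiple_def exI[of _ 0])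
  moreover have "agrees_on 0 K (\<lambda>_. 0)" for K by transfer simp
  ultimately have "0 \<in> V_MC \<Omega> m n X Y"
    unfolding V_MC_eq[OF subdivision] using P_zero
    by (intro CollectI conjI exI[of _ "\<lambda>_ _. 0"] ballI) auto
  then show "V_MC \<Omega> m n X Y \<noteq> {}" by blast
next
  fix x y u v assume "u \<in> V_MC \<Omega> m n X Y" "v \<in> V_MC \<Omega> m n X Y"
  then obtain q r where u: "u \<in> L2 \<Omega>" "\<forall>K\<in>cells m n. q K \<in> P 2 \<and> agrees_on u (cell X Y K) (q K)"
      "moment_matched m n X Y q"
    and v: "v \<in> L2 \<Omega>" "\<forall>K\<in>cells m n. r K \<in> P 2 \<and> agrees_on v (cell X Y K) (r K)"
      "moment_matched m n X Y r"
    unfolding V_MC_eq[OF subdivision] by blast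
  obtain f g where "u = ae_class f" "f \<in> sq_integrable \<Omega>" "v = ae_class g" "g \<in> sq_integrable \<Omega>"
    using u v by (auto simp: L2_def)
  then have "x *\<^sub>R u + y *\<^sub>R v \<in> L2 \<Omega>"
    unfolding L2_def by (auto simp flip: ae_class_lincomb intro!: imageI sq_integrable_lincomb)
  moreover have "moment_matched m n X Y (\<lambda>K p. x * q K p + y * r K p)"
    by (intro moment_matched_lincomb u v)
  ultimately show "x *\<^sub>R u + y *\<^sub>R v \<in> V_MC \<Omega> m n X Y"
    unfolding V_MC_eq[OF subdivision] using u(2) v(2)
    by (intro CollectI conjI exI[of _ "\<lambda>K p. x * q K p + y * r K p"] ballI) (auto intro: P_lincomb agrees_on_lincomb)
qed

lemma subspace_V_BL: "subspace (V_BL \<Omega> m n X Y)"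
proof (rule subspace_by_lincomb)
  have "0 \<in> H10 \<Omega>" by (rule subspace_0[OF subspace_H10])
  moreover have "agrees_on 0 K (\<lambda>_. 0)" for K by transfer simp
  moreover have "(\<lambda>_. 0) \<in> Q 1" unfolding Q_def by (auto intro: exI[of _ "\<lambda>_ _. 0"])
  ultimately have "0 \<in> V_BL \<Omega> m n X Y" unfolding V_BL_def by blast
  then show "V_BL \<Omega> m n X Y \<noteq> {}" by blast
next
  fix x y u v assume uv: "u \<in> V_BL \<Omega> m n X Y" "v \<in> V_BL \<Omega> m n X Y"
  then have "x *\<^sub>R u + y *\<^sub>R v \<in> H10 \<Omega>"
    unfolding V_BL_def by (intro subspace_add[OF subspace_H10] subspace_scale[OF subspace_H10]) auto
  moreover have "\<exists>q\<in>Q 1. agrees_on (x *\<^sub>R u + y *\<^sub>R v) (cell X Y K) q" if K: "K \<in> cells m n" for K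
  proof -
    obtain q r where "q \<in> Q 1" "agrees_on u (cell X Y K) q" "r \<in> Q 1" "agrees_on v (cell X Y K) r"
      using V_BL_D(2)[OF uv(1) K] V_BL_D(2)[OF uv(2) K] by (elim bexE)
    then show ?thesis
      by (intro bexI[where x = "\<lambda>p. x * q p + y * r p"] agrees_on_lincomb Q_lincomb)
  qed
  ultimately show "x *\<^sub>R u + y *\<^sub>R v \<in> V_BL \<Omega> m n X Y" by (simp add: V_BL_def)
qed

text \<open>The bubble without its cutoff, so that it has polynomial coefficients and one-sided
  values on edges.\<close>

definition bubble_poly :: "nat \<times> nat \<Rightarrow> plane \<Rightarrow> real" where
  "bubble_poly K p =
     (fst p - X (fst K)) * (X (Suc (fst K)) - fst p) / (X (Suc (fst K)) - X (fst K))\<^sup>2 +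
     (snd p - Y (snd K)) * (Y (Suc (snd K)) - snd p) / (Y (Suc (snd K)) - Y (snd K))\<^sup>2 - 1 / 6"

lemma bubble_eq: "bubble X Y K p = (if p \<in> cell X Y K then bubble_poly K p else 0)"
proof (cases K, cases p)
  fix i j s t assume "K = (i, j)" "p = (s, t)"
  then show ?thesis by (simp add: bubble_poly_def Let_def theta_prod del: cell.simps)
qed

lemma bubble_poly_P_2: "bubble_poly K \<in> P 2"
proof -
  define x0 x1 y0 y1 where "x0 = X (fst K)" "x1 = X (Suc (fst K))" "y0 = Y (snd K)" "y1 = Y (Suc (snd K))"
  define \<alpha> \<beta> where "\<alpha> = 1 / (x1 - x0)\<^sup>2" "\<beta> = 1 / (y1 - y0)\<^sup>2"
  have "bubble_poly K (s, t) = (s - x0) * (x1 - s) * \<alpha> + (t - y0) * (y1 - t) * \<beta> - 1 / 6" for s t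
    by (simp add: bubble_poly_def x0_x1_y0_y1_def \<alpha>_\<beta>_def)
  then have "\<forall>s t. bubble_poly K (s, t) = (- x0 * x1 * \<alpha> - y0 * y1 * \<beta> - 1 / 6) + (x0 + x1) * \<alpha> * s +
      (y0 + y1) * \<beta> * t + 0 * (s * t) + (- \<alpha>) * s\<^sup>2 + (- \<beta>) * t\<^sup>2"
    by (simp add: power2_eq_square algebra_simps)
  then show ?thesis unfolding P_2_iff by blast
qed

text \<open>After multiplication by the squared width or height both coefficients are -1. Hence one
  multiple of the bubble removes both square terms on a cell as soon as the scaled coefficients
  there coincide.\<close>

lemma coeff_bubble_poly:
  "coeff_xx (bubble_poly (i, j)) = - 1 / (X (Suc i) - X i)\<^sup>2"
  "coeff_yy (bubble_poly (i, j)) = - 1 / (Y (Suc j) - Y j)\<^sup>2"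
proof -
  have *: "(1 - x0) * (x1 - 1) / c + A - B + ((-1 - x0) * (x1 - (-1)) / c + A - B) -
      2 * ((0 - x0) * (x1 - 0) / c + A - B) = - 2 / c" for x0 x1 c A B :: real
    by (simp add: diff_divide_distrib[symmetric] add_divide_distrib[symmetric] algebra_simps)
  show "coeff_xx (bubble_poly (i, j)) = - 1 / (X (Suc i) - X i)\<^sup>2"
    using *[of "X i" "X (Suc i)" "(X (Suc i) - X i)\<^sup>2" "(0 - Y j) * (Y (Suc j) - 0) / (Y (Suc j) - Y j)\<^sup>2" "1 / 6"]
    by (simp add: coeff_xx_def bubble_poly_def)
  show "coeff_yy (bubble_poly (i, j)) = - 1 / (Y (Suc j) - Y j)\<^sup>2"
    using *[of "Y j" "Y (Suc j)" "(Y (Suc j) - Y j)\<^sup>2" "(0 - X i) * (X (Suc i) - 0) / (X (Suc i) - X i)\<^sup>2" "1 / 6"]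
    by (simp add: coeff_yy_def bubble_poly_def ac_simps)
qed

text \<open>On a vertical side the \<open>x\<close> part is 0 and the rest is
  \<open>\<tau> - \<tau>^2 - 1/6\<close>.\<close>

lemma legendre_bubble_poly_vertical:
  assumes "j < n" "s = X i \<or> s = X (Suc i)"
  shows "legendre_multiple (s, Y j) (s, Y (Suc j)) (bubble_poly (i, j))"
proof -
  define \<eta> where "\<eta> = Y (Suc j) - Y j"
  have \<eta>: "\<eta> \<noteq> 0" using Y_less[of j "Suc j"] assms by (simp add: \<eta>_def)
  have lp: "linepath (s, Y j) (s, Y (Suc j)) \<tau> = (s, Y j + \<tau> * \<eta>)" for \<tau>
    by (simp add: linepath_def \<eta>_def algebra_simps)
  have x0: "(s - X i) * (X (Suc i) - s) = 0" using assms by auto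
  have "bubble_poly (i, j) (s, Y j + \<tau> * \<eta>) = -1 * (\<tau>\<^sup>2 - \<tau> + 1 / 6)" for \<tau>
  proof -
    have "(Y j + \<tau> * \<eta> - Y j) * (Y (Suc j) - (Y j + \<tau> * \<eta>)) = (\<tau> - \<tau>\<^sup>2) * \<eta>\<^sup>2"
      unfolding \<eta>_def by algebra
    then show ?thesis using \<eta> x0 unfolding bubble_poly_def by (simp flip: \<eta>_def)
  qed
  then show ?thesis unfolding legendre_multiple_def lp by blast
qed

lemma legendre_bubble_poly_horizontal:
  assumes "i < m" "t = Y j \<or> t = Y (Suc j)"
  shows "legendre_multiple (X i, t) (X (Suc i), t) (bubble_poly (i, j))"
proof -
  define \<xi> where "\<xi> = X (Suc i) - X i"
  have \<xi>: "\<xi> \<noteq> 0" using X_less[of i "Suc i"] assms by (simp add: \<xi>_def)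
  have lp: "linepath (X i, t) (X (Suc i), t) \<tau> = (X i + \<tau> * \<xi>, t)" for \<tau>
    by (simp add: linepath_def \<xi>_def algebra_simps)
  have y0: "(t - Y j) * (Y (Suc j) - t) = 0" using assms by auto
  have "bubble_poly (i, j) (X i + \<tau> * \<xi>, t) = -1 * (\<tau>\<^sup>2 - \<tau> + 1 / 6)" for \<tau>
  proof -
    have "(X i + \<tau> * \<xi> - X i) * (X (Suc i) - (X i + \<tau> * \<xi>)) = (\<tau> - \<tau>\<^sup>2) * \<xi>\<^sup>2"
      unfolding \<xi>_def by algebra
    then show ?thesis using \<xi> y0 unfolding bubble_poly_def by (simp flip: \<xi>_def)
  qed
  then show ?thesis unfolding legendre_multiple_def lp by blast
qed

section \<open>Points off the grid lines and sums of bubbles\<close>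

lemma AE_off_grid_lines: "AE p in lborel. (\<forall>i\<le>m. fst p \<noteq> X i) \<and> (\<forall>j\<le>n. snd p \<noteq> Y j)"
proof -
  have "AE p in (lborel :: plane measure). \<forall>i\<in>{..m}. fst p \<noteq> X i"
    "AE p in (lborel :: plane measure). \<forall>j\<in>{..n}. snd p \<noteq> Y j"
    using AE_fst_neq AE_snd_neq by (auto intro!: eventually_ball_finite)
  then show ?thesis by eventually_elim auto
qed

lemma cell_off_grid:
  assumes "\<forall>i\<le>m. s \<noteq> X i" "\<forall>j\<le>n. t \<noteq> Y j" "i < m" "j < n"
  shows "(s, t) \<in> cell X Y (i, j) \<longleftrightarrow> X i < s \<and> s < X (Suc i) \<and> Y j < t \<and> t < Y (Suc j)"
  using assms(1)[rule_format, of i] assms(1)[rule_format, of "Suc i"]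
    assms(2)[rule_format, of j] assms(2)[rule_format, of "Suc j"] assms(3,4)
  by (auto simp: cbox_Pair)

text \<open>One pair of inequalities is strict and the other is not: a point of an open column is
  compared with closed cells, which overlap along grid lines.\<close>

lemma column_unique:
  assumes "X i < s" "s < X (Suc i)" "X i' \<le> s" "s \<le> X (Suc i')" "i < m" "i' < m"
  shows "i' = i"
proof (rule ccontr)
  assume "i' \<noteq> i"
  then consider "Suc i \<le> i'" | "Suc i' \<le> i" by linarith
  then show False
    by cases (use X_le[of "Suc i" i'] X_le[of "Suc i'" i] assms in auto)
qed

lemma row_unique:
  assumes "Y j < t" "t < Y (Suc j)" "Y j' \<le> t" "t \<le> Y (Suc j')" "j < n" "j' < n"
  shows "j' = j"
proof (rule ccontr)
  assume "j' \<noteq> j"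
  then consider "Suc j \<le> j'" | "Suc j' \<le> j" by linarith
  then show False
    by cases (use Y_le[of "Suc j" j'] Y_le[of "Suc j'" j] assms in auto)
qed

lemma sum_bubbles:
  assumes "X i < s" "s < X (Suc i)" "Y j < t" "t < Y (Suc j)" "i < m" "j < n"
  shows "(\<Sum>K\<in>cells m n. g K * bubble X Y K (s, t)) = g (i, j) * bubble_poly (i, j) (s, t)"
proof -
  have "g K * bubble X Y K (s, t) = (if K = (i, j) then g (i, j) * bubble_poly (i, j) (s, t) else 0)"
    if "K \<in> cells m n" for K
  proof -
    from that obtain i' j' where K: "K = (i', j')" "i' < m" "j' < n" by (auto simp: cells_def)
    have "(s, t) \<in> cell X Y K \<longleftrightarrow> K = (i, j)"
      using assms K column_unique[of i s i'] row_unique[of j t j'] by (auto simp: cbox_Pair)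
    then show ?thesis by (simp add: bubble_eq)
  qed
  then have "(\<Sum>K\<in>cells m n. g K * bubble X Y K (s, t)) =
      (\<Sum>K\<in>cells m n. if K = (i, j) then g (i, j) * bubble_poly (i, j) (s, t) else 0)"
    by (intro sum.cong) auto
  also have "\<dots> = g (i, j) * bubble_poly (i, j) (s, t)"
    using assms finite_cells by (simp add: cells_def)
  finally show ?thesis .
qed

lemma cell_off_grid_subset:
  assumes "\<forall>i\<le>m. fst p \<noteq> X i" "\<forall>j\<le>n. snd p \<noteq> Y j" "K \<in> cells m n" "p \<in> cell X Y K"
  shows "p \<in> \<Omega>"
proof -
  obtain i j s t where K: "K = (i, j)" "i < m" "j < n" and p: "p = (s, t)"
    using assms by (cases p) (auto simp: cells_def)
  have "X i < s \<and> s < X (Suc i) \<and> Y j < t \<and> t < Y (Suc j)"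
    using cell_off_grid[of s t i j] assms K p by simp
  moreover have "X 0 \<le> X i" "X (Suc i) \<le> X m" "Y 0 \<le> Y j" "Y (Suc j) \<le> Y n"
    using K by (auto intro: X_le Y_le)
  ultimately show ?thesis by (auto simp: \<Omega>_eq p box_Pair)
qed

text \<open>The only nonzero cell polynomial is a Legendre multiple on all four sides of its cell,
  so every jump is that polynomial, its negative or 0.\<close>

lemma bubble_in_V_MC:
  assumes K: "K \<in> cells m n"
  shows "ae_class (bubble X Y K) \<in> V_MC \<Omega> m n X Y"
proof -
  obtain i j where ij: "K = (i, j)" "i < m" "j < n" using K by (auto simp: cells_def)
  \<comment> \<open>The bubble lives on a closed cell, which may touch the boundary of the open set
    \<open>\<Omega>\<close>; a representative in \<open>sq_integrable\<close> has to be cut off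
    there, which changes it on a null set only.\<close>
  define f where "f p = (if p \<in> \<Omega> then bubble X Y K p else 0)" for p
  have "cell X Y K \<in> sets borel" by (simp add: ij)
  moreover have "bubble_poly K \<in> borel_measurable borel"
    by (intro borel_measurable_continuous_onI continuous_on_P_2 bubble_poly_P_2)
  ultimately have meas: "f \<in> borel_measurable borel"
    unfolding f_def[abs_def] bubble_eq using \<Omega>_borel by measurable
  have "compact (cell X Y K)" by (simp add: ij)
  then have "bounded (bubble_poly K ` cell X Y K)"
    by (intro compact_imp_bounded compact_continuous_image continuous_on_P_2 bubble_poly_P_2)
  then obtain M where M: "\<And>p. p \<in> cell X Y K \<Longrightarrow> \<bar>bubble_poly K p\<bar> \<le> M" by (auto simp: bounded_iff)
  have "\<bar>f p\<bar> \<le> max 0 M" for p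
    using M[of p] unfolding f_def bubble_eq by (auto simp del: split_paired_All)
  then have "f \<in> sq_integrable \<Omega>"
    by (rule sq_integrable_bounded[OF meas \<Omega>_borel \<Omega>_bounded]) (simp add: f_def)
  moreover have "AE p in lborel. f p = bubble X Y K p"
    using AE_off_grid_lines
  proof eventually_elim
    case (elim p)
    then show ?case using cell_off_grid_subset[OF _ _ K] unfolding f_def bubble_eq by auto
  qed
  ultimately have L2: "ae_class (bubble X Y K) \<in> L2 \<Omega>"
    unfolding L2_def using ae_class_eq_iff by (metis imageI)
  define q where "q L = (if L = K then bubble_poly K else (\<lambda>_. 0))" for L
  have agrees: "agrees_on (ae_class (bubble X Y K)) (cell X Y L) (q L)" if L: "L \<in> cells m n" for L
    unfolding agrees_on_ae_class using AE_off_grid_lines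
  proof eventually_elim
    case (elim p)
    show ?case
    proof
      assume p: "p \<in> cell X Y L"
      obtain i' j' s t where L': "L = (i', j')" "i' < m" "j' < n" "p = (s, t)"
        using L by (cases p) (auto simp: cells_def)
      have "X i' < s \<and> s < X (Suc i') \<and> Y j' < t \<and> t < Y (Suc j')"
        using cell_off_grid[of s t i' j'] elim L' p by simp
      then have "p \<in> cell X Y K \<longleftrightarrow> L = K"
        using L' ij column_unique[of i' s i] row_unique[of j' t j] by (auto simp: cbox_Pair)
      then show "bubble X Y K p = q L p" by (simp add: bubble_eq q_def)
    qed
  qed
  have sh: "shifted m n q a b = (if a = Suc i \<and> b = Suc j then bubble_poly (i, j) else (\<lambda>_. 0))" for a b
    using ij by (auto simp: shifted_def q_def fun_eq_iff)
  have zero: "legendre_multiple p p' (\<lambda>_. 0)" for p p'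
    by (simp add: legendre_multiple_def exI[of _ 0])
  have diff: "legendre_multiple p p' (\<lambda>z. J z - J' z)"
    if "legendre_multiple p p' J" "legendre_multiple p p' J'" for p p' J J'
    using legendre_multiple_lincomb[OF that, of 1 "-1"] by simp
  have "moment_matched m n X Y q"
    unfolding moment_matched_def
    by (intro conjI allI impI diff; unfold sh)
       (auto intro!: zero legendre_bubble_poly_vertical legendre_bubble_poly_horizontal)
  moreover have "q L \<in> P 2" for L using bubble_poly_P_2 P_zero by (simp add: q_def)
  ultimately show ?thesis
    unfolding V_MC_eq[OF subdivision] using L2 agrees by blast
qed

text \<open>Summing the jumps around a vertex gives a relation between the values of \<open>d - e\<close> on the four
  adjacent cells; as \<open>d - e\<close> vanishes outside the grid, it vanishes everywhere.\<close>

lemma corner_values: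
  fixes q :: "nat \<times> nat \<Rightarrow> plane \<Rightarrow> real"
  defines "d a b \<equiv> coeff_xx (shifted m n q a b) * (X a - X (a - 1))\<^sup>2"
    and "e a b \<equiv> coeff_yy (shifted m n q a b) * (Y b - Y (b - 1))\<^sup>2"
  assumes q: "\<forall>K\<in>cells m n. q K \<in> P 2" and mm: "moment_matched m n X Y q"
  obtains U where "\<And>a b. a \<le> Suc m \<Longrightarrow> b \<le> Suc n \<Longrightarrow> d a b = e a b"
    "\<And>i j a b. i \<le> m \<Longrightarrow> j \<le> n \<Longrightarrow> a = i \<or> a = Suc i \<Longrightarrow> b = j \<or> b = Suc j \<Longrightarrow>
       shifted m n q a b (X i, Y j) - d a b / 6 = U i j"
    "\<And>i. i \<le> m \<Longrightarrow> U i 0 = 0 \<and> U i n = 0" "\<And>j. j \<le> n \<Longrightarrow> U 0 j = 0 \<and> U m j = 0"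
proof -
  let ?s = "shifted m n q"
  have diff_P2: "(\<lambda>p. ?s a b p - ?s a' b' p) \<in> P 2" for a b a' b'
    using P_lincomb[OF shifted_in_P_2[OF q, of a b] shifted_in_P_2[OF q, of a' b'], of 1 "-1"] by simp
  have coeff_diff: "coeff_xx (\<lambda>p. r p - s p) = coeff_xx r - coeff_xx s"
    "coeff_yy (\<lambda>p. r p - s p) = coeff_yy r - coeff_yy s" for r s
    by (simp_all add: coeff_xx_def coeff_yy_def field_simps)
  have outside: "?s a b = (\<lambda>_. 0)" "d a b = 0" "e a b = 0" if "\<not> (0 < a \<and> a \<le> m \<and> 0 < b \<and> b \<le> n)" for a b
    using that by (auto simp: shifted_def d_def e_def coeff_xx_def coeff_yy_def)
  \<comment> \<open>The jump across a vertical edge, evaluated at its end \<open>(X i, Y j)\<close>.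
    With \<open>b = j\<close> the edge lies below this vertex, with \<open>b = Suc j\<close> above
    it; if it is not in the grid, both sides of the equation are 0.\<close>
  have V: "?s (Suc i) b (X i, Y j) - ?s i b (X i, Y j) = (e (Suc i) b - e i b) / 6"
    if ij: "i \<le> m" "j \<le> n" and b: "b = j \<or> b = Suc j" for i j b
  proof (cases "0 < b \<and> b \<le> n")
    case True
    then obtain k where k: "b = Suc k" "k < n" by (cases b) auto
    have L: "legendre_multiple (X i, Y k) (X i, Y (Suc k)) (\<lambda>p. ?s (Suc i) (Suc k) p - ?s i (Suc k) p)"
      using mm ij(1) k(2) by (simp add: moment_matched_def)
    have "j = k \<or> j = Suc k" using b k by auto
    then show ?thesis
      using vertical_edge_ends[OF diff_P2 L] by (auto simp: e_def k coeff_diff left_diff_distrib)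
  next
    case False
    then show ?thesis using outside[of i b] outside[of "Suc i" b] by simp
  qed
  have H: "?s a (Suc j) (X i, Y j) - ?s a j (X i, Y j) = (d a (Suc j) - d a j) / 6"
    if ij: "i \<le> m" "j \<le> n" and a: "a = i \<or> a = Suc i" for i j a
  proof (cases "0 < a \<and> a \<le> m")
    case True
    then obtain k where k: "a = Suc k" "k < m" by (cases a) auto
    have L: "legendre_multiple (X k, Y j) (X (Suc k), Y j) (\<lambda>p. ?s (Suc k) (Suc j) p - ?s (Suc k) j p)"
      using mm ij(2) k(2) by (simp add: moment_matched_def)
    have "i = k \<or> i = Suc k" using a k by auto
    then show ?thesis
      using horizontal_edge_ends[OF diff_P2 L] by (auto simp: d_def k coeff_diff left_diff_distrib)
  next
    case False
    then have "\<not> (0 < a \<and> a \<le> m \<and> 0 < j \<and> j \<le> n)" "\<not> (0 < a \<and> a \<le> m \<and> 0 < Suc j \<and> Suc j \<le> n)" by auto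
    then show ?thesis by (simp add: outside)
  qed
  \<comment> \<open>The signed jumps around the vertex add up to 0. Vertical edges contribute
    differences of \<open>e\<close>, horizontal ones differences of \<open>d\<close>.\<close>
  have step: "d (Suc i) (Suc j) - e (Suc i) (Suc j) =
      (d i (Suc j) - e i (Suc j)) + (d (Suc i) j - e (Suc i) j) - (d i j - e i j)" if "i \<le> m" "j \<le> n" for i j
    using V[OF that, of j] V[OF that, of "Suc j"] H[OF that, of i] H[OF that, of "Suc i"] by simp
  \<comment> \<open>Induction from the lower left: cells with an index 0 lie outside the grid, and
    \<open>step\<close> obtains the upper right cell at a vertex from the other three.\<close>
  have eq: "d a b - e a b = 0" if "a \<le> Suc m" "b \<le> Suc n" for a b
    using that
  proof (induction a arbitrary: b)
    case (Suc a)
    show ?case using Suc.prems(2)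
    proof (induction b)
      case (Suc b)
      then show ?case using step[of a b] Suc.IH \<open>Suc a \<le> Suc m\<close> \<open>\<And>b. a \<le> Suc m \<Longrightarrow> b \<le> Suc n \<Longrightarrow> d a b - e a b = 0\<close>
        by simp
    qed (simp add: outside)
  qed (simp add: outside)
  \<comment> \<open>As \<open>d = e\<close>, the jumps at a vertex are differences of
    \<open>d / 6\<close> across horizontal and vertical edges alike; subtracting
    \<open>d / 6\<close> makes the four values equal.\<close>
  define U where "U i j = ?s (Suc i) (Suc j) (X i, Y j) - d (Suc i) (Suc j) / 6" for i j
  have U: "?s a b (X i, Y j) - d a b / 6 = U i j"
    if ij: "i \<le> m" "j \<le> n" and ab: "a = i \<or> a = Suc i" "b = j \<or> b = Suc j" for i j a b
    using V[OF ij, of j] V[OF ij, of "Suc j"] H[OF ij, of i] H[OF ij, of "Suc i"]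
      eq[of i j] eq[of "Suc i" j] eq[of i "Suc j"] eq[of "Suc i" "Suc j"] ij ab
    unfolding U_def by auto
  \<comment> \<open>At a boundary vertex \<open>U\<close> can be evaluated from an adjacent cell
    outside the grid, where everything is 0.\<close>
  have "U i 0 = 0 \<and> U i n = 0" if "i \<le> m" for i
    using U[of i 0 i 0] U[of i n i "Suc n"] that outside by simp
  moreover have "U 0 j = 0 \<and> U m j = 0" if "j \<le> n" for j
    using U[of 0 j 0 j] U[of m j "Suc m" j] that outside by simp
  moreover have "d a b = e a b" if "a \<le> Suc m" "b \<le> Suc n" for a b using eq[OF that] by simp
  ultimately show ?thesis using U by (intro that[of U]) blast+
qed

text \<open>Only interior vertices carry a hat, so every summand has its support in the rectangle.
  On a cell the double sum is evaluated by interpolating in \<open>t\<close> and then in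
  \<open>s\<close>, each time by \<open>hat_sum_eq\<close>.\<close>

lemma nodal_interpolant_in_H10:
  fixes U :: "nat \<Rightarrow> nat \<Rightarrow> real"
  defines "h \<equiv> \<lambda>p. \<Sum>c\<in>{0<..<m} \<times> {0<..<n}. U (fst c) (snd c) *
      (hat (X (fst c - 1)) (X (fst c)) (X (Suc (fst c))) (fst p) *
       hat (Y (snd c - 1)) (Y (snd c)) (Y (Suc (snd c))) (snd p))"
  assumes U: "\<And>i. i \<le> m \<Longrightarrow> U i 0 = 0 \<and> U i n = 0" "\<And>j. j \<le> n \<Longrightarrow> U 0 j = 0 \<and> U m j = 0"
  shows "ae_class h \<in> H10 \<Omega>"
    and "p \<notin> \<Omega> \<Longrightarrow> h p = 0"
    and "i < m \<Longrightarrow> j < n \<Longrightarrow> X i < s \<Longrightarrow> s < X (Suc i) \<Longrightarrow> Y j < t \<Longrightarrow> t < Y (Suc j) \<Longrightarrow> h (s, t) =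
      (U i j * ((Y (Suc j) - t) / (Y (Suc j) - Y j)) + U i (Suc j) * ((t - Y j) / (Y (Suc j) - Y j))) *
        ((X (Suc i) - s) / (X (Suc i) - X i)) +
      (U (Suc i) j * ((Y (Suc j) - t) / (Y (Suc j) - Y j)) + U (Suc i) (Suc j) * ((t - Y j) / (Y (Suc j) - Y j))) *
        ((s - X i) / (X (Suc i) - X i))"
proof -
  let ?hX = "\<lambda>a. hat (X (a - 1)) (X a) (X (Suc a))" and ?hY = "\<lambda>b. hat (Y (b - 1)) (Y b) (Y (Suc b))"
  have X3: "X 0 \<le> X (a - 1)" "X (a - 1) < X a" "X a < X (Suc a)" "X (Suc a) \<le> X m" if "a \<in> {0<..<m}" for a
    using that by (auto intro: X_le X_less)
  have Y3: "Y 0 \<le> Y (b - 1)" "Y (b - 1) < Y b" "Y b < Y (Suc b)" "Y (Suc b) \<le> Y n" if "b \<in> {0<..<n}" for b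
    using that by (auto intro: Y_le Y_less)
  have "ae_class h = (\<Sum>c\<in>{0<..<m} \<times> {0<..<n}. U (fst c) (snd c) *\<^sub>R
      ae_class (\<lambda>p. ?hX (fst c) (fst p) * ?hY (snd c) (snd p)))"
    unfolding h_def by (rule ae_class_sum)
  also have "\<dots> \<in> H10 \<Omega>"
  proof (intro subspace_sum[OF subspace_H10] subspace_scale[OF subspace_H10])
    fix c assume "c \<in> {0<..<m} \<times> {0<..<n}"
    then have c: "fst c \<in> {0<..<m}" "snd c \<in> {0<..<n}" by auto
    show "ae_class (\<lambda>p. ?hX (fst c) (fst p) * ?hY (snd c) (snd p)) \<in> H10 \<Omega>"
      unfolding \<Omega>_eq by (rule hat_tensor_in_H10[OF X3[OF c(1)] Y3[OF c(2)]])
  qed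
  finally show "ae_class h \<in> H10 \<Omega>" .
  show "h p = 0" if p: "p \<notin> \<Omega>"
    unfolding h_def
  proof (rule sum.neutral, rule ballI)
    fix c assume "c \<in> {0<..<m} \<times> {0<..<n}"
    then have c: "fst c \<in> {0<..<m}" "snd c \<in> {0<..<n}" by auto
    have "fst p \<le> X 0 \<or> X m \<le> fst p \<or> snd p \<le> Y 0 \<or> Y n \<le> snd p"
      using p by (cases p) (auto simp: \<Omega>_eq box_Pair)
    then have "?hX (fst c) (fst p) = 0 \<or> ?hY (snd c) (snd p) = 0"
      using hat_simps(1,4)[OF X3(2,3)[OF c(1)], of "fst p"] hat_simps(1,4)[OF Y3(2,3)[OF c(2)], of "snd p"]
        X3[OF c(1)] Y3[OF c(2)] by linarith
    then show "U (fst c) (snd c) * (?hX (fst c) (fst p) * ?hY (snd c) (snd p)) = 0" by auto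
  qed
  assume ij: "i < m" "j < n" and s: "X i < s" "s < X (Suc i)" and t: "Y j < t" "t < Y (Suc j)"
  \<comment> \<open>For fixed \<open>t\<close> the inner sum is a nodal function of the column
    index, and it inherits the zeros at \<open>0\<close> and \<open>m\<close>.\<close>
  define u where "u a = (\<Sum>b\<in>{0<..<n}. U a b * ?hY b t)" for a
  have u: "u a = U a j * ((Y (Suc j) - t) / (Y (Suc j) - Y j)) + U a (Suc j) * ((t - Y j) / (Y (Suc j) - Y j))"
    if "a \<le> m" for a
    unfolding u_def using U(1)[OF that] by (intro hat_sum_eq[OF Y_mono ij(2) t]) auto
  have "h (s, t) = (\<Sum>a\<in>{0<..<m}. \<Sum>b\<in>{0<..<n}. U a b * (?hX a s * ?hY b t))"
    unfolding h_def by (simp add: sum.cartesian_product case_prod_beta)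
  also have "\<dots> = (\<Sum>a\<in>{0<..<m}. u a * ?hX a s)"
    unfolding u_def sum_distrib_right by (intro sum.cong refl) (simp add: ac_simps)
  also have "\<dots> = u i * ((X (Suc i) - s) / (X (Suc i) - X i)) + u (Suc i) * ((s - X i) / (X (Suc i) - X i))"
  proof (rule hat_sum_eq[OF X_mono ij(1) s])
    show "u 0 = 0" "u m = 0" using U(2) by (auto simp: u_def intro!: sum.neutral)
  qed
  finally show "h (s, t) =
      (U i j * ((Y (Suc j) - t) / (Y (Suc j) - Y j)) + U i (Suc j) * ((t - Y j) / (Y (Suc j) - Y j))) *
        ((X (Suc i) - s) / (X (Suc i) - X i)) +
      (U (Suc i) j * ((Y (Suc j) - t) / (Y (Suc j) - Y j)) + U (Suc i) (Suc j) * ((t - Y j) / (Y (Suc j) - Y j))) *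
        ((s - X i) / (X (Suc i) - X i))"
    using ij by (simp only: u less_imp_le Suc_leI)
qed

lemma V_MC_decompose:
  assumes "w \<in> V_MC \<Omega> m n X Y"
  obtains v g where "v \<in> V_BL \<Omega> m n X Y" "w = v + (\<Sum>K\<in>cells m n. g K *\<^sub>R ae_class (bubble X Y K))"
proof -
  obtain q where "w \<in> L2 \<Omega>" and q: "\<forall>K\<in>cells m n. q K \<in> P 2"
    and agrees: "\<forall>K\<in>cells m n. agrees_on w (cell X Y K) (q K)"
    and mm: "moment_matched m n X Y q"
    using assms unfolding V_MC_eq[OF subdivision] by blast
  then obtain f where f: "w = ae_class f" "f \<in> sq_integrable \<Omega>" unfolding L2_def by blast
  define d where "d a b = coeff_xx (shifted m n q a b) * (X a - X (a - 1))\<^sup>2" for a b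
  define e where "e a b = coeff_yy (shifted m n q a b) * (Y b - Y (b - 1))\<^sup>2" for a b
  obtain U where de: "\<And>a b. a \<le> Suc m \<Longrightarrow> b \<le> Suc n \<Longrightarrow> d a b = e a b"
    and corner: "\<And>i j a b. i \<le> m \<Longrightarrow> j \<le> n \<Longrightarrow> a = i \<or> a = Suc i \<Longrightarrow> b = j \<or> b = Suc j \<Longrightarrow>
       shifted m n q a b (X i, Y j) - d a b / 6 = U i j"
    and U0: "\<And>i. i \<le> m \<Longrightarrow> U i 0 = 0 \<and> U i n = 0" "\<And>j. j \<le> n \<Longrightarrow> U 0 j = 0 \<and> U m j = 0"
    using corner_values[OF q mm] unfolding d_def e_def by blast
  \<comment> \<open>The scaled coefficients of the bubble are -1, hence the sign; \<open>Suc\<close>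
    passes from the cell to its shifted index.\<close>
  define g where "g K = - d (Suc (fst K)) (Suc (snd K))" for K
  define B where "B K p = q K p - g K * bubble_poly K p" for K p
  have B_bilinear: "\<exists>a b c d. \<forall>s t. B K (s, t) = a + b * s + c * t + d * (s * t)" if "K \<in> cells m n" for K
  proof -
    from that obtain i j where K: "K = (i, j)" "i < m" "j < n" by (auto simp: cells_def)
    have pos: "0 < X (Suc i) - X i" "0 < Y (Suc j) - Y j"
      using X_less[of i "Suc i"] Y_less[of j "Suc j"] K by simp_all
    have "B K \<in> P 2"
      using P_lincomb[OF bspec[OF q that] bubble_poly_P_2[of K], of 1 "- g K"] by (simp add: B_def[abs_def])
    then obtain a b c d' where
      BK: "\<And>s t. B K (s, t) = a + b * s + c * t + d' * (s * t) + coeff_xx (B K) * s\<^sup>2 + coeff_yy (B K) * t\<^sup>2"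
      using P_2_E by blast
    have lin: "coeff_xx (B K) = coeff_xx (q K) - g K * coeff_xx (bubble_poly K)"
      "coeff_yy (B K) = coeff_yy (q K) - g K * coeff_yy (bubble_poly K)"
      by (simp_all add: B_def coeff_xx_def coeff_yy_def field_simps)
    have g: "g K = - (coeff_xx (q K) * (X (Suc i) - X i)\<^sup>2)" "g K = - (coeff_yy (q K) * (Y (Suc j) - Y j)\<^sup>2)"
      using de[of "Suc i" "Suc j"] K by (simp_all add: g_def d_def e_def shifted_def)
    have "coeff_xx (B K) = 0" unfolding lin(1) g(1) using pos by (simp add: K coeff_bubble_poly)
    moreover have "coeff_yy (B K) = 0" unfolding lin(2) g(2) using pos by (simp add: K coeff_bubble_poly)
    ultimately show ?thesis using BK by auto
  qed
  \<comment> \<open>The bubble is -1/6 at the vertices of its cell, so removing \<open>g K\<close>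
    times the bubble subtracts \<open>d / 6\<close> there, exactly the correction contained in
    \<open>U\<close>.\<close>
  have B_corner: "B (i, j) (X i', Y j') = U i' j'"
    if "i < m" "j < n" "i' = i \<or> i' = Suc i" "j' = j \<or> j' = Suc j" for i j i' j'
  proof -
    have "bubble_poly (i, j) (X i', Y j') = - 1 / 6" using that by (auto simp: bubble_poly_def)
    then have "B (i, j) (X i', Y j') = q (i, j) (X i', Y j') - d (Suc i) (Suc j) / 6"
      by (simp add: B_def g_def)
    also have "\<dots> = U i' j'"
      using corner[of i' j' "Suc i" "Suc j"] that by (auto simp: shifted_def)
    finally show ?thesis .
  qed
  define h where "h = (\<lambda>p. \<Sum>c\<in>{0<..<m} \<times> {0<..<n}. U (fst c) (snd c) *
      (hat (X (fst c - 1)) (X (fst c)) (X (Suc (fst c))) (fst p) *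
       hat (Y (snd c - 1)) (Y (snd c)) (Y (Suc (snd c))) (snd p)))"
  have h_cell: "h (s, t) = B (i, j) (s, t)"
    if ij: "i < m" "j < n" and st: "X i < s" "s < X (Suc i)" "Y j < t" "t < Y (Suc j)" for i j s t
  proof -
    have "(i, j) \<in> cells m n" using ij by (simp add: cells_def)
    from B_bilinear[OF this] obtain a b c d' where
      "\<And>s t. B (i, j) (s, t) = a + b * s + c * t + d' * (s * t)" by blast
    note bilinear_interpolation[OF this, of "X i" "X (Suc i)" "Y j" "Y (Suc j)" s t]
    then show ?thesis
      using nodal_interpolant_in_H10(3)[OF U0 ij st] st B_corner[OF ij] unfolding h_def by simp
  qed
  have "ae_class h \<in> V_BL \<Omega> m n X Y"
    unfolding V_BL_def
  proof (intro CollectI conjI ballI)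
    show "ae_class h \<in> H10 \<Omega>" unfolding h_def by (rule nodal_interpolant_in_H10(1)[OF U0])
    fix K assume K: "K \<in> cells m n"
    then obtain i j where ij: "K = (i, j)" "i < m" "j < n" by (auto simp: cells_def)
    have "AE p in lborel. p \<in> cell X Y K \<longrightarrow> h p = B K p"
      using AE_off_grid_lines
    proof eventually_elim
      case (elim p)
      obtain s t where p: "p = (s, t)" by (cases p)
      show ?case using elim cell_off_grid[of s t i j] h_cell[of i j s t] ij unfolding p by auto
    qed
    then show "\<exists>q\<in>Q 1. agrees_on (ae_class h) (cell X Y K) q"
      using B_bilinear[OF K] unfolding agrees_on_ae_class Q_1_iff[symmetric] by blast
  qed
  \<comment> \<open>The identity of classes is checked pointwise off the grid lines: inside
    \<open>\<Omega>\<close> on the one cell containing the point, outside with every term 0.\<close>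
  moreover have "w = ae_class h + (\<Sum>K\<in>cells m n. g K *\<^sub>R ae_class (bubble X Y K))"
  proof -
    have "AE p in lborel. \<forall>K\<in>cells m n. p \<in> cell X Y K \<longrightarrow> f p = q K p"
      using agrees unfolding f agrees_on_ae_class by (intro eventually_ball_finite finite_cells)
    then have "AE p in lborel. f p = h p + (\<Sum>K\<in>cells m n. g K * bubble X Y K p)"
      using AE_off_grid_lines
    proof eventually_elim
      case (elim p)
      obtain s t where p: "p = (s, t)" by (cases p)
      show ?case
      proof (cases "p \<in> \<Omega>")
        case True
        then have st: "X 0 < s" "s < X m" "Y 0 < t" "t < Y n" by (auto simp: \<Omega>_eq p box_Pair)
        have "s \<noteq> X i" if "i \<le> m" for i using elim(2) that by (simp add: p)
        then obtain i where i: "i < m" "X i < s" "s < X (Suc i)" using grid_interval_exists[OF st(1,2)] by blast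
        have "t \<noteq> Y j" if "j \<le> n" for j using elim(2) that by (simp add: p)
        then obtain j where j: "j < n" "Y j < t" "t < Y (Suc j)" using grid_interval_exists[OF st(3,4)] by blast
        have "(i, j) \<in> cells m n" "p \<in> cell X Y (i, j)" using i j by (simp_all add: cells_def p cbox_Pair)
        then have "f p = q (i, j) p" using elim(1) by blast
        then show ?thesis
          unfolding p sum_bubbles[OF i(2,3) j(2,3) i(1) j(1)] h_cell[OF i(1) j(1) i(2,3) j(2,3)]
          by (simp add: B_def)
      next
        case False
        have "h p = 0" unfolding h_def by (rule nodal_interpolant_in_H10(2)[OF U0 False])
        moreover have "bubble X Y K p = 0" if "K \<in> cells m n" for K
          using cell_off_grid_subset[of p K] elim(2) that False by (auto simp: bubble_eq)
        ultimately show ?thesis using sq_integrableD(2)[OF f(2) False] by simp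
      qed
    qed
    then have "w = ae_class (\<lambda>p. h p + (\<Sum>K\<in>cells m n. g K * bubble X Y K p))"
      unfolding f ae_class_eq_iff .
    then show ?thesis
      using ae_class_lincomb[of 1 h 1 "\<lambda>p. \<Sum>K\<in>cells m n. g K * bubble X Y K p"]
      by (simp add: ae_class_sum)
  qed
  ultimately show ?thesis using that by blast
qed

text \<open>On a cell \<open>w\<close> is bilinear and also \<open>g K\<close> times the bubble. A
  second difference in the first variable annihilates bilinear functions but not the bubble.\<close>

lemma V_BL_bubbles_zero:
  assumes w: "w \<in> V_BL \<Omega> m n X Y" "w = (\<Sum>K\<in>cells m n. g K *\<^sub>R ae_class (bubble X Y K))"
    and K: "K \<in> cells m n"
  shows "g K = 0"
proof -
  obtain i j where ij: "K = (i, j)" "i < m" "j < n" using K by (auto simp: cells_def)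
  obtain r where r: "r \<in> Q 1" "agrees_on w (cell X Y K) r" using V_BL_D(2)[OF w(1) K] by blast
  have "AE p in lborel. p \<in> cell X Y K \<longrightarrow> (\<Sum>K\<in>cells m n. g K * bubble X Y K p) = r p"
    using r(2) unfolding w(2) ae_class_sum[symmetric] agrees_on_ae_class .
  define U where "U = box (X i, Y j) (X (Suc i), Y (Suc j))"
  have eq: "r p = g K * bubble_poly K p" if "p \<in> U" for p
  proof (rule AE_eq_on_open[of U])
    show "open U" by (simp add: U_def open_box)
    show "continuous_on U r" using r(1) Q_1_subset_P_2 by (intro continuous_on_P_2) blast
    show "continuous_on U (\<lambda>p. g K * bubble_poly K p)"
      by (intro continuous_intros continuous_on_P_2 bubble_poly_P_2)
    show "AE p in lborel. p \<in> U \<longrightarrow> r p = g K * bubble_poly K p"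
      using \<open>AE p in lborel. p \<in> cell X Y K \<longrightarrow> (\<Sum>K\<in>cells m n. g K * bubble X Y K p) = r p\<close>
    proof eventually_elim
      case (elim p)
      obtain s t where p: "p = (s, t)" by (cases p)
      show ?case
      proof
        assume "p \<in> U"
        then have st: "X i < s" "s < X (Suc i)" "Y j < t" "t < Y (Suc j)" by (auto simp: U_def p box_Pair)
        then have "p \<in> cell X Y K" by (simp add: ij p cbox_Pair)
        then show "r p = g K * bubble_poly K p"
          using elim sum_bubbles[OF st ij(2,3), of g] by (simp only: p ij)
      qed
    qed
  qed (fact that)
  \<comment> \<open>The centre of the cell and a quarter of its width as step: all three points lie
    in the open cell, where the two continuous expressions agree pointwise.\<close>
  define x y \<xi> where "x = (X i + X (Suc i)) / 2" and "y = (Y j + Y (Suc j)) / 2" and "\<xi> = X (Suc i) - X i"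
  have pos: "0 < \<xi>" "X i < X (Suc i)" "Y j < Y (Suc j)"
    using X_less[of i "Suc i"] Y_less[of j "Suc j"] ij by (simp_all add: \<xi>_def)
  have mem: "(x, y) \<in> U" "(x + \<xi> / 4, y) \<in> U" "(x - \<xi> / 4, y) \<in> U"
    using pos unfolding U_def box_Pair x_def y_def \<xi>_def by (auto simp: field_simps)
  obtain a b c d where "\<And>s t. r (s, t) = a + b * s + c * t + d * (s * t)"
    using r(1) unfolding Q_1_iff by blast
  then have "r (x + \<xi> / 4, y) + r (x - \<xi> / 4, y) - 2 * r (x, y) = 0" by (simp add: algebra_simps)
  then have "g K * (bubble_poly K (x + \<xi> / 4, y) + bubble_poly K (x - \<xi> / 4, y) - 2 * bubble_poly K (x, y)) = 0"
    unfolding eq[OF mem(1)] eq[OF mem(2)] eq[OF mem(3)] by (simp add: algebra_simps)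
  \<comment> \<open>Twice the coefficient \<open>- 1 / \<xi>^2\<close> times the squared step
    \<open>\<xi>^2 / 16\<close>.\<close>
  moreover have "bubble_poly K (x + \<xi> / 4, y) + bubble_poly K (x - \<xi> / 4, y) - 2 * bubble_poly K (x, y) = - (1 / 8)"
  proof -
    define Z where "Z = (y - Y j) * (Y (Suc j) - y) / (Y (Suc j) - Y j)\<^sup>2"
    have b: "bubble_poly K (x + \<sigma> * \<xi>, y) = (1 / 2 + \<sigma>) * (1 / 2 - \<sigma>) + Z - 1 / 6" for \<sigma>
    proof -
      have "x + \<sigma> * \<xi> - X i = (1 / 2 + \<sigma>) * \<xi>" "X (Suc i) - (x + \<sigma> * \<xi>) = (1 / 2 - \<sigma>) * \<xi>"
        by (simp_all add: x_def \<xi>_def field_simps)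
      then have "bubble_poly K (x + \<sigma> * \<xi>, y) = ((1 / 2 + \<sigma>) * \<xi>) * ((1 / 2 - \<sigma>) * \<xi>) / \<xi>\<^sup>2 + Z - 1 / 6"
        by (simp add: bubble_poly_def ij Z_def flip: \<xi>_def)
      then show ?thesis using pos(1) by (simp add: power2_eq_square)
    qed
    show ?thesis using b[of 0] b[of "1 / 4"] b[of "- 1 / 4"] by simp
  qed
  ultimately show ?thesis by simp
qed

end

theorem theoremA7:
  fixes \<Omega> :: "(real \<times> real) set" and m n :: nat and X Y :: "nat \<Rightarrow> real"
  assumes "rectangular_subdivision \<Omega> m n X Y"
  shows "direct_sum (V_MC \<Omega> m n X Y) (V_BL \<Omega> m n X Y)
           (span ((\<lambda>K. ae_class (bubble X Y K)) ` cells m n))"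
proof -
  interpret grid \<Omega> m n X Y by unfold_locales (rule assms)
  let ?W = "span ((\<lambda>K. ae_class (bubble X Y K)) ` cells m n)"
  \<comment> \<open>Explicit coefficients serve both for the intersection, where they are shown to
    be 0, and for the decomposition, where they are constructed.\<close>
  have W: "?W = range (\<lambda>g. \<Sum>K\<in>cells m n. g K *\<^sub>R ae_class (bubble X Y K))"
    by (rule span_image_eq[OF finite_cells])
  have "V_BL \<Omega> m n X Y \<inter> ?W \<subseteq> {0}"
  proof
    fix w assume "w \<in> V_BL \<Omega> m n X Y \<inter> ?W"
    then obtain g where w: "w \<in> V_BL \<Omega> m n X Y" "w = (\<Sum>K\<in>cells m n. g K *\<^sub>R ae_class (bubble X Y K))"
      unfolding W by blast
    show "w \<in> {0}" using V_BL_bubbles_zero[OF w] unfolding w(2) by (simp add: sum.neutral)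
  qed
  moreover have "0 \<in> V_BL \<Omega> m n X Y \<inter> ?W"
    using subspace_0[OF subspace_V_BL] span_zero by blast
  moreover have "?W \<subseteq> V_MC \<Omega> m n X Y"
    using bubble_in_V_MC by (intro span_minimal subspace_V_MC) blast
  then have "{v + w | v w. v \<in> V_BL \<Omega> m n X Y \<and> w \<in> ?W} \<subseteq> V_MC \<Omega> m n X Y"
    using V_BL_subset_V_MC subspace_add[OF subspace_V_MC] by blast
  moreover have "V_MC \<Omega> m n X Y \<subseteq> {v + w | v w. v \<in> V_BL \<Omega> m n X Y \<and> w \<in> ?W}"
  proof
    fix w assume "w \<in> V_MC \<Omega> m n X Y"
    then obtain v g where "v \<in> V_BL \<Omega> m n X Y" "w = v + (\<Sum>K\<in>cells m n. g K *\<^sub>R ae_class (bubble X Y K))"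
      by (rule V_MC_decompose)
    then show "w \<in> {v + w | v w. v \<in> V_BL \<Omega> m n X Y \<and> w \<in> ?W}" unfolding W by blast
  qed
  ultimately show ?thesis
    unfolding direct_sum_def using subspace_V_BL subspace_span by blast
qed

end
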